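(* Let $d\ge 1$ and $n\ge 1$. The set of strictly hyperbolic polynomials $p\in\mathcal{F}_{\mathbb{R}}$ such that $N_s(p)\in\mathcal{H}^\circ$ for all $s\in(0,1]$ is dense in $\mathcal{H}$. More precisely, the complement of this set in $\mathcal{H}$ is a semialgebraic subset of positive codimension in $\mathcal{F}_{\mathbb{R}}$.
   Context: Fix $d,n\ge 1$ and write $x=(x_1,\dots,x_n)$. Let $\mathcal{F}_{\mathbb{R}}$ be the set of polynomials $p\in\mathbb{R}[t,x]$ that are homogeneous of total degree $d$ and satisfy $p(1,0,\dots,0)=1$, a finite-dimensional real affine space with its Euclidean topology. A polynomial $p\in\mathcal{F}_{\mathbb{R}}$ is hyperbolic if for every $u\in\mathbb{R}^n$ all roots of $p(t,u)\in\mathbb{R}[t]$ are real, and strictly hyperbolic if moreover these roots are distinct for every $u\in\mathbb{R}^n$, $u\ne 0$. $\mathcal{H}$ is the set of hyperbolic polynomials, and $\mathcal{H}^\circ$ the set of $p\in\mathcal{H}$ for which the complex projective variety $\mathcal{V}_{\mathbb{C}}(p)\subset\mathbb{P}^n(\mathbb{C})$ defined by $p$ is smooth. For a linear form $\ell\in\mathbb{R}[x]$ and $s\in\mathbb{R}$ define linear operators on $\mathbb{R}[t,x]$ by $T^\ell_s(p)=p+s\,\ell\,\frac{\partial p}{\partial t}$, $G_s(p)=p(t,sx)$, $F_s=(T^{x_1}_s)^d\cdots(T^{x_n}_s)^d$, and $N_s=F_{1-s}G_s$. They map $\mathcal{F}_{\mathbb{R}}$ to itself. *)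

theory Defs
  imports
    "HOL-Analysis.Analysis"
    "HOL-Algebra.QuotRing"
    "HOL-Computational_Algebra.Polynomial"
    "HOL-Library.Poly_Mapping"
begin

section \<open>Multivariate polynomials\<close>

text \<open>A monomial is its exponent vector; a polynomial is its finitely supported family of
  coefficients. The ring structure is the convolution product of \<^theory>\<open>HOL-Library.Poly_Mapping\<close>.\<close>

type_synonym ('v, 'a) mpoly = "('v \<Rightarrow>\<^sub>0 nat) \<Rightarrow>\<^sub>0 'a"

definition mdeg :: "('v \<Rightarrow>\<^sub>0 nat) \<Rightarrow> nat" where
  "mdeg m = (\<Sum>v\<in>Poly_Mapping.keys m. Poly_Mapping.lookup m v)"

definition mconst :: "'a::zero \<Rightarrow> ('v, 'a) mpoly" where
  "mconst c = Poly_Mapping.single 0 c"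

definition mvar :: "'v \<Rightarrow> ('v, 'a::zero_neq_one) mpoly" where
  "mvar v = Poly_Mapping.single (Poly_Mapping.single v 1) 1"

definition mpolys_in :: "'v set \<Rightarrow> ('v, 'a::zero) mpoly set" where
  "mpolys_in V = {p. \<forall>m\<in>Poly_Mapping.keys p. Poly_Mapping.keys m \<subseteq> V}"

text \<open>Substitution of \<open>a v\<close> for the variable \<open>v\<close>, where \<open>h\<close> is the map (in all uses a ring
  homomorphism) carrying the coefficients to the target ring.\<close>

definition mpoly_subst ::
  "('a::zero \<Rightarrow> 'b::comm_semiring_1) \<Rightarrow> ('v \<Rightarrow> 'b) \<Rightarrow> ('v, 'a) mpoly \<Rightarrow> 'b" where
  "mpoly_subst h a p = (\<Sum>m\<in>Poly_Mapping.keys p. h (Poly_Mapping.lookup p m) *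
     (\<Prod>v\<in>Poly_Mapping.keys m. a v ^ Poly_Mapping.lookup m v))"

text \<open>Partial derivative with respect to \<open>v\<close>; the truncated subtraction of exponents is harmless,
  since the coefficient is \<open>0\<close> when \<open>v\<close> does not occur in \<open>m\<close>.\<close>

definition mpderiv :: "'v \<Rightarrow> ('v, 'a::comm_semiring_1) mpoly \<Rightarrow> ('v, 'a) mpoly" where
  "mpderiv v p = (\<Sum>m\<in>Poly_Mapping.keys p.
     Poly_Mapping.single (m - Poly_Mapping.single v 1)
       (of_nat (Poly_Mapping.lookup m v) * Poly_Mapping.lookup p m))"


section \<open>Hyperbolic polynomials\<close>

text \<open>Variable \<open>0\<close> is \<open>t\<close>, and variable \<open>i\<close> with \<open>1 \<le> i \<le> n\<close> is \<open>x\<^sub>i\<close>. Points of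
  \<open>\<real>\<^sup>n\<close> are functions on \<open>nat\<close> whose values outside \<open>{1..n}\<close> play no role; likewise for
  \<open>\<complex>\<^sup>n\<^sup>+\<^sup>1\<close> and \<open>{0..n}\<close>.\<close>

definition FR :: "nat \<Rightarrow> nat \<Rightarrow> (nat, real) mpoly set" where
  "FR n d = {p \<in> mpolys_in {0..n}.
     (\<forall>m\<in>Poly_Mapping.keys p. mdeg m = d) \<and>
     mpoly_subst (\<lambda>c. c) (\<lambda>i. if i = 0 then 1 else 0) p = 1}"

text \<open>The univariate polynomial \<open>p(t,u)\<close>, viewed over the complex numbers.\<close>

definition fibre :: "(nat, real) mpoly \<Rightarrow> (nat \<Rightarrow> real) \<Rightarrow> complex poly" where
  "fibre p u = mpoly_subst (\<lambda>c. [:of_real c:]) (\<lambda>i. if i = 0 then [:0, 1:] else [:of_real (u i):]) p"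

definition hyperbolic :: "(nat, real) mpoly \<Rightarrow> bool" where
  "hyperbolic p \<longleftrightarrow> (\<forall>u z. poly (fibre p u) z = 0 \<longrightarrow> z \<in> \<real>)"

definition strictly_hyperbolic :: "nat \<Rightarrow> (nat, real) mpoly \<Rightarrow> bool" where
  "strictly_hyperbolic n p \<longleftrightarrow> hyperbolic p \<and>
     (\<forall>u z. (\<exists>i\<in>{1..n}. u i \<noteq> 0) \<longrightarrow> poly (fibre p u) z = 0 \<longrightarrow>
        Polynomial.order z (fibre p u) = 1)"

definition Hyp :: "nat \<Rightarrow> nat \<Rightarrow> (nat, real) mpoly set" where
  "Hyp n d = {p \<in> FR n d. hyperbolic p}"

text \<open>Smoothness of the hypersurface of \<open>\<P>\<^sup>n(\<complex>)\<close> defined by \<open>p\<close>, in homogeneous coordinates: no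
  zero of \<open>p\<close> is a zero of all its partial derivatives.\<close>

definition smooth_hypersurface :: "nat \<Rightarrow> (nat, real) mpoly \<Rightarrow> bool" where
  "smooth_hypersurface n p \<longleftrightarrow>
     (\<forall>z::nat \<Rightarrow> complex. (\<exists>i\<in>{0..n}. z i \<noteq> 0) \<longrightarrow> mpoly_subst of_real z p = 0 \<longrightarrow>
        (\<exists>i\<in>{0..n}. mpoly_subst of_real z (mpderiv i p) \<noteq> 0))"

definition Hyp_smooth :: "nat \<Rightarrow> nat \<Rightarrow> (nat, real) mpoly set" where
  "Hyp_smooth n d = {p \<in> Hyp n d. smooth_hypersurface n p}"


section \<open>The operators\<close>

definition T_op :: "(nat, real) mpoly \<Rightarrow> real \<Rightarrow> (nat, real) mpoly \<Rightarrow> (nat, real) mpoly" where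
  "T_op l s p = p + mconst s * l * mpderiv 0 p"

definition G_op :: "real \<Rightarrow> (nat, real) mpoly \<Rightarrow> (nat, real) mpoly" where
  "G_op s p = mpoly_subst mconst (\<lambda>i. if i = 0 then mvar 0 else mconst s * mvar i) p"

definition F_op :: "nat \<Rightarrow> nat \<Rightarrow> real \<Rightarrow> (nat, real) mpoly \<Rightarrow> (nat, real) mpoly" where
  "F_op n d s = foldr (\<lambda>i g. (T_op (mvar i) s ^^ d) \<circ> g) [1..<Suc n] id"

definition N_op :: "nat \<Rightarrow> nat \<Rightarrow> real \<Rightarrow> (nat, real) mpoly \<Rightarrow> (nat, real) mpoly" where
  "N_op n d s = F_op n d (1 - s) \<circ> G_op s"


section \<open>Semialgebraic sets and their dimension\<close>

text \<open>Affine space \<open>\<real>\<^sup>I\<close>, for a finite set \<open>I\<close> of coordinates, consists of the functions extensional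
  on \<open>I\<close>. Its semialgebraic subsets are the Boolean algebra generated by the sets \<open>{f > 0}\<close>.\<close>

abbreviation affine_space :: "'i set \<Rightarrow> ('i \<Rightarrow> real) set" where
  "affine_space I \<equiv> (\<Pi>\<^sub>E i\<in>I. UNIV)"

inductive semialgebraic :: "'i set \<Rightarrow> ('i \<Rightarrow> real) set \<Rightarrow> bool" for I where
  pos: "f \<in> mpolys_in I \<Longrightarrow> semialgebraic I {x \<in> affine_space I. mpoly_subst (\<lambda>c. c) x f > 0}"
| un: "semialgebraic I A \<Longrightarrow> semialgebraic I B \<Longrightarrow> semialgebraic I (A \<union> B)"
| compl: "semialgebraic I A \<Longrightarrow> semialgebraic I (affine_space I - A)"

definition polynomial_ring :: "'i set \<Rightarrow> ('i, real) mpoly ring" where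
  "polynomial_ring I =
     \<lparr>carrier = mpolys_in I, mult = (*), one = 1, zero = 0, add = (+)\<rparr>"

definition vanishing_ideal :: "'i set \<Rightarrow> ('i \<Rightarrow> real) set \<Rightarrow> ('i, real) mpoly set" where
  "vanishing_ideal I A = {f \<in> mpolys_in I. \<forall>x\<in>A. mpoly_subst (\<lambda>c. c) x f = 0}"

text \<open>The zero ring has no prime ideals, and hence Krull dimension \<open>-\<infinity>\<close>.\<close>

definition krull_dim :: "('a, 'b) ring_scheme \<Rightarrow> ereal" where
  "krull_dim R = Sup {ereal (real k) | k.
     \<exists>P. (\<forall>i\<le>k. primeideal (P i) R) \<and> (\<forall>i<k. P i \<subset> P (Suc i))}"

text \<open>The dimension of a semialgebraic set as in Bochnak, Coste and Roy, Real Algebraic Geometry,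
  Section 2.8: the Krull dimension of \<open>\<real>[I] / \<I>(A)\<close>.\<close>

definition semialg_dim :: "'i set \<Rightarrow> ('i \<Rightarrow> real) set \<Rightarrow> ereal" where
  "semialg_dim I A = krull_dim (polynomial_ring I Quot vanishing_ideal I A)"


section \<open>The affine space of normalised homogeneous polynomials\<close>

text \<open>An element of \<open>FR n d\<close> has coefficient \<open>1\<close> at \<open>t\<^sup>d\<close>; the coefficients at the other
  monomials of degree \<open>d\<close> are arbitrary, and are affine coordinates on \<open>FR n d\<close>.\<close>

definition coord_monomials :: "nat \<Rightarrow> nat \<Rightarrow> (nat \<Rightarrow>\<^sub>0 nat) set" where
  "coord_monomials n d =
     {m. Poly_Mapping.keys m \<subseteq> {0..n} \<and> mdeg m = d} - {Poly_Mapping.single 0 d}"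

definition coords :: "nat \<Rightarrow> nat \<Rightarrow> (nat, real) mpoly \<Rightarrow> (nat \<Rightarrow>\<^sub>0 nat) \<Rightarrow> real" where
  "coords n d p = restrict (Poly_Mapping.lookup p) (coord_monomials n d)"

definition FR_topology :: "nat \<Rightarrow> nat \<Rightarrow> (nat, real) mpoly topology" where
  "FR_topology n d = pullback_topology (FR n d) (coords n d)
     (product_topology (\<lambda>_. euclideanreal) (coord_monomials n d))"

definition semialgebraic_in_FR :: "nat \<Rightarrow> nat \<Rightarrow> (nat, real) mpoly set \<Rightarrow> bool" where
  "semialgebraic_in_FR n d A \<longleftrightarrow>
     A \<subseteq> FR n d \<and> semialgebraic (coord_monomials n d) (coords n d ` A)"

definition positive_codim_in_FR :: "nat \<Rightarrow> nat \<Rightarrow> (nat, real) mpoly set \<Rightarrow> bool" where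
  "positive_codim_in_FR n d A \<longleftrightarrow>
     semialg_dim (coord_monomials n d) (coords n d ` A)
       < semialg_dim (coord_monomials n d) (coords n d ` FR n d)"

definition good_set :: "nat \<Rightarrow> nat \<Rightarrow> (nat, real) mpoly set" where
  "good_set n d = {p \<in> FR n d. strictly_hyperbolic n p \<and>
     (\<forall>s\<in>{0<..1}. N_op n d s p \<in> Hyp_smooth n d)}"

end

theory Submission
  imports Defs "HOL-Computational_Algebra.Fundamental_Theorem_Algebra"
begin

text \<open>Call \<open>p\<close> in \<open>Hyp n d\<close> bad if it is not strictly hyperbolic or if \<open>N_op n d s p\<close> is singular for some
  \<open>s\<close> in \<open>(0, 1]\<close>. By Tarski and Seidenberg the bad polynomials form a semialgebraic set. They lie in a
  hypersurface, for the following reasons.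

  By Nuij's argument, \<open>F_op n d e p\<close> is strictly hyperbolic for \<open>e \<noteq> 0\<close>, and it tends to \<open>p\<close>; so \<open>p\<close> lies on
  the boundary of the semialgebraic set of hyperbolic, not strictly hyperbolic polynomials if it belongs to
  it, and off a hypersurface a semialgebraic set has no boundary.

  \<open>N_op n d s p\<close> is \<open>F_op n d \<tau> p\<close> with \<open>\<tau> = (1 - s) / s\<close>, up to a scaling of the coordinates. If \<open>p\<close> is
  strictly hyperbolic, a singular point of the latter is not real, and a real change of coordinates with \<open>2 n\<close>
  parameters moves it to a point with the coordinates \<open>1\<close>, \<open>\<i>\<close> and otherwise \<open>0\<close>. Singularity there determines
  \<open>2 n + 2\<close> of the coefficients. As \<open>F_op n d \<tau>\<close> has an inverse that is polynomial in \<open>\<tau>\<close>, such \<open>p\<close> form the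
  image of a polynomial map whose source has one dimension less than \<open>FR n d\<close>, and counting monomials gives
  an algebraic relation between its components.

  For the density, \<open>p\<close> is first replaced by \<open>F_op n d e p\<close>, which can then be moved off the hypersurface
  along a line, as being strictly hyperbolic is an open condition.\<close>

section \<open>The Cauchy index of two real polynomials\<close>

text \<open>A count shows why the singular points have to be nonreal. Singular real polynomials can
  fill a set of codimension 1, as the discriminant does, so a union over the parameter
  \<open>s\<close> could have interior. A nonreal singular point imposes \<open>n + 1\<close>
  independent complex equations, hence \<open>2 n + 2\<close> real ones, while such points depend on
  \<open>2 n\<close> real parameters: codimension 2, which survives one further parameter. The point
  is moved to a fixed one because the equations there are linear in the coefficients, with constant
  factors, and can be solved explicitly; no implicit function theorem enters. The explicit solution
  needs \<open>d \<ge> 3\<close>; below that, a conjugate pair of singular points forces a real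
  double root. \<open>F_op\<close> replaces \<open>N_op\<close> because \<open>N_op n d s\<close>
  degenerates as \<open>s\<close> tends to \<open>0\<close>, whereas \<open>F_op n d \<tau>\<close>
  is unipotent for every \<open>\<tau>\<close>. As dimension means Krull dimension, one nonzero
  polynomial vanishing on the bad set suffices, provided that the ambient dimension is finite; this
  again follows from counting monomials.\<close>

definition local_coeff :: "real poly \<Rightarrow> real \<Rightarrow> real" where
  "local_coeff p a = poly (p div [:-a, 1:] ^ Polynomial.order a p) a"

text \<open>Identifies \<open>local_coeff p a\<close> as the lowest Taylor coefficient of
  \<open>p\<close> at \<open>a\<close>. Together with the parity of the order it decides the signs
  of \<open>p\<close> on both sides of \<open>a\<close>.\<close>

lemma local_coeff_decomp:
  assumes "p \<noteq> 0"
  obtains q where "p = [:-a, 1:] ^ Polynomial.order a p * q" "poly q a \<noteq> 0" "local_coeff p a = poly q a"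
proof -
  obtain q where q: "p = [:-a, 1:] ^ Polynomial.order a p * q" "\<not> [:-a, 1:] dvd q"
    using order_decomp[OF assms] by blast
  have "p div [:-a, 1:] ^ Polynomial.order a p = q"
    using q(1) by (metis nonzero_mult_div_cancel_left pCons_eq_0_iff power_not_zero zero_neq_one)
  then show ?thesis using that[of q] q by (simp add: local_coeff_def poly_eq_0_iff_dvd)
qed

lemma local_coeff_unique:
  assumes "p = [:-a, 1:] ^ k * q" "poly q a \<noteq> 0"
  shows "Polynomial.order a p = k" "local_coeff p a = poly q a" "p \<noteq> 0"
proof -
  show p0: "p \<noteq> 0" using assms by auto
  show k: "Polynomial.order a p = k"
  proof -
    have "\<not> [:-a, 1:] ^ Suc k dvd p"
    proof
      assume "[:-a, 1:] ^ Suc k dvd p"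
      then have "[:-a, 1:] ^ k * [:-a, 1:] dvd [:-a, 1:] ^ k * q"
        using assms(1) by (simp only: power_Suc2)
      then have "[:-a, 1:] dvd q"
        by (subst (asm) dvd_times_left_cancel_iff) auto
      with assms(2) show False by (simp add: poly_eq_0_iff_dvd)
    qed
    then show ?thesis using order_unique_lemma[of a k p] assms(1) by auto
  qed
  have "p div [:-a, 1:] ^ k = q"
    using assms(1) by (metis nonzero_mult_div_cancel_left pCons_eq_0_iff power_not_zero zero_neq_one)
  then show "local_coeff p a = poly q a" by (simp add: local_coeff_def k)
qed

lemma local_coeff_nonzero: "p \<noteq> 0 \<Longrightarrow> local_coeff p a \<noteq> 0"
  by (metis local_coeff_decomp)

lemma local_coeff_mult:
  assumes "p \<noteq> 0" "q \<noteq> 0"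
  shows "local_coeff (p * q) a = local_coeff p a * local_coeff q a"
proof -
  obtain p' where p': "p = [:-a, 1:] ^ Polynomial.order a p * p'" "poly p' a \<noteq> 0" "local_coeff p a = poly p' a"
    using local_coeff_decomp[OF assms(1)] .
  obtain q' where q': "q = [:-a, 1:] ^ Polynomial.order a q * q'" "poly q' a \<noteq> 0" "local_coeff q a = poly q' a"
    using local_coeff_decomp[OF assms(2)] .
  have "p * q = [:-a, 1:] ^ (Polynomial.order a p + Polynomial.order a q) * (p' * q')"
    by (subst p'(1), subst q'(1)) (simp add: power_add algebra_simps)
  from local_coeff_unique(2)[OF this] p' q' show ?thesis by simp
qed

section \<open>Signs at infinity and total sign change\<close>

lemma sgn_poly_eq_sgn_lead_coeff:
  fixes p :: "real poly"
  assumes "\<And>x. x \<ge> a \<Longrightarrow> poly p x \<noteq> 0"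
  shows "sgn (poly p a) = sgn (lead_coeff p)"
proof -
  have pos: "poly q a > 0" if q: "\<And>x. x \<ge> a \<Longrightarrow> poly q x \<noteq> 0" and lq: "lead_coeff q > 0" for q :: "real poly"
  proof (rule ccontr)
    assume "\<not> poly q a > 0"
    with q[of a] have neg: "poly q a < 0" by auto
    obtain n where n: "\<forall>x\<ge>n. poly q x \<ge> lead_coeff q" using poly_pinfty_gt_lc[OF lq] by blast
    define b where "b = max n (a + 1)"
    have "poly q b > 0" using n lq by (metis b_def less_le_trans max.cobounded1)
    moreover have "a < b" by (simp add: b_def)
    ultimately obtain x where "a < x" "x < b" "poly q x = 0" using poly_IVT_pos[of a b q] neg by blast
    with q[of x] show False by auto
  qed
  have p0: "lead_coeff p \<noteq> 0" using assms[of a] by auto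
  show ?thesis
  proof (cases "lead_coeff p > 0")
    case True with pos[of p] assms show ?thesis by auto
  next
    case False
    with p0 have "lead_coeff p < 0" by (metis linorder_neqE_linordered_idom)
    then have l: "lead_coeff (- p) > 0" by (simp add: lead_coeff_minus)
    have "poly (- p) a > 0" by (rule pos) (use assms l in auto)
    moreover have "lead_coeff p < 0" using False p0 by (metis linorder_neqE_linordered_idom)
    ultimately show ?thesis by simp
  qed
qed

text \<open>Without a root, the sign at \<open>0\<close> would be the sign at +infinity both of
  \<open>p\<close> and of its reflection, whose leading coefficients are opposite in odd
  degree.\<close>

lemma odd_degree_imp_real_root:
  fixes p :: "real poly"
  assumes "odd (degree p)"
  shows "\<exists>x. poly p x = 0"
proof (rule ccontr)
  assume no: "\<not> ?thesis"
  define q where "q = p \<circ>\<^sub>p [:0, -1:]"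
  have "sgn (poly p 0) = sgn (lead_coeff p)" using no by (intro sgn_poly_eq_sgn_lead_coeff) auto
  moreover have "sgn (poly q 0) = sgn (lead_coeff q)"
    using no by (intro sgn_poly_eq_sgn_lead_coeff) (auto simp: q_def poly_pcompose)
  moreover have "poly q 0 = poly p 0" by (simp add: q_def poly_pcompose)
  moreover have "lead_coeff q = - lead_coeff p" using assms by (simp add: q_def lead_coeff_comp)
  ultimately have "sgn (poly p 0) = 0" by (simp add: sgn_minus)
  with no show False by (auto simp: sgn_zero_iff)
qed

text \<open>Half of the difference between the signs at +infinity and at -infinity, which cancel in
  even degree.\<close>

definition odd_sgn :: "real poly \<Rightarrow> real" where
  "odd_sgn r = (if odd (degree r) then sgn (lead_coeff r) else 0)"

text \<open>A root of odd order contributes half of the sign change of \<open>r\<close> there, so the sum is half of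
  the total sign change of \<open>r\<close> from \<open>-\<infinity>\<close> to \<open>+\<infinity>\<close>.\<close>

lemma sum_sign_changes:
  fixes r :: "real poly"
  assumes "r \<noteq> 0"
  shows "(\<Sum>a | poly r a = 0. if odd (Polynomial.order a r) then sgn (local_coeff r a) else 0) = odd_sgn r"
  using assms
proof (induction "degree r" arbitrary: r rule: less_induct)
  case less
  show ?case
  proof (cases "\<exists>x. poly r x = 0")
    case False
    then have "even (degree r)" using odd_degree_imp_real_root by blast
    with False show ?thesis by (simp add: odd_sgn_def)
  next
    case True
    define R where "R = {x. poly r x = 0}"
    have fin: "finite R" unfolding R_def using poly_roots_finite[OF less.prems] by simp
    \<comment> \<open>Splitting off the largest root keeps the signs under control: the cofactor has
      no root from \<open>a\<close> on, and at every other root the split factor has the sign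
      \<open>(-1) ^ m\<close>.\<close>
    define a where "a = Max R"
    have aR: "a \<in> R" and amax: "\<And>x. x \<in> R \<Longrightarrow> x \<le> a"
      using fin True Max_in[of R] Max_ge[of R] by (auto simp: a_def R_def)
    define m where "m = Polynomial.order a r"
    obtain r1 where r1: "r = [:-a, 1:] ^ m * r1" "poly r1 a \<noteq> 0" "local_coeff r a = poly r1 a"
      using local_coeff_decomp[OF less.prems] m_def by blast
    have r10: "r1 \<noteq> 0" using r1 by auto
    have m0: "m > 0" using aR less.prems by (simp add: m_def R_def order_root)
    have deg: "degree r = m + degree r1"
      by (subst r1(1)) (use r10 in \<open>simp add: degree_mult_eq degree_linear_power\<close>)
    have lc: "lead_coeff r = lead_coeff r1"
      using arg_cong[OF r1(1), of lead_coeff] by (simp add: lead_coeff_mult lead_coeff_power)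
    define R1 where "R1 = {x. poly r1 x = 0}"
    have RR: "R = insert a R1" "a \<notin> R1"
    proof -
      have "poly r x = 0 \<longleftrightarrow> x = a \<or> poly r1 x = 0" for x
        using arg_cong[OF r1(1), of "\<lambda>p. poly p x"] m0 by simp
      then show "R = insert a R1" "a \<notin> R1" using r1(2) by (auto simp: R_def R1_def)
    qed
    have sa: "sgn (poly r1 a) = sgn (lead_coeff r1)"
    proof (rule sgn_poly_eq_sgn_lead_coeff)
      fix x assume "a \<le> x" then show "poly r1 x \<noteq> 0" using amax RR by (force simp: R1_def)
    qed
    have ord: "Polynomial.order x r = Polynomial.order x r1 \<and>
        local_coeff r x = (x - a) ^ m * local_coeff r1 x" if "x \<in> R1" for x
    proof -
      have "x \<noteq> a" using that RR by auto
      then have "[:-a, 1:] ^ m = [:-x, 1:] ^ 0 * [:-a, 1:] ^ m" "poly ([:-a, 1:] ^ m) x \<noteq> 0" by auto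
      note u = local_coeff_unique[OF this]
      have "Polynomial.order x r = Polynomial.order x ([:-a, 1:] ^ m) + Polynomial.order x r1"
        using less.prems by (subst r1(1), subst order_mult) (auto simp: r10)
      moreover have "local_coeff r x = local_coeff ([:-a, 1:] ^ m) x * local_coeff r1 x"
        by (subst r1(1), rule local_coeff_mult) (auto simp: r10)
      ultimately show ?thesis using u by (simp add: add.commute)
    qed
    have IH: "(\<Sum>a\<in>R1. if odd (Polynomial.order a r1) then sgn (local_coeff r1 a) else 0) = odd_sgn r1"
      using less.hyps[of r1] deg m0 r10 by (simp add: R1_def)
    have "(\<Sum>a\<in>R. if odd (Polynomial.order a r) then sgn (local_coeff r a) else 0) =
       (if odd m then sgn (poly r1 a) else 0) +
       (\<Sum>a\<in>R1. if odd (Polynomial.order a r) then sgn (local_coeff r a) else 0)"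
      using RR fin r1(3) by (simp add: m_def)
    also have "(\<Sum>x\<in>R1. if odd (Polynomial.order x r) then sgn (local_coeff r x) else 0) =
        (\<Sum>x\<in>R1. (-1) ^ m * (if odd (Polynomial.order x r1) then sgn (local_coeff r1 x) else 0))"
    proof (rule sum.cong[OF refl])
      fix x assume x: "x \<in> R1"
      have "x < a" using x RR amax[of x] by (cases "x = a") auto
      then have "sgn ((x - a) ^ m) = (-1) ^ m" by (simp add: power_sgn[symmetric])
      then show "(if odd (Polynomial.order x r) then sgn (local_coeff r x) else 0) =
         (-1) ^ m * (if odd (Polynomial.order x r1) then sgn (local_coeff r1 x) else 0)"
        using ord[OF x] by (simp add: sgn_mult)
    qed
    also have "\<dots> = (-1) ^ m * odd_sgn r1" by (simp only: sum_distrib_left[symmetric] IH)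
    finally show ?thesis using sa deg lc by (auto simp: odd_sgn_def R_def)
  qed
qed

text \<open>Half of the sign change of the rational function \<open>q / p\<close> at a pole
  \<open>a\<close>, so \<open>1\<close> for a jump from -infinity to +infinity; a pole of even order
  contributes nothing.\<close>

definition jump :: "real poly \<Rightarrow> real poly \<Rightarrow> real \<Rightarrow> real" where
  "jump p q a =
    (if Polynomial.order a q < Polynomial.order a p \<and> odd (Polynomial.order a p - Polynomial.order a q)
     then sgn (local_coeff p a * local_coeff q a) else 0)"

definition cauchy_index :: "real poly \<Rightarrow> real poly \<Rightarrow> real" where
  "cauchy_index p q = (if p = 0 \<or> q = 0 then 0 else \<Sum>a | poly p a = 0. jump p q a)"

lemma cauchy_index_superset:
  assumes "p \<noteq> 0" "q \<noteq> 0" "finite S" "{a. poly p a = 0} \<subseteq> S"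
  shows "cauchy_index p q = (\<Sum>a\<in>S. jump p q a)"
proof -
  have "(\<Sum>a | poly p a = 0. jump p q a) = (\<Sum>a\<in>S. jump p q a)"
    using assms by (intro sum.mono_neutral_left) (auto simp: jump_def order_root)
  then show ?thesis using assms by (simp add: cauchy_index_def)
qed

text \<open>At each point at most one of \<open>q / p\<close> and \<open>p / q\<close> has a pole,
  and both have the sign of \<open>p * q\<close> around it. So the jumps of the two make up the sign
  changes of \<open>p * q\<close>. This is the exchange step of a Euclidean algorithm for Cauchy
  indices.\<close>

lemma cauchy_index_swap:
  assumes "p \<noteq> 0" "q \<noteq> 0"
  shows "cauchy_index p q + cauchy_index q p = odd_sgn (p * q)"
proof -
  have pq: "p * q \<noteq> 0" using assms by simp
  define S where "S = {a. poly (p * q) a = 0}"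
  have S: "finite S" unfolding S_def using poly_roots_finite[OF pq] by simp
  have "cauchy_index p q + cauchy_index q p = (\<Sum>a\<in>S. jump p q a + jump q p a)"
    using cauchy_index_superset[OF assms S] cauchy_index_superset[OF assms(2,1) S]
    by (simp add: S_def sum.distrib Collect_mono)
  also have "\<dots> = (\<Sum>a\<in>S. if odd (Polynomial.order a (p * q)) then sgn (local_coeff (p * q) a) else 0)"
    by (rule sum.cong)
      (auto simp: jump_def order_mult[OF pq] local_coeff_mult[OF assms] mult.commute)
  also have "\<dots> = odd_sgn (p * q)" unfolding S_def by (rule sum_sign_changes[OF pq])
  finally show ?thesis .
qed

text \<open>Passing from \<open>q\<close> to \<open>c q - A p\<close> multiplies
  \<open>q / p\<close> by a positive number and subtracts a polynomial, which affects no jump. The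
  factor \<open>c\<close> permits reduction without dividing by a leading coefficient.\<close>

lemma jump_reduce:
  assumes "p \<noteq> 0" "q \<noteq> 0" "c > 0" and r: "smult c q - A * p \<noteq> 0"
  shows "jump p (smult c q - A * p) a = jump p q a"
proof (cases "Polynomial.order a q < Polynomial.order a p")
  case True
  obtain p' where p': "p = [:-a, 1:] ^ Polynomial.order a p * p'" "poly p' a \<noteq> 0"
    using local_coeff_decomp[OF assms(1)] by metis
  obtain q' where q': "q = [:-a, 1:] ^ Polynomial.order a q * q'" "poly q' a \<noteq> 0" "local_coeff q a = poly q' a"
    using local_coeff_decomp[OF assms(2)] .
  obtain j where j: "Polynomial.order a p = Polynomial.order a q + Suc j" using True by (metis less_imp_Suc_add add_Suc_right)
  let ?k = "Polynomial.order a q"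
  have "smult c q - A * p = smult c ([:-a, 1:] ^ ?k * q') - A * ([:-a, 1:] ^ (?k + Suc j) * p')"
    using p'(1) q'(1) j by metis
  also have "\<dots> = [:-a, 1:] ^ ?k * (smult c q' - A * [:-a, 1:] ^ Suc j * p')"
    by (simp only: power_add right_diff_distrib mult_smult_right mult_smult_left mult.assoc mult.commute mult.left_commute)
  finally have eq: "smult c q - A * p = [:-a, 1:] ^ ?k * (smult c q' - A * [:-a, 1:] ^ Suc j * p')" .
  have "poly (smult c q' - A * [:-a, 1:] ^ Suc j * p') a = c * poly q' a" by simp
  with local_coeff_unique[OF eq] q' \<open>c > 0\<close>
  have "Polynomial.order a (smult c q - A * p) = ?k" "local_coeff (smult c q - A * p) a = c * local_coeff q a"
    by auto
  then show ?thesis using \<open>c > 0\<close> by (simp add: jump_def sgn_mult)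
next
  case False
  let ?k = "Polynomial.order a p"
  have "[:-a, 1:] ^ ?k dvd p" "[:-a, 1:] ^ ?k dvd q"
    using False order_1[of a p] order_divides[of a ?k q] by auto
  then have "[:-a, 1:] ^ ?k dvd smult c q - A * p" by (simp add: dvd_smult)
  then have "?k \<le> Polynomial.order a (smult c q - A * p)" using r order_divides by blast
  then show ?thesis using False by (auto simp: jump_def)
qed

lemma cauchy_index_reduce:
  assumes "p \<noteq> 0" "q \<noteq> 0" "c > 0"
  shows "cauchy_index p (smult c q - A * p) = cauchy_index p q"
proof (cases "smult c q - A * p = 0")
  case True
  have "smult (inverse c) (smult c q) = smult (inverse c) (A * p)" using True by simp
  then have "q = smult (inverse c) A * p" using \<open>c > 0\<close> by simp
  then have "p dvd q" by (metis dvd_triv_right)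
  then have "jump p q a = 0" for a using dvd_imp_order_le[OF assms(2)] by (auto simp: jump_def not_less)
  then show ?thesis using True by (simp add: cauchy_index_def)
next
  case False
  then show ?thesis using assms by (simp add: cauchy_index_def jump_reduce)
qed

section \<open>Tarski queries\<close>

lemma local_coeff_pderiv:
  assumes "p \<noteq> 0" "poly p a = 0"
  shows "Polynomial.order a p = Suc (Polynomial.order a (pderiv p))"
    "local_coeff (pderiv p) a = of_nat (Polynomial.order a p) * local_coeff p a" "pderiv p \<noteq> 0"
proof -
  obtain m where m: "Polynomial.order a p = Suc m"
    using assms order_root by (metis not0_implies_Suc)
  obtain q where q: "p = [:-a, 1:] ^ Suc m * q" "poly q a \<noteq> 0" "local_coeff p a = poly q a"
    using local_coeff_decomp[OF assms(1)] m by metis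
  have "pderiv p = [:-a, 1:] ^ m * (smult (of_nat (Suc m)) q + [:-a, 1:] * pderiv q)"
  proof -
    define X where "X = [:-a, 1:]"
    have "pderiv X = 1" by (simp add: X_def pderiv_pCons)
    then have "pderiv (X ^ Suc m * q) = X ^ m * (smult (of_nat (Suc m)) q + X * pderiv q)"
      by (simp add: pderiv_mult pderiv_power_Suc algebra_simps del: of_nat_Suc power_Suc) simp
    then show ?thesis using q(1) unfolding X_def by metis
  qed
  note u = local_coeff_unique[OF this]
  have "poly (smult (of_nat (Suc m)) q + [:-a, 1:] * pderiv q) a = of_nat (Suc m) * poly q a"
    by (simp del: of_nat_Suc)
  with u q m show "Polynomial.order a p = Suc (Polynomial.order a (pderiv p))"
    "local_coeff (pderiv p) a = of_nat (Polynomial.order a p) * local_coeff p a" "pderiv p \<noteq> 0"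
    by (auto simp del: of_nat_Suc)
qed

definition tarski_query :: "real poly \<Rightarrow> real poly \<Rightarrow> real" where
  "tarski_query p q = (if p = 0 then 0 else \<Sum>a | poly p a = 0. sgn (poly q a))"

text \<open>The logarithmic derivative of \<open>p\<close> has a simple pole at each root, with the
  multiplicity as its positive residue. After multiplication by \<open>q\<close> the jump is the
  sign of \<open>q\<close> there, and the pole disappears where \<open>q\<close> vanishes.\<close>

lemma tarski_query_eq_cauchy_index: "tarski_query p q = cauchy_index p (pderiv p * q)"
proof (cases "p = 0 \<or> pderiv p * q = 0")
  case True
  then consider "p = 0" | "p \<noteq> 0" "q = 0" | "p \<noteq> 0" "pderiv p = 0" by auto
  then show ?thesis
  proof cases
    case 3
    then have "{a. poly p a = 0} = {}" using local_coeff_pderiv(3) by blast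
    then show ?thesis using 3 by (simp add: tarski_query_def cauchy_index_def)
  qed (auto simp: tarski_query_def cauchy_index_def)
next
  case False
  have "jump p (pderiv p * q) a = sgn (poly q a)" if "poly p a = 0" for a
  proof -
    note l = local_coeff_pderiv[OF _ that]
    have ord: "Polynomial.order a (pderiv p * q) = Polynomial.order a (pderiv p) + Polynomial.order a q"
      using False by (simp add: order_mult)
    show ?thesis
    proof (cases "poly q a = 0")
      case True
      then have "Polynomial.order a q > 0" using False by (simp add: order_root)
      with True show ?thesis using False l ord by (simp add: jump_def)
    next
      case neq: False
      have lq: "local_coeff q a = poly q a" and oq: "Polynomial.order a q = 0"
        using local_coeff_unique[of q a 0 q] neq by auto
      have "sgn (local_coeff p a * local_coeff (pderiv p * q) a) = sgn (poly q a)"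
        using False l local_coeff_nonzero[of p a]
        by (auto simp: local_coeff_mult lq sgn_mult) 
      then show ?thesis using False l ord oq by (simp add: jump_def)
    qed
  qed
  then show ?thesis using False by (simp add: tarski_query_def cauchy_index_def)
qed

section \<open>Quantifier elimination over the reals\<close>

text \<open>Polynomials are represented by the functions they define, generated by closure rules, so
  that polynomial dependence on parameters is established by introduction rules instead of
  computations with coefficients.\<close>

inductive polyfun :: "'v set \<Rightarrow> (('v \<Rightarrow> real) \<Rightarrow> real) \<Rightarrow> bool" for V where
  const: "polyfun V (\<lambda>x. c)"
| var: "v \<in> V \<Longrightarrow> polyfun V (\<lambda>x. x v)"
| add: "polyfun V f \<Longrightarrow> polyfun V g \<Longrightarrow> polyfun V (\<lambda>x. f x + g x)"
| mult: "polyfun V f \<Longrightarrow> polyfun V g \<Longrightarrow> polyfun V (\<lambda>x. f x * g x)"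

lemma polyfun_uminus: "polyfun V f \<Longrightarrow> polyfun V (\<lambda>x. - f x)"
  using polyfun.mult[OF polyfun.const[of V "-1"]] by simp

lemma polyfun_diff: "polyfun V f \<Longrightarrow> polyfun V g \<Longrightarrow> polyfun V (\<lambda>x. f x - g x)"
  using polyfun.add[OF _ polyfun_uminus, of V f g] by simp

lemma polyfun_sum: "(\<And>i. i \<in> I \<Longrightarrow> polyfun V (f i)) \<Longrightarrow> polyfun V (\<lambda>x. \<Sum>i\<in>I. f i x)"
  by (induction I rule: infinite_finite_induct) (auto intro: polyfun.intros)

lemma polyfun_prod: "(\<And>i. i \<in> I \<Longrightarrow> polyfun V (f i)) \<Longrightarrow> polyfun V (\<lambda>x. \<Prod>i\<in>I. f i x)"
  by (induction I rule: infinite_finite_induct) (auto intro: polyfun.intros)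

lemma polyfun_power: "polyfun V f \<Longrightarrow> polyfun V (\<lambda>x. f x ^ k)"
  by (induction k) (auto intro: polyfun.intros)

lemma polyfun_if: "polyfun V f \<Longrightarrow> polyfun V g \<Longrightarrow> polyfun V (\<lambda>x. if b then f x else g x)"
  by (cases b) auto

lemmas polyfun_intros = polyfun.const polyfun.var polyfun.add polyfun.mult polyfun_uminus
  polyfun_diff polyfun_sum polyfun_prod polyfun_power polyfun_if

lemma polyfun_cong:
  "polyfun V f \<Longrightarrow> (\<And>v. v \<in> V \<Longrightarrow> x v = y v) \<Longrightarrow> f x = f y"
  by (induction rule: polyfun.induct) auto

text \<open>A univariate polynomial over the polynomial functions of the parameters. The degree
  bound is uniform, because the parametric Euclidean algorithm descends on it.\<close>

definition param_poly :: "'v set \<Rightarrow> (('v \<Rightarrow> real) \<Rightarrow> real poly) \<Rightarrow> bool" where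
  "param_poly V P \<longleftrightarrow> (\<forall>i. polyfun V (\<lambda>x. coeff (P x) i)) \<and> (\<exists>n. \<forall>x. degree (P x) \<le> n)"

lemma param_poly_coeff: "param_poly V P \<Longrightarrow> polyfun V (\<lambda>x. coeff (P x) i)"
  by (simp add: param_poly_def)

lemma param_poly_monom: "polyfun V f \<Longrightarrow> param_poly V (\<lambda>x. monom (f x) n)"
  by (auto simp: param_poly_def intro: polyfun_if polyfun.const exI[of _ n] degree_monom_le)

lemma param_poly_const: "polyfun V f \<Longrightarrow> param_poly V (\<lambda>x. [:f x:])"
  using param_poly_monom[of V f 0] by (simp add: monom_0)

lemma param_poly_add:
  assumes "param_poly V P" "param_poly V Q" shows "param_poly V (\<lambda>x. P x + Q x)"
proof -
  obtain m n where "\<forall>x. degree (P x) \<le> m" "\<forall>x. degree (Q x) \<le> n" using assms by (auto simp: param_poly_def)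
  then have "\<forall>x. degree (P x + Q x) \<le> max m n" by (meson degree_add_le max.coboundedI1 max.coboundedI2)
  then show ?thesis using assms by (auto simp: param_poly_def intro: polyfun.add)
qed

lemma param_poly_mult:
  assumes "param_poly V P" "param_poly V Q" shows "param_poly V (\<lambda>x. P x * Q x)"
proof -
  obtain m n where "\<forall>x. degree (P x) \<le> m" "\<forall>x. degree (Q x) \<le> n" using assms by (auto simp: param_poly_def)
  then have "\<forall>x. degree (P x * Q x) \<le> m + n" by (meson add_mono degree_mult_le order_trans)
  then show ?thesis using assms by (auto simp: param_poly_def coeff_mult intro!: polyfun_intros)
qed

lemma param_poly_smult: "polyfun V f \<Longrightarrow> param_poly V P \<Longrightarrow> param_poly V (\<lambda>x. smult (f x) (P x))"
  using param_poly_mult[OF param_poly_const, of V f P] by simp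

lemma param_poly_diff: "param_poly V P \<Longrightarrow> param_poly V Q \<Longrightarrow> param_poly V (\<lambda>x. P x - Q x)"
  using param_poly_add[OF _ param_poly_smult[OF polyfun.const[of V "-1"]], of P Q] by simp

lemma param_poly_pderiv:
  assumes "param_poly V P" shows "param_poly V (\<lambda>x. pderiv (P x))"
proof -
  obtain n where "\<forall>x. degree (P x) \<le> n" using assms by (auto simp: param_poly_def)
  then have "\<forall>x. degree (pderiv (P x)) \<le> n" by (simp add: degree_pderiv) (meson diff_le_self order_trans)
  then show ?thesis using assms by (auto simp: param_poly_def coeff_pderiv intro!: polyfun_intros)
qed

lemma param_poly_prod_list:
  "(\<And>P. P \<in> set Ps \<Longrightarrow> param_poly V P) \<Longrightarrow> param_poly V (\<lambda>x. prod_list (map (\<lambda>P. P x) Ps))"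
proof (induction Ps)
  case Nil then show ?case using param_poly_const[OF polyfun.const[of V 1]] by (simp add: one_pCons)
next
  case (Cons P Ps) then show ?case by (simp add: param_poly_mult)
qed

lemma polyfun_insert_param_poly:
  assumes "polyfun (insert v V) f"
  shows "\<exists>P. param_poly V P \<and> (\<forall>x. f x = poly (P x) (x v))"
  using assms
proof (induction rule: polyfun.induct)
  case (const c)
  show ?case using param_poly_const[OF polyfun.const[of V c]] by (intro exI[of _ "\<lambda>x. [:c:]"]) auto
next
  case (var w)
  show ?case
  proof (cases "w = v")
    case True
    then show ?thesis using param_poly_monom[OF polyfun.const[of V 1], of 1]
      by (intro exI[of _ "\<lambda>x. monom 1 1"]) (auto simp: poly_monom)
  next
    case False
    then show ?thesis using var param_poly_const[OF polyfun.var[of w V]]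
      by (intro exI[of _ "\<lambda>x. [:x w:]"]) auto
  qed
next
  case (add f g)
  then obtain P Q where "param_poly V P" "\<forall>x. f x = poly (P x) (x v)" "param_poly V Q" "\<forall>x. g x = poly (Q x) (x v)"
    by auto
  then show ?case by (intro exI[of _ "\<lambda>x. P x + Q x"]) (auto intro: param_poly_add)
next
  case (mult f g)
  then obtain P Q where "param_poly V P" "\<forall>x. f x = poly (P x) (x v)" "param_poly V Q" "\<forall>x. g x = poly (Q x) (x v)"
    by auto
  then show ?case by (intro exI[of _ "\<lambda>x. P x * Q x"]) (auto intro: param_poly_mult)
qed

text \<open>A predicate is semialgebraic iff it depends only on the signs of finitely many polynomials. Allowing
  arbitrary values instead of truth values makes this notion closed under all compositions.\<close>

definition sign_determined :: "'v set \<Rightarrow> (('v \<Rightarrow> real) \<Rightarrow> 'a) \<Rightarrow> bool" where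
  "sign_determined V g \<longleftrightarrow>
     (\<exists>fs h. (\<forall>f\<in>set fs. polyfun V f) \<and> (\<forall>x. g x = h (map (\<lambda>f. sgn (f x)) fs)))"

section \<open>Closure properties of sign-determined functions\<close>

lemma sign_determined_const: "sign_determined V (\<lambda>x. c)"
  unfolding sign_determined_def by (intro exI[of _ "[]"] exI[of _ "\<lambda>_. c"]) auto

lemma sign_determined_sgn: "polyfun V f \<Longrightarrow> sign_determined V (\<lambda>x. sgn (f x))"
  unfolding sign_determined_def by (intro exI[of _ "[f]"] exI[of _ hd]) auto

lemma sign_determined_comp: "sign_determined V g \<Longrightarrow> sign_determined V (\<lambda>x. k (g x))"
  unfolding sign_determined_def by (elim exE, rule exI, rule exI[of _ "k \<circ> _"]) auto

lemma sign_determined_comp2: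
  assumes "sign_determined V g1" "sign_determined V g2"
  shows "sign_determined V (\<lambda>x. k (g1 x) (g2 x))"
proof -
  obtain fs1 h1 where 1: "\<forall>f\<in>set fs1. polyfun V f" "\<forall>x. g1 x = h1 (map (\<lambda>f. sgn (f x)) fs1)"
    using assms(1) by (auto simp: sign_determined_def)
  obtain fs2 h2 where 2: "\<forall>f\<in>set fs2. polyfun V f" "\<forall>x. g2 x = h2 (map (\<lambda>f. sgn (f x)) fs2)"
    using assms(2) by (auto simp: sign_determined_def)
  show ?thesis unfolding sign_determined_def
    using 1 2
    by (intro exI[of _ "fs1 @ fs2"] exI[of _ "\<lambda>l. k (h1 (take (length fs1) l)) (h2 (drop (length fs1) l))"]) auto
qed

lemma sign_determined_if:
  assumes "sign_determined V b" "sign_determined V g1" "sign_determined V g2"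
  shows "sign_determined V (\<lambda>x. if b x then g1 x else g2 x)"
  using sign_determined_comp2[OF assms(1) sign_determined_comp2[OF assms(2,3), of Pair],
    of "\<lambda>b (u, v). if b then u else v"] by simp

text \<open>Bundles finitely many values into one function, so that a bounded quantifier over them
  becomes a single application of \<open>sign_determined_comp\<close>.\<close>

lemma sign_determined_family:
  assumes "finite S" "\<And>s. s \<in> S \<Longrightarrow> sign_determined V (g s)"
  shows "sign_determined V (\<lambda>x s. if s \<in> S then g s x else undefined)"
  using assms
proof (induction S rule: finite_induct)
  case empty
  then show ?case by (simp add: sign_determined_const)
next
  case (insert s S)
  then have "sign_determined V (\<lambda>x. (\<lambda>a b. b(s := a)) (g s x) (\<lambda>s. if s \<in> S then g s x else undefined))"
    by (intro sign_determined_comp2[of V "g s" "\<lambda>x s. if s \<in> S then g s x else undefined" "\<lambda>a b. b(s := a)"]) auto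
  moreover have "(\<lambda>x. (\<lambda>a b. b(s := a)) (g s x) (\<lambda>s. if s \<in> S then g s x else undefined)) =
     (\<lambda>x t. if t \<in> insert s S then g t x else undefined)"
    by (auto simp: fun_eq_iff)
  ultimately show ?case by simp
qed

lemma sign_determined_Ex:
  assumes "finite S" "\<And>s. s \<in> S \<Longrightarrow> sign_determined V (g s)"
  shows "sign_determined V (\<lambda>x. \<exists>s\<in>S. g s x)"
  using sign_determined_comp[OF sign_determined_family[of S V g, OF assms], of "\<lambda>f. \<exists>s\<in>S. f s"]
  by (simp cong: bex_cong)

lemma sign_determined_All:
  assumes "finite S" "\<And>s. s \<in> S \<Longrightarrow> sign_determined V (g s)"
  shows "sign_determined V (\<lambda>x. \<forall>s\<in>S. g s x)"
  using sign_determined_comp[OF sign_determined_family[of S V g, OF assms], of "\<lambda>f. \<forall>s\<in>S. f s"]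
  by (simp cong: ball_cong)

lemma sign_determined_eq_0: "polyfun V f \<Longrightarrow> sign_determined V (\<lambda>x. f x = 0)"
  using sign_determined_comp[OF sign_determined_sgn, of V f "\<lambda>s. s = 0"] by (simp add: sgn_zero_iff)

lemma sign_determined_pos: "polyfun V f \<Longrightarrow> sign_determined V (\<lambda>x. f x > 0)"
  using sign_determined_comp[OF sign_determined_sgn, of V f "\<lambda>s. s > 0"] by simp

lemma sign_determined_not: "sign_determined V g \<Longrightarrow> sign_determined V (\<lambda>x. \<not> g x)"
  by (rule sign_determined_comp)

lemma sign_determined_conj: "sign_determined V f \<Longrightarrow> sign_determined V g \<Longrightarrow> sign_determined V (\<lambda>x. f x \<and> g x)"
  by (rule sign_determined_comp2)

lemma sign_determined_disj: "sign_determined V f \<Longrightarrow> sign_determined V g \<Longrightarrow> sign_determined V (\<lambda>x. f x \<or> g x)"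
  by (rule sign_determined_comp2)

text \<open>The Euclidean algorithm, run for all parameters at once. The exclusive bounds
  \<open>a\<close> and \<open>b\<close> stand in for the degrees, which vary with the parameters. If
  a formal leading coefficient vanishes, its bound drops; otherwise the polynomial of larger formal
  degree is reduced by the other. Every step lowers \<open>a + b\<close>, and which step applies
  depends on signs only.\<close>

lemma sign_determined_cauchy_index_aux:
  assumes "param_poly V P" "param_poly V Q"
    and "\<And>x i. i \<ge> a \<Longrightarrow> coeff (P x) i = 0" "\<And>x i. i \<ge> b \<Longrightarrow> coeff (Q x) i = 0"
  shows "sign_determined V (\<lambda>x. cauchy_index (P x) (Q x))"
  using assms
proof (induction "a + b" arbitrary: a b P Q rule: less_induct)
  case less
  show ?case
  proof (cases "a = 0 \<or> b = 0")
    case True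
    then have "(\<forall>x. P x = 0) \<or> (\<forall>x. Q x = 0)" using less.prems(3,4) by (auto intro: poly_eqI)
    then show ?thesis by (auto simp: cauchy_index_def sign_determined_const)
  next
    case False
    then obtain a' b' where ab: "a = Suc a'" "b = Suc b'" by (meson not0_implies_Suc)
    define \<alpha> where "\<alpha> x = coeff (P x) a'" for x
    define \<beta> where "\<beta> x = coeff (Q x) b'" for x
    have p\<alpha>: "polyfun V \<alpha>" unfolding \<alpha>_def[abs_def] using less.prems by (auto intro: param_poly_coeff)
    have p\<beta>: "polyfun V \<beta>" unfolding \<beta>_def[abs_def] using less.prems by (auto intro: param_poly_coeff)
    \<comment> \<open>Where the leading coefficient vanishes, subtracting its monomial changes
      nothing; but it makes the smaller bound valid for all parameters, as the induction hypothesis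
      demands.\<close>
    have P1: "sign_determined V (\<lambda>x. cauchy_index (P x - monom (\<alpha> x) a') (Q x))"
      using less.prems ab p\<alpha> Suc_le_eq
      by (intro less.hyps[of a' b]) (auto intro!: param_poly_diff param_poly_monom, auto simp: \<alpha>_def dest: le_neq_implies_less)
    have Q1: "sign_determined V (\<lambda>x. cauchy_index (P x) (Q x - monom (\<beta> x) b'))"
      using less.prems ab p\<beta> Suc_le_eq
      by (intro less.hyps[of a b']) (auto intro!: param_poly_diff param_poly_monom, auto simp: \<beta>_def dest: le_neq_implies_less)
    \<comment> \<open>Pseudo-division: the multiplier is the square of the leading coefficient of
      the divisor, hence positive when that is nonzero, and the top terms cancel without
      division.\<close>
    have lower: "coeff (smult (u * u) F - monom (u * w) (m - k) * G) i = 0"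
      if "u = coeff G k" "w = coeff F m" "\<And>i. i \<ge> Suc k \<Longrightarrow> coeff G i = 0" "\<And>i. i \<ge> Suc m \<Longrightarrow> coeff F i = 0"
        "k \<le> m" "m \<le> i" for u w :: real and F G k m i
    proof (cases "i = m")
      case True
      then have "i - (m - k) = k" "m - k \<le> i" using that(5) by auto
      then show ?thesis using True by (simp add: coeff_monom_mult that(1,2))
    next
      case False
      then have "coeff F i = 0" "coeff G (i - (m - k)) = 0" using that(5,6) by (intro that(3,4), linarith)+
      then show ?thesis by (simp add: coeff_monom_mult)
    qed
    have deg: "degree F = k" if "coeff F k \<noteq> 0" "\<And>i. i \<ge> Suc k \<Longrightarrow> coeff F i = 0" for F :: "real poly" and k
    proof (rule antisym)
      show "degree F \<le> k" by (rule degree_le) (use that(2) Suc_leI in blast)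
      show "k \<le> degree F" by (rule le_degree[OF that(1)])
    qed
    have degs: "\<alpha> x \<noteq> 0 \<Longrightarrow> degree (P x) = a'" "\<beta> x \<noteq> 0 \<Longrightarrow> degree (Q x) = b'" for x
      using less.prems(3,4) unfolding ab \<alpha>_def \<beta>_def by (blast intro: deg)+
    define b2 where "b2 = (if odd (a' + b') then 1 else 0 :: real)"
    have osgn: "odd_sgn (P x * Q x) = b2 * sgn (\<alpha> x * \<beta> x)" if "\<alpha> x \<noteq> 0" "\<beta> x \<noteq> 0" for x
    proof -
      have "P x \<noteq> 0" "Q x \<noteq> 0" using that by (auto simp: \<alpha>_def \<beta>_def)
      then have "degree (P x * Q x) = a' + b'" using degs that by (simp add: degree_mult_eq)
      moreover have "lead_coeff (P x * Q x) = \<alpha> x * \<beta> x"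
        unfolding lead_coeff_mult using degs that by (simp add: \<alpha>_def \<beta>_def)
      ultimately show ?thesis by (simp add: odd_sgn_def b2_def)
    qed
    obtain R where R: "sign_determined V R"
      "\<And>x. \<alpha> x \<noteq> 0 \<Longrightarrow> \<beta> x \<noteq> 0 \<Longrightarrow> cauchy_index (P x) (Q x) = R x"
    proof (cases "a' \<le> b'")
      case True
      let ?R = "\<lambda>x. cauchy_index (P x) (smult (\<alpha> x * \<alpha> x) (Q x) - monom (\<alpha> x * \<beta> x) (b' - a') * P x)"
      have "sign_determined V ?R"
        using less.prems ab p\<alpha> p\<beta> True
        by (intro less.hyps[of a b'] lower)
          (auto intro!: param_poly_diff param_poly_monom param_poly_mult param_poly_smult polyfun.mult param_poly_coeff simp: \<alpha>_def \<beta>_def)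
      moreover have "cauchy_index (P x) (Q x) = ?R x" if "\<alpha> x \<noteq> 0" "\<beta> x \<noteq> 0" for x
        using that by (subst cauchy_index_reduce) (auto simp: \<alpha>_def \<beta>_def zero_less_mult_iff)
      ultimately show ?thesis using that by blast
    next
      case False
      \<comment> \<open>Only the second argument of \<open>cauchy_index\<close> can be reduced, so
        here the arguments are exchanged, at the price of the sign term of
        \<open>cauchy_index_swap\<close>.\<close>
      let ?R = "\<lambda>x. cauchy_index (Q x) (smult (\<beta> x * \<beta> x) (P x) - monom (\<beta> x * \<alpha> x) (a' - b') * Q x)"
      have "sign_determined V ?R"
        using less.prems ab p\<alpha> p\<beta> False
        by (intro less.hyps[of b a'] lower)
          (auto intro!: param_poly_diff param_poly_monom param_poly_mult param_poly_smult polyfun.mult param_poly_coeff simp: \<alpha>_def \<beta>_def)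
      then have "sign_determined V (\<lambda>x. b2 * sgn (\<alpha> x * \<beta> x) - ?R x)"
        by (intro sign_determined_comp2[of _ "\<lambda>x. sgn (\<alpha> x * \<beta> x)" ?R "\<lambda>u v. b2 * u - v"] sign_determined_sgn
          polyfun.mult p\<alpha> p\<beta>)
      moreover have "cauchy_index (P x) (Q x) = b2 * sgn (\<alpha> x * \<beta> x) - ?R x" if *: "\<alpha> x \<noteq> 0" "\<beta> x \<noteq> 0" for x
      proof -
        have "cauchy_index (Q x) (P x) = ?R x"
          using that by (subst cauchy_index_reduce) (auto simp: \<alpha>_def \<beta>_def zero_less_mult_iff)
        moreover have "cauchy_index (P x) (Q x) + cauchy_index (Q x) (P x) = odd_sgn (P x * Q x)"
          using that by (intro cauchy_index_swap) (auto simp: \<alpha>_def \<beta>_def)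
        ultimately show ?thesis using osgn[OF *] by simp
      qed
      ultimately show ?thesis using that by blast
    qed
    have "cauchy_index (P x) (Q x) = (if \<alpha> x = 0 then cauchy_index (P x - monom (\<alpha> x) a') (Q x)
        else if \<beta> x = 0 then cauchy_index (P x) (Q x - monom (\<beta> x) b') else R x)" for x
      using R(2)[of x] by auto
    then show ?thesis
      by (simp only:) (intro sign_determined_if sign_determined_eq_0 p\<alpha> p\<beta> P1 Q1 R(1))
  qed
qed

lemma sign_determined_cauchy_index:
  assumes "param_poly V P" "param_poly V Q"
  shows "sign_determined V (\<lambda>x. cauchy_index (P x) (Q x))"
proof -
  obtain a b where ab: "\<forall>x. degree (P x) \<le> a" "\<forall>x. degree (Q x) \<le> b"
    using assms by (auto simp: param_poly_def)
  show ?thesis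
  proof (rule sign_determined_cauchy_index_aux[OF assms])
    show "coeff (P x) i = 0" if "Suc a \<le> i" for x i
      using that ab(1)[rule_format, of x] by (intro coeff_eq_0) simp
    show "coeff (Q x) i = 0" if "Suc b \<le> i" for x i
      using that ab(2)[rule_format, of x] by (intro coeff_eq_0) simp
  qed
qed

lemma sign_determined_tarski_query:
  assumes "param_poly V P" "param_poly V Q"
  shows "sign_determined V (\<lambda>x. tarski_query (P x) (Q x))"
  unfolding tarski_query_eq_cauchy_index
  by (intro sign_determined_cauchy_index param_poly_mult param_poly_pderiv assms)

text \<open>The degree is the last index with a nonzero coefficient, searched below the uniform
  bound, hence a function of finitely many signs. It supplies the signs at both infinities.\<close>

lemma sign_determined_lead:
  assumes "param_poly V P"
  shows "sign_determined V (\<lambda>x. (degree (P x), sgn (lead_coeff (P x))))"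
proof -
  obtain n where n: "\<forall>x. degree (P x) \<le> n" using assms by (auto simp: param_poly_def)
  define d :: "(nat \<Rightarrow> real) \<Rightarrow> nat" where "d s = (LEAST m. \<forall>i>m. i \<le> n \<longrightarrow> s i = 0)" for s
  let ?s = "\<lambda>x i. if i \<in> {..n} then sgn (coeff (P x) i) else undefined"
  have deg: "degree (P x) = d (?s x)" for x
  proof -
    have "(\<forall>i>m. coeff (P x) i = 0) \<longleftrightarrow> (\<forall>i>m. i \<le> n \<longrightarrow> ?s x i = 0)" (is "?A = ?B") for m
    proof
      assume ?B
      then have "coeff (P x) i = 0" if "i > m" for i
      proof (cases "i \<le> n")
        case True with that \<open>?B\<close> show ?thesis by (simp add: sgn_zero_iff)
      next
        case False
        then have "degree (P x) < i" using n[rule_format, of x] by linarith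
        then show ?thesis by (rule coeff_eq_0)
      qed
      then show ?A by blast
    qed simp
    then show ?thesis unfolding d_def Polynomial.degree_def by (intro arg_cong[where f = Least] ext)
  qed
  have "sgn (lead_coeff (P x)) = ?s x (degree (P x))" for x using n by simp
  then have eq: "(degree (P x), sgn (lead_coeff (P x))) = (d (?s x), ?s x (d (?s x)))" for x
    unfolding deg by simp
  have s: "sign_determined V ?s"
    using assms by (intro sign_determined_family sign_determined_sgn param_poly_coeff) auto
  show ?thesis
    unfolding eq by (rule sign_determined_comp[OF s, of "\<lambda>s. (d s, s (d s))"])
qed

text \<open>For \<open>g = 1\<close> this is the number of real roots of \<open>f\<close> at which
  all sign conditions in \<open>L\<close> hold. The weight \<open>g\<close> serves the recursion,
  which trades a condition for factors of \<open>g\<close>; for empty \<open>L\<close> a Tarski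
  query is left.\<close>

definition root_count :: "real poly \<Rightarrow> real poly \<Rightarrow> (real poly \<times> real) list \<Rightarrow> real" where
  "root_count f g L = (if f = 0 then 0 else
     \<Sum>a | poly f a = 0. sgn (poly g a) * (if \<forall>(p, s)\<in>set L. sgn (poly p a) = s then 1 else 0))"

text \<open>On \<open>{-1, 0, 1}\<close> the indicator of \<open>t = s\<close> is a quadratic
  polynomial in \<open>t\<close>, namely \<open>1 - t * t\<close> for \<open>s = 0\<close> and
  \<open>(s * t + t * t) / 2\<close> otherwise. Since signs are multiplicative, each
  \<open>t\<close> turns into a factor \<open>p\<close> of the weight.\<close>

lemma root_count_Cons:
  assumes "s \<in> {-1, 0, 1}"
  shows "root_count f g ((p, s) # L) =
    (if s = 0 then 1 else 0) * root_count f g L + s / 2 * root_count f (g * p) L +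
    (if s = 0 then -1 else 1 / 2) * root_count f (g * p * p) L"
proof -
  define W :: "real \<Rightarrow> real" where "W a = (if \<forall>(p, s)\<in>set L. sgn (poly p a) = s then 1 else 0)" for a
  have ind: "(if t = s then 1 else 0) = (if s = 0 then 1 else 0) + s / 2 * t + (if s = 0 then -1 else 1 / 2) * t * t"
    if "t \<in> {-1, 0, 1}" for t :: real using assms that by auto
  have *: "sgn (poly g a) * (if \<forall>(p, s)\<in>set ((p, s) # L). sgn (poly p a) = s then 1 else 0) =
    (if s = 0 then 1 else 0) * (sgn (poly g a) * W a) + s / 2 * (sgn (poly (g * p) a) * W a) +
    (if s = 0 then -1 else 1 / 2) * (sgn (poly (g * p * p) a) * W a)" for a
  proof -
    have "sgn (poly p a) \<in> {-1, 0, 1}" by (auto simp: sgn_if)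
    note i = ind[OF this]
    have "(if \<forall>(p, s)\<in>set ((p, s) # L). sgn (poly p a) = s then 1 else 0 :: real) =
      (if sgn (poly p a) = s then 1 else 0) * W a" by (auto simp: W_def)
    then show ?thesis unfolding i by (simp only: poly_mult sgn_mult) (simp add: algebra_simps)
  qed
  show ?thesis
    unfolding root_count_def * W_def[symmetric] sum.distrib sum_distrib_left[symmetric] by simp
qed

lemma sign_determined_root_count:
  assumes "param_poly V f" "param_poly V g" "\<forall>(p, s)\<in>set L. param_poly V p \<and> s \<in> {-1, 0, 1}"
  shows "sign_determined V (\<lambda>x. root_count (f x) (g x) (map (\<lambda>(p, s). (p x, s)) L))"
  using assms(2,3)
proof (induction L arbitrary: g)
  case Nil
  have "root_count (f x) (g x) [] = tarski_query (f x) (g x)" for x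
    by (simp add: root_count_def tarski_query_def)
  then show ?case using sign_determined_tarski_query[OF assms(1) Nil(1)] by simp
next
  case (Cons ps L)
  obtain p s where ps: "ps = (p, s)" by fastforce
  then have p: "param_poly V p" "s \<in> {-1, 0, 1}" and L: "\<forall>(p, s)\<in>set L. param_poly V p \<and> s \<in> {-1, 0, 1}"
    using Cons.prems by auto
  let ?r = "\<lambda>g x. root_count (f x) (g x) (map (\<lambda>(p, s). (p x, s)) L)"
  have "sign_determined V (?r g)" by (intro Cons.IH Cons.prems L)
  moreover have "sign_determined V (?r (\<lambda>x. g x * p x))" by (intro Cons.IH Cons.prems L param_poly_mult p)
  moreover have "sign_determined V (?r (\<lambda>x. g x * p x * p x))" by (intro Cons.IH Cons.prems L param_poly_mult p)
  ultimately have "sign_determined V (\<lambda>x. (if s = 0 then 1 else 0) * ?r g x + s / 2 * ?r (\<lambda>x. g x * p x) x +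
    (if s = 0 then -1 else 1 / 2) * ?r (\<lambda>x. g x * p x * p x) x)"
    by (intro sign_determined_comp2[where k = "(+)"] sign_determined_comp[where k = "(*) _"]) auto
  then show ?case using root_count_Cons[OF p(2)] by (simp add: ps)
qed

lemma sign_determined_ex_root:
  assumes "param_poly V f" "\<forall>(p, s)\<in>set L. param_poly V p \<and> s \<in> {-1, 0, 1}"
  shows "sign_determined V (\<lambda>x. f x \<noteq> 0 \<and> (\<exists>y. poly (f x) y = 0 \<and> (\<forall>(p, s)\<in>set L. sgn (poly (p x) y) = s)))"
proof -
  have "(f x \<noteq> 0 \<and> (\<exists>y. poly (f x) y = 0 \<and> (\<forall>(p, s)\<in>set L. sgn (poly (p x) y) = s))) \<longleftrightarrow>
     root_count (f x) 1 (map (\<lambda>(p, s). (p x, s)) L) \<noteq> 0" for x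
  proof (cases "f x = 0")
    case False
    have "(\<Sum>a | poly (f x) a = 0. if \<forall>(p, s)\<in>set L. sgn (poly (p x) a) = s then 1 else 0 :: real) = 0 \<longleftrightarrow>
       (\<forall>a\<in>{a. poly (f x) a = 0}. (if \<forall>(p, s)\<in>set L. sgn (poly (p x) a) = s then 1 else 0 :: real) = 0)"
      by (intro sum_nonneg_eq_0_iff poly_roots_finite False) auto
    with False show ?thesis by (auto simp: root_count_def case_prod_unfold)
  qed (simp add: root_count_def)
  moreover have "param_poly V (\<lambda>x. 1)" using param_poly_const[OF polyfun.const[of V 1]] by (simp add: one_pCons)
  ultimately show ?thesis
    using sign_determined_comp[OF sign_determined_root_count[OF assms(1) _ assms(2), of "\<lambda>x. 1"], of "\<lambda>r. r \<noteq> 0"]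
    by simp
qed

section \<open>Elimination of a real variable\<close>

lemma sgn_poly_eq_sgn_minus_infinity:
  fixes p :: "real poly"
  assumes "\<And>x. x \<le> a \<Longrightarrow> poly p x \<noteq> 0"
  shows "sgn (poly p a) = (-1) ^ degree p * sgn (lead_coeff p)"
proof -
  have "sgn (poly (p \<circ>\<^sub>p [:0, -1:]) (-a)) = sgn (lead_coeff (p \<circ>\<^sub>p [:0, -1:]))"
    using assms by (intro sgn_poly_eq_sgn_lead_coeff) (auto simp: poly_pcompose)
  then show ?thesis by (simp add: poly_pcompose lead_coeff_comp sgn_mult power_sgn[symmetric])
qed

lemma sgn_poly_eq_no_root:
  fixes p :: "real poly"
  assumes "\<And>x. min a b \<le> x \<Longrightarrow> x \<le> max a b \<Longrightarrow> poly p x \<noteq> 0"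
  shows "sgn (poly p a) = sgn (poly p b)"
proof (rule ccontr)
  assume ne: "sgn (poly p a) \<noteq> sgn (poly p b)"
  have nz: "poly p a \<noteq> 0" "poly p b \<noteq> 0" using assms[of a] assms[of b] by auto
  have "a \<noteq> b" using ne by auto
  then have ab: "min a b < max a b" by (auto simp: min_def max_def)
  have "poly p a * poly p b < 0" using ne nz by (auto simp: sgn_if mult_less_0_iff split: if_splits)
  then have "poly p (min a b) * poly p (max a b) < 0" by (auto simp: min_def max_def mult.commute)
  from poly_IVT[OF ab this] obtain x where "min a b < x" "x < max a b" "poly p x = 0" by blast
  with assms[of x] show False by (simp add: less_imp_le)
qed

lemma finite_roots_list:
  "finite {x::real. \<exists>(p, s)\<in>set L. p \<noteq> 0 \<and> poly p x = 0}"
proof -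
  have "{x. \<exists>(p, s)\<in>set L. p \<noteq> 0 \<and> poly p x = 0} = (\<Union>p\<in>{p\<in>fst ` set L. p \<noteq> 0}. {x. poly p x = 0})"
    by force
  then show ?thesis by (auto intro: poly_roots_finite)
qed

text \<open>If a sign condition holds somewhere, it holds at a root of one of the polynomials involved,
  at \<open>\<plusminus>\<infinity>\<close>, or on an interval between two roots of their product, where Rolle's theorem gives a root
  of the derivative of the product.\<close>

lemma ex_sign_condition_iff:
  fixes L :: "(real poly \<times> real) list"
  defines "C \<equiv> \<lambda>y. \<forall>(p, s)\<in>set L. sgn (poly p y) = s"
    and "h \<equiv> pderiv (prod_list (map fst (filter (\<lambda>(p, s). s \<noteq> 0) L)))"
  shows "(\<exists>y. C y) \<longleftrightarrow>
    (\<exists>(p, s)\<in>set L. p \<noteq> 0 \<and> (\<exists>y. poly p y = 0 \<and> C y)) \<or>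
    (\<forall>(p, s)\<in>set L. sgn (lead_coeff p) = s) \<or>
    (\<forall>(p, s)\<in>set L. (-1) ^ degree p * sgn (lead_coeff p) = s) \<or>
    (h \<noteq> 0 \<and> (\<exists>y. poly h y = 0 \<and> C y))" (is "?L \<longleftrightarrow> ?R")
proof
  assume ?R
  then consider "?L" | (pinf) "\<forall>(p, s)\<in>set L. sgn (lead_coeff p) = s"
    | (minf) "\<forall>(p, s)\<in>set L. (-1) ^ degree p * sgn (lead_coeff p) = s" by (elim disjE) auto
  then show ?L
  proof cases
    case pinf
    obtain M where M: "\<And>x. x \<in> {x. \<exists>(p, s)\<in>set L. p \<noteq> 0 \<and> poly p x = 0} \<Longrightarrow> x < M"
    proof -
      assume *: "\<And>M. (\<And>x. x \<in> {x. \<exists>(p, s)\<in>set L. p \<noteq> 0 \<and> poly p x = 0} \<Longrightarrow> x < M) \<Longrightarrow> thesis"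
      have "x \<le> Max (insert 0 {x. \<exists>(p, s)\<in>set L. p \<noteq> 0 \<and> poly p x = 0})"
        if "x \<in> {x. \<exists>(p, s)\<in>set L. p \<noteq> 0 \<and> poly p x = 0}" for x
        using finite_roots_list[of L] that by (intro Max_ge) auto
      then show thesis
        by (intro *[of "Max (insert 0 {x. \<exists>(p, s)\<in>set L. p \<noteq> 0 \<and> poly p x = 0}) + 1"]) force
    qed
   have "sgn (poly p M) = s" if "(p, s) \<in> set L" for p s
    proof (cases "p = 0")
      case False
      have "sgn (poly p M) = sgn (lead_coeff p)"
        by (rule sgn_poly_eq_sgn_lead_coeff) (use M that False in force)
      with pinf that show ?thesis by auto
    qed (use pinf that in auto)
    then show ?thesis by (auto simp: C_def)
  next
    case minf
    obtain M where M: "\<And>x. x \<in> {x. \<exists>(p, s)\<in>set L. p \<noteq> 0 \<and> poly p x = 0} \<Longrightarrow> M < x"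
    proof -
      assume *: "\<And>M. (\<And>x. x \<in> {x. \<exists>(p, s)\<in>set L. p \<noteq> 0 \<and> poly p x = 0} \<Longrightarrow> M < x) \<Longrightarrow> thesis"
      have "Min (insert 0 {x. \<exists>(p, s)\<in>set L. p \<noteq> 0 \<and> poly p x = 0}) \<le> x"
        if "x \<in> {x. \<exists>(p, s)\<in>set L. p \<noteq> 0 \<and> poly p x = 0}" for x
        using finite_roots_list[of L] that by (intro Min_le) auto
      then show thesis
        by (intro *[of "Min (insert 0 {x. \<exists>(p, s)\<in>set L. p \<noteq> 0 \<and> poly p x = 0}) - 1"]) force
    qed
    have "sgn (poly p M) = s" if "(p, s) \<in> set L" for p s
    proof (cases "p = 0")
      case False
      have "sgn (poly p M) = (-1) ^ degree p * sgn (lead_coeff p)"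
        by (rule sgn_poly_eq_sgn_minus_infinity) (use M that False in force)
      with minf that show ?thesis by auto
    qed (use minf that in auto)
    then show ?thesis by (auto simp: C_def)
  qed
next
  assume ?L
  then obtain y where y: "C y" ..
  define h0 where "h0 = prod_list (map fst (filter (\<lambda>(p, s). s \<noteq> 0) L))"
  show ?R
  proof (cases "\<exists>(p, s)\<in>set L. p \<noteq> 0 \<and> poly p y = 0")
    case True
    with y show ?thesis by (intro disjI1) auto
  next
    case nr: False
    have h0_root: "poly h0 x = 0 \<longleftrightarrow> (\<exists>(p, s)\<in>set L. s \<noteq> 0 \<and> poly p x = 0)" for x
      unfolding h0_def by (induction L) auto
    \<comment> \<open>As no nonzero polynomial of the list vanishes at \<open>y\<close>, the sign
      \<open>0\<close> is prescribed exactly for the zero polynomials. Hence the roots of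
      \<open>h0\<close> are all the points at which a sign can change.\<close>
    have nz: "p \<noteq> 0 \<longleftrightarrow> s \<noteq> 0" if "(p, s) \<in> set L" for p s
      using nr y that by (force simp: C_def sgn_zero_iff)
    have h0y: "poly h0 y \<noteq> 0" using nr nz by (force simp: h0_root)
    then have h00: "h0 \<noteq> 0" by auto
    define R where "R = {x. poly h0 x = 0}"
    have fin: "finite R" unfolding R_def by (rule poly_roots_finite[OF h00])
    have noroot: "poly p x \<noteq> 0" if "(p, s) \<in> set L" "p \<noteq> 0" "x \<notin> R" for p s x
      using that nz by (auto simp: R_def h0_root)
    have yR: "y \<notin> R" using h0y by (simp add: R_def)
    consider "\<forall>x\<in>R. x < y" | "\<forall>x\<in>R. y < x" | "(\<exists>x\<in>R. x < y) \<and> (\<exists>x\<in>R. y < x)"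
      using yR by (metis linorder_neqE)
    then show ?thesis
    proof cases
      case 1
      have "sgn (lead_coeff p) = s" if "(p, s) \<in> set L" for p s
      proof (cases "p = 0")
        case False
        have "sgn (poly p y) = sgn (lead_coeff p)"
        proof (rule sgn_poly_eq_sgn_lead_coeff)
          fix x assume "y \<le> x"
          then have "x \<notin> R" using 1 by force
          then show "poly p x \<noteq> 0" by (rule noroot[OF that False])
        qed
        with y that show ?thesis by (auto simp: C_def)
      qed (use nz that in auto)
      then show ?thesis by (intro disjI2[OF disjI1]) auto
    next
      case 2
      have "(-1) ^ degree p * sgn (lead_coeff p) = s" if "(p, s) \<in> set L" for p s
      proof (cases "p = 0")
        case False
        have "sgn (poly p y) = (-1) ^ degree p * sgn (lead_coeff p)"
        proof (rule sgn_poly_eq_sgn_minus_infinity)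
          fix x assume "x \<le> y"
          then have "x \<notin> R" using 2 by force
          then show "poly p x \<noteq> 0" by (rule noroot[OF that False])
        qed
        with y that show ?thesis by (auto simp: C_def)
      qed (use nz that in auto)
      then show ?thesis by (intro disjI2[OF disjI2[OF disjI1]]) auto
    next
      case 3
      define a where "a = Max {x\<in>R. x < y}"
      define b where "b = Min {x\<in>R. y < x}"
      have "a \<in> {x\<in>R. x < y}" unfolding a_def using fin 3 by (intro Max_in) auto
      moreover have "x \<le> a" if "x \<in> R" "x < y" for x unfolding a_def using fin that by (intro Max_ge) auto
      ultimately have a: "a \<in> R" "a < y" "\<And>x. x \<in> R \<Longrightarrow> x < y \<Longrightarrow> x \<le> a" by auto
      have "b \<in> {x\<in>R. y < x}" unfolding b_def using fin 3 by (intro Min_in) auto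
      moreover have "b \<le> x" if "x \<in> R" "y < x" for x unfolding b_def using fin that by (intro Min_le) auto
      ultimately have b: "b \<in> R" "y < b" "\<And>x. x \<in> R \<Longrightarrow> y < x \<Longrightarrow> b \<le> x" by auto
      obtain c where c: "a < c" "c < b" "poly h0 b - poly h0 a = (b - a) * poly (pderiv h0) c"
        using poly_MVT[OF less_trans[OF a(2) b(2)], of h0] by auto
      have hc: "poly h c = 0"
      proof -
        have "poly h0 a = 0" "poly h0 b = 0" using a(1) b(1) by (simp_all add: R_def)
        moreover have "b - a \<noteq> 0" using a(2) b(2) by simp
        ultimately have "poly (pderiv h0) c = 0" using c(3) by simp
        then show ?thesis by (simp add: h_def h0_def)
      qed
      have between: "x \<notin> R" if "a < x" "x < b" for x
        using that a(3)[of x] b(3)[of x] yR by (metis linorder_neqE not_le)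
      have Cc: "C c" unfolding C_def
      proof clarify
        fix p s assume ps: "(p, s) \<in> set L"
        have "sgn (poly p c) = sgn (poly p y)" if "p \<noteq> 0"
        proof (rule sgn_poly_eq_no_root)
          fix x assume "min c y \<le> x" "x \<le> max c y"
          then have "a < x" "x < b" using a b c by auto
          then show "poly p x \<noteq> 0" using noroot[OF ps that] between by blast
        qed
        then show "sgn (poly p c) = s" using ps y by (cases "p = 0") (auto simp: C_def)
      qed
      have "h \<noteq> 0"
      proof
        assume "h = 0"
        then obtain k where "h0 = [:k:]" by (auto simp: h_def h0_def[symmetric] pderiv_eq_0_iff elim: degree_eq_zeroE)
        then show False using a h0y by (auto simp: R_def)
      qed
      with hc Cc show ?thesis by (intro disjI2 conjI exI[of _ c])
    qed
  qed
qed

lemma sign_determined_ex_sign_condition: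
  assumes "\<forall>(p, s)\<in>set L. param_poly V p \<and> s \<in> {-1, 0, 1}"
  shows "sign_determined V (\<lambda>x. \<exists>y. \<forall>(p, s)\<in>set L. sgn (poly (p x) y) = s)"
proof -
  define h where "h x = pderiv (prod_list (map (\<lambda>p. p x) (map fst (filter (\<lambda>(p, s). s \<noteq> 0) L))))" for x
  have h: "param_poly V h" unfolding h_def[abs_def]
    using assms by (intro param_poly_pderiv param_poly_prod_list) auto
  have filt: "map fst (filter (\<lambda>(p, s). s \<noteq> 0) (map (\<lambda>(p, s). (p x, s)) L)) =
      map (\<lambda>p. p x) (map fst (filter (\<lambda>(p, s). s \<noteq> 0) L))" for x :: "'a \<Rightarrow> real"
    by (induction L) auto
  have eq: "(\<exists>y. \<forall>(p, s)\<in>set L. sgn (poly (p x) y) = s) \<longleftrightarrow>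
    (\<exists>ps\<in>set L. fst ps x \<noteq> 0 \<and> (\<exists>y. poly (fst ps x) y = 0 \<and> (\<forall>(p, s)\<in>set L. sgn (poly (p x) y) = s))) \<or>
    (\<forall>ps\<in>set L. (\<lambda>(d, t). t = snd ps) (degree (fst ps x), sgn (lead_coeff (fst ps x)))) \<or>
    (\<forall>ps\<in>set L. (\<lambda>(d, t). (-1) ^ d * t = snd ps) (degree (fst ps x), sgn (lead_coeff (fst ps x)))) \<or>
    (h x \<noteq> 0 \<and> (\<exists>y. poly (h x) y = 0 \<and> (\<forall>(p, s)\<in>set L. sgn (poly (p x) y) = s)))" for x
    using ex_sign_condition_iff[of "map (\<lambda>(p, s). (p x, s)) L"]
    unfolding filt h_def[symmetric] by (simp add: case_prod_unfold)
  have L: "param_poly V (fst ps)" if "ps \<in> set L" for ps using assms that by auto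
  have pinf: "sign_determined V (\<lambda>x. \<forall>ps\<in>set L. (\<lambda>(d, t). t = snd ps) (degree (fst ps x), sgn (lead_coeff (fst ps x))))"
    by (rule sign_determined_All[OF finite_set]) (rule sign_determined_comp[OF sign_determined_lead[OF L]])
  have minf: "sign_determined V (\<lambda>x. \<forall>ps\<in>set L. (\<lambda>(d, t). (-1) ^ d * t = snd ps) (degree (fst ps x), sgn (lead_coeff (fst ps x))))"
    by (rule sign_determined_All[OF finite_set]) (rule sign_determined_comp[OF sign_determined_lead[OF L]])
  have roots: "sign_determined V (\<lambda>x. \<exists>ps\<in>set L. fst ps x \<noteq> 0 \<and>
      (\<exists>y. poly (fst ps x) y = 0 \<and> (\<forall>(p, s)\<in>set L. sgn (poly (p x) y) = s)))"
    by (rule sign_determined_Ex[OF finite_set]) (rule sign_determined_ex_root[OF L assms])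
  show ?thesis unfolding eq
    by (rule sign_determined_disj[OF roots sign_determined_disj[OF pinf
      sign_determined_disj[OF minf sign_determined_ex_root[OF h assms]]]])
qed

text \<open>The theorem of Tarski and Seidenberg for one variable. The truth value of
  \<open>g\<close> is a function of one of finitely many sign vectors \<open>l\<close>, so the
  quantifier over \<open>y\<close> can be treated for one \<open>l\<close> at a time, where it asks
  for a sign condition on univariate polynomials with parameters.\<close>

theorem sign_determined_ex:
  fixes g :: "('v \<Rightarrow> real) \<Rightarrow> bool"
  assumes "sign_determined (insert v V) g" "v \<notin> V"
  shows "sign_determined V (\<lambda>x. \<exists>y. g (x(v := y)))"
proof -
  obtain fs k where fs: "\<forall>f\<in>set fs. polyfun (insert v V) f" "\<And>x. g x = k (map (\<lambda>f. sgn (f x)) fs)"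
    using assms(1) by (auto simp: sign_determined_def)
  have "\<forall>f\<in>set fs. \<exists>P. param_poly V P \<and> (\<forall>x. f x = poly (P x) (x v))"
    by (intro ballI polyfun_insert_param_poly) (use fs(1) in auto)
  then obtain P where P: "\<forall>f\<in>set fs. param_poly V (P f) \<and> (\<forall>x. f x = poly (P f x) (x v))"
    unfolding bchoice_iff by blast
  \<comment> \<open>The coefficients of \<open>P f\<close> are functions of the variables in
    \<open>V\<close>, and \<open>v\<close> is not among them, so assigning a value to
    \<open>v\<close> leaves them alone.\<close>
  have fP: "f (x(v := y)) = poly (P f x) y" if "f \<in> set fs" for f x y
  proof -
    have "P f (x(v := y)) = P f x"
    proof (rule poly_eqI)
      fix i show "coeff (P f (x(v := y))) i = coeff (P f x) i"
        using P that assms(2) by (intro polyfun_cong[OF param_poly_coeff[of V "P f" i]]) auto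
    qed
    moreover have "f (x(v := y)) = poly (P f (x(v := y))) ((x(v := y)) v)" using P that by blast
    ultimately show ?thesis by simp
  qed
  define S where "S = {l::real list. set l \<subseteq> {-1, 0, 1} \<and> length l = length fs}"
  have "finite S" unfolding S_def by (rule finite_lists_length_eq) simp
  have eq: "(\<exists>y. g (x(v := y))) \<longleftrightarrow>
    (\<exists>l\<in>S. k l \<and> (\<exists>y. \<forall>(p, s)\<in>set (zip (map P fs) l). sgn (poly (p x) y) = s))" for x
  proof
    assume "\<exists>y. g (x(v := y))"
    then obtain y where y: "k (map (\<lambda>f. sgn (f (x(v := y)))) fs)" using fs(2) by auto
    let ?l = "map (\<lambda>f. sgn (f (x(v := y)))) fs"
    have "?l \<in> S" by (auto simp: S_def sgn_if)
    moreover have "\<forall>(p, s)\<in>set (zip (map P fs) ?l). sgn (poly (p x) y) = s"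
      by (auto simp: zip_map_map zip_same_conv_map fP)
    ultimately show "\<exists>l\<in>S. k l \<and> (\<exists>y. \<forall>(p, s)\<in>set (zip (map P fs) l). sgn (poly (p x) y) = s)"
      using y by blast
  next
    assume "\<exists>l\<in>S. k l \<and> (\<exists>y. \<forall>(p, s)\<in>set (zip (map P fs) l). sgn (poly (p x) y) = s)"
    then obtain l y where l: "l \<in> S" "k l" "\<forall>(p, s)\<in>set (zip (map P fs) l). sgn (poly (p x) y) = s" by blast
    have "map (\<lambda>f. sgn (f (x(v := y)))) fs = l"
    proof (rule nth_equalityI)
      show len: "length (map (\<lambda>f. sgn (f (x(v := y)))) fs) = length l" using l(1) by (simp add: S_def)
      fix i assume "i < length (map (\<lambda>f. sgn (f (x(v := y)))) fs)"
      then have i: "i < length fs" by simp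
      then have mem: "(P (fs ! i), l ! i) \<in> set (zip (map P fs) l)" using len by (force simp: in_set_zip)
      have "sgn (poly (P (fs ! i) x) y) = l ! i" using bspec[OF l(3) mem] by simp
      with i show "map (\<lambda>f. sgn (f (x(v := y)))) fs ! i = l ! i" by (simp add: fP)
    qed
    with l(2) show "\<exists>y. g (x(v := y))" using fs(2) by metis
  qed
  have zip: "\<forall>(p, s)\<in>set (zip (map P fs) l). param_poly V p \<and> s \<in> {-1, 0, 1}" if "l \<in> S" for l
  proof clarify
    fix p s assume ps: "(p, s) \<in> set (zip (map P fs) l)"
    have "p \<in> P ` set fs" "s \<in> set l" using set_zip_leftD[OF ps] set_zip_rightD[OF ps] by auto
    then show "param_poly V p \<and> s \<in> {-1, 0, 1}" using P that unfolding S_def by blast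
  qed
  show ?thesis unfolding eq
    by (rule sign_determined_Ex[OF \<open>finite S\<close>], rule sign_determined_conj[OF sign_determined_const],
      rule sign_determined_ex_sign_condition[OF zip])
qed

lemma sign_determined_ex_block:
  fixes g :: "('v \<Rightarrow> real) \<Rightarrow> bool"
  assumes "finite W" "sign_determined (V \<union> W) g" "V \<inter> W = {}"
  shows "sign_determined V (\<lambda>x. \<exists>w. g (\<lambda>v. if v \<in> W then w v else x v))"
  using assms
proof (induction W arbitrary: g rule: finite_induct)
  case empty
  then show ?case by simp
next
  case (insert a W)
  have "sign_determined (V \<union> W) (\<lambda>x. \<exists>y. g (x(a := y)))"
    using insert.prems insert.hyps by (intro sign_determined_ex) auto
  then have "sign_determined V (\<lambda>x. \<exists>w y. g ((\<lambda>v. if v \<in> W then w v else x v)(a := y)))"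
    using insert by auto
  moreover have "(\<exists>w y. g ((\<lambda>v. if v \<in> W then w v else x v)(a := y))) \<longleftrightarrow>
      (\<exists>w. g (\<lambda>v. if v \<in> insert a W then w v else x v))" for x
  proof
    assume "\<exists>w y. g ((\<lambda>v. if v \<in> W then w v else x v)(a := y))"
    then obtain w y where "g ((\<lambda>v. if v \<in> W then w v else x v)(a := y))" by blast
    moreover have "(\<lambda>v. if v \<in> W then w v else x v)(a := y) = (\<lambda>v. if v \<in> insert a W then (w(a := y)) v else x v)"
      by auto
    ultimately show "\<exists>w. g (\<lambda>v. if v \<in> insert a W then w v else x v)" by metis
  next
    assume "\<exists>w. g (\<lambda>v. if v \<in> insert a W then w v else x v)"
    then obtain w where "g (\<lambda>v. if v \<in> insert a W then w v else x v)" by blast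
    moreover have "(\<lambda>v. if v \<in> insert a W then w v else x v) = (\<lambda>v. if v \<in> W then w v else x v)(a := w a)"
      by auto
    ultimately show "\<exists>w y. g ((\<lambda>v. if v \<in> W then w v else x v)(a := y))" by metis
  qed
  ultimately show ?case by simp
qed

section \<open>Substitution and differentiation of polynomials\<close>

abbreviation "lookup \<equiv> Poly_Mapping.lookup"
abbreviation "keys \<equiv> Poly_Mapping.keys"
abbreviation "single \<equiv> Poly_Mapping.single"

definition monom_val :: "('v \<Rightarrow> 'b::comm_semiring_1) \<Rightarrow> ('v \<Rightarrow>\<^sub>0 nat) \<Rightarrow> 'b" where
  "monom_val a m = (\<Prod>v\<in>keys m. a v ^ lookup m v)"

lemma monom_val_superset:
  assumes "finite V" "keys m \<subseteq> V"
  shows "monom_val a m = (\<Prod>v\<in>V. a v ^ lookup m v)"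
  unfolding monom_val_def using assms
  by (intro prod.mono_neutral_left) (auto simp: in_keys_iff)

lemma monom_val_zero [simp]: "monom_val a 0 = 1"
  by (simp add: monom_val_def)

lemma monom_val_add: "monom_val a (m + n) = monom_val a m * monom_val a n"
proof -
  let ?V = "keys m \<union> keys n"
  have "monom_val a (m + n) = (\<Prod>v\<in>?V. a v ^ lookup (m + n) v)"
    using Poly_Mapping.keys_add[of m n] by (intro monom_val_superset) auto
  also have "\<dots> = (\<Prod>v\<in>?V. a v ^ lookup m v) * (\<Prod>v\<in>?V. a v ^ lookup n v)"
    by (simp add: lookup_add power_add prod.distrib)
  also have "\<dots> = monom_val a m * monom_val a n"
    by (simp add: monom_val_superset[of ?V])
  finally show ?thesis .
qed

lemma monom_val_single: "monom_val a (single v k) = a v ^ k"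
  by (subst monom_val_superset[of "{v}"]) auto

lemma monom_val_cong: "(\<And>v. v \<in> keys m \<Longrightarrow> a v = b v) \<Longrightarrow> monom_val a m = monom_val b m"
  by (simp add: monom_val_def)

definition semiring_hom :: "('a::comm_semiring_1 \<Rightarrow> 'b::comm_semiring_1) \<Rightarrow> bool" where
  "semiring_hom h \<longleftrightarrow> h 0 = 0 \<and> h 1 = 1 \<and> (\<forall>x y. h (x + y) = h x + h y) \<and> (\<forall>x y. h (x * y) = h x * h y)"

lemma semiring_hom_simps:
  assumes "semiring_hom h"
  shows "h 0 = 0" "h 1 = 1" "h (x + y) = h x + h y" "h (x * y) = h x * h y"
  using assms by (auto simp: semiring_hom_def)

lemma semiring_hom_sum: "semiring_hom h \<Longrightarrow> h (\<Sum>i\<in>I. f i) = (\<Sum>i\<in>I. h (f i))"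
  by (induction I rule: infinite_finite_induct) (auto simp: semiring_hom_simps)

lemma semiring_hom_prod: "semiring_hom h \<Longrightarrow> h (\<Prod>i\<in>I. f i) = (\<Prod>i\<in>I. h (f i))"
  by (induction I rule: infinite_finite_induct) (auto simp: semiring_hom_simps)

lemma semiring_hom_power: "semiring_hom h \<Longrightarrow> h (x ^ k) = h x ^ k"
  by (induction k) (auto simp: semiring_hom_simps)

lemma semiring_hom_id: "semiring_hom (\<lambda>c. c)"
  by (simp add: semiring_hom_def)

lemma semiring_hom_of_real: "semiring_hom (of_real :: real \<Rightarrow> complex)"
  by (simp add: semiring_hom_def)

lemma semiring_hom_poly_const: "semiring_hom (\<lambda>c::real. [:complex_of_real c:])"
  by (simp add: semiring_hom_def one_pCons)

lemma semiring_hom_poly: "semiring_hom (\<lambda>p. poly p (z::'a::comm_semiring_1))"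
  by (simp add: semiring_hom_def)

lemma semiring_hom_mconst: "semiring_hom (mconst :: 'a::comm_semiring_1 \<Rightarrow> ('v, 'a) mpoly)"
  by (simp add: semiring_hom_def mconst_def single_add mult_single)

lemma mpoly_subst_monom_val:
  "mpoly_subst h a p = (\<Sum>m\<in>keys p. h (lookup p m) * monom_val a m)"
  by (simp add: mpoly_subst_def monom_val_def)

lemma mpoly_subst_superset:
  assumes "semiring_hom h" "finite S" "keys p \<subseteq> S"
  shows "mpoly_subst h a p = (\<Sum>m\<in>S. h (lookup p m) * monom_val a m)"
  unfolding mpoly_subst_monom_val using assms
  by (intro sum.mono_neutral_left) (auto simp: in_keys_iff semiring_hom_simps)

lemma mpoly_subst_add:
  assumes "semiring_hom h"
  shows "mpoly_subst h a (p + q) = mpoly_subst h a p + mpoly_subst h a q"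
proof -
  let ?S = "keys p \<union> keys q"
  have "mpoly_subst h a (p + q) = (\<Sum>m\<in>?S. h (lookup (p + q) m) * monom_val a m)"
    using Poly_Mapping.keys_add[of p q] by (intro mpoly_subst_superset assms) auto
  also have "\<dots> = (\<Sum>m\<in>?S. h (lookup p m) * monom_val a m) + (\<Sum>m\<in>?S. h (lookup q m) * monom_val a m)"
    by (simp add: lookup_add semiring_hom_simps[OF assms] distrib_right sum.distrib)
  also have "\<dots> = mpoly_subst h a p + mpoly_subst h a q"
    by (simp add: mpoly_subst_superset[OF assms, of ?S])
  finally show ?thesis .
qed

lemma mpoly_subst_zero: "mpoly_subst h a 0 = 0"
  by (simp add: mpoly_subst_def)

lemma mpoly_subst_sum:
  "semiring_hom h \<Longrightarrow> mpoly_subst h a (\<Sum>i\<in>I. f i) = (\<Sum>i\<in>I. mpoly_subst h a (f i))"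
  by (induction I rule: infinite_finite_induct) (auto simp: mpoly_subst_zero mpoly_subst_add)

lemma mpoly_subst_single: "semiring_hom h \<Longrightarrow> mpoly_subst h a (single m c) = h c * monom_val a m"
  by (subst mpoly_subst_superset[of h "{m}"]) (auto split: if_splits)

lemma mpoly_sum_single: "(p :: ('v, 'a::comm_semiring_1) mpoly) = (\<Sum>m\<in>keys p. single m (lookup p m))"
  by (rule poly_mapping_eqI) (simp add: lookup_sum lookup_single when_def in_keys_iff)

lemma mpoly_mult_sum_single:
  fixes p q :: "('v, 'a::comm_semiring_1) mpoly"
  shows "p * q = (\<Sum>m\<in>keys p. \<Sum>n\<in>keys q. single (m + n) (lookup p m * lookup q n))"
proof -
  have "p * q = (\<Sum>m\<in>keys p. single m (lookup p m)) * (\<Sum>n\<in>keys q. single n (lookup q n))"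
    using mpoly_sum_single[of p] mpoly_sum_single[of q] by simp
  then show ?thesis by (simp add: sum_product mult_single)
qed

lemma mpoly_subst_mult:
  assumes "semiring_hom h"
  shows "mpoly_subst h a (p * q) = mpoly_subst h a p * mpoly_subst h a q"
proof -
  have "mpoly_subst h a (p * q) =
      (\<Sum>m\<in>keys p. \<Sum>n\<in>keys q. (h (lookup p m) * monom_val a m) * (h (lookup q n) * monom_val a n))"
    unfolding mpoly_mult_sum_single[of p q]
    by (simp add: mpoly_subst_sum mpoly_subst_single assms monom_val_add semiring_hom_simps[OF assms] mult_ac)
  then show ?thesis by (simp add: mpoly_subst_monom_val sum_product)
qed

lemma mpoly_subst_one: "semiring_hom h \<Longrightarrow> mpoly_subst h a 1 = 1"
  using mpoly_subst_single[of h a 0 1] by (simp add: semiring_hom_simps)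

lemma semiring_hom_mpoly_subst: "semiring_hom h \<Longrightarrow> semiring_hom (mpoly_subst h a)"
  by (simp add: semiring_hom_def[of "mpoly_subst h a"] mpoly_subst_zero mpoly_subst_one mpoly_subst_add mpoly_subst_mult)

lemma mpoly_subst_power: "semiring_hom h \<Longrightarrow> mpoly_subst h a (p ^ k) = mpoly_subst h a p ^ k"
  by (rule semiring_hom_power[OF semiring_hom_mpoly_subst])

lemma mpoly_subst_mconst: "semiring_hom h \<Longrightarrow> mpoly_subst h a (mconst c) = h c"
  unfolding mconst_def by (subst mpoly_subst_single) simp_all

lemma mpoly_subst_mvar: "semiring_hom h \<Longrightarrow> mpoly_subst h a (mvar v) = a v"
  unfolding mvar_def by (subst mpoly_subst_single) (simp_all add: monom_val_single semiring_hom_simps)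

lemmas mpoly_subst_simps = mpoly_subst_one mpoly_subst_add mpoly_subst_mult mpoly_subst_power
  mpoly_subst_mconst mpoly_subst_mvar mpoly_subst_sum

lemma hom_mpoly_subst:
  assumes "semiring_hom k"
  shows "k (mpoly_subst h a p) = mpoly_subst (\<lambda>c. k (h c)) (\<lambda>v. k (a v)) p"
  by (simp add: mpoly_subst_def semiring_hom_sum[OF assms] semiring_hom_prod[OF assms]
      semiring_hom_power[OF assms] semiring_hom_simps[OF assms])

lemma mpoly_subst_mpoly_subst:
  assumes "semiring_hom h"
  shows "mpoly_subst h a (mpoly_subst mconst b p) = mpoly_subst h (\<lambda>v. mpoly_subst h a (b v)) p"
  by (subst hom_mpoly_subst[OF semiring_hom_mpoly_subst[OF assms]]) (simp add: mpoly_subst_mconst[OF assms])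

lemma monom_val_mvar: "monom_val mvar m = (single m 1 :: ('v, 'a::comm_semiring_1) mpoly)"
proof -
  have p: "(mvar v :: ('v, 'a) mpoly) ^ k = single (single v k) 1" for v k
    by (induction k) (auto simp: mvar_def mult_single single_add[symmetric] Poly_Mapping.single_one)
  have "(\<Prod>v\<in>S. (mvar v :: ('v, 'a) mpoly) ^ lookup m v) = single (\<Sum>v\<in>S. single v (lookup m v)) 1" if "finite S" for S
    using that by (induction S rule: finite_induct) (auto simp: p mult_single)
  moreover have "(\<Sum>v\<in>keys m. single v (lookup m v)) = m"
    by (rule poly_mapping_eqI) (simp add: lookup_sum lookup_single when_def in_keys_iff)
  ultimately show ?thesis by (simp add: monom_val_def)
qed

lemma mpoly_subst_mconst_mvar: "mpoly_subst mconst mvar p = (p :: ('v, 'a::comm_semiring_1) mpoly)"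
proof -
  have "mpoly_subst mconst mvar p = (\<Sum>m\<in>keys p. single m (lookup p m))"
    unfolding mpoly_subst_monom_val monom_val_mvar by (simp add: mconst_def mult_single)
  then show ?thesis using mpoly_sum_single[of p] by simp
qed

lemma mpoly_subst_cong:
  assumes "p \<in> mpolys_in V" "\<And>v. v \<in> V \<Longrightarrow> a v = b v"
  shows "mpoly_subst h a p = mpoly_subst h b p"
  unfolding mpoly_subst_monom_val using assms
  by (intro sum.cong refl arg_cong2[of _ _ _ _ "(*)"] monom_val_cong) (auto simp: mpolys_in_def)

lemma mpolys_in_zero: "0 \<in> mpolys_in V"
  by (simp add: mpolys_in_def)

lemma mpolys_in_single: "keys m \<subseteq> V \<Longrightarrow> single m c \<in> mpolys_in V"
  by (auto simp: mpolys_in_def split: if_splits)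

lemma mpolys_in_mconst: "mconst c \<in> mpolys_in V"
  by (simp add: mconst_def mpolys_in_single)

lemma mpolys_in_one: "(1::('v, 'a::comm_semiring_1) mpoly) \<in> mpolys_in V"
  by (simp add: mpolys_in_def)

lemma mpolys_in_mvar: "v \<in> V \<Longrightarrow> mvar v \<in> mpolys_in V"
  by (simp add: mvar_def mpolys_in_single)

lemma mpolys_in_add: "p \<in> mpolys_in V \<Longrightarrow> q \<in> mpolys_in V \<Longrightarrow> p + q \<in> mpolys_in V"
  using Poly_Mapping.keys_add[of p q] by (auto simp: mpolys_in_def)

lemma mpolys_in_mult: "p \<in> mpolys_in V \<Longrightarrow> q \<in> mpolys_in V \<Longrightarrow> p * q \<in> mpolys_in V"
  unfolding mpolys_in_def
proof clarify
  fix m v assume *: "\<forall>m\<in>keys p. keys m \<subseteq> V" "\<forall>m\<in>keys q. keys m \<subseteq> V" "m \<in> keys (p * q)" "v \<in> keys m"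
  then obtain a b where "m = a + b" "a \<in> keys p" "b \<in> keys q" using keys_mult[of p q] by auto
  then have "v \<in> keys a \<union> keys b" using *(4) Poly_Mapping.keys_add[of a b] by blast
  then show "v \<in> V" using *(1,2) \<open>a \<in> keys p\<close> \<open>b \<in> keys q\<close> by blast
qed

lemma mpolys_in_sum: "(\<And>i. i \<in> I \<Longrightarrow> f i \<in> mpolys_in V) \<Longrightarrow> (\<Sum>i\<in>I. f i) \<in> mpolys_in V"
  by (induction I rule: infinite_finite_induct) (auto intro: mpolys_in_add mpolys_in_zero)

lemma mpolys_in_prod:
  "(\<And>i. i \<in> I \<Longrightarrow> f i \<in> mpolys_in V) \<Longrightarrow> (\<Prod>i\<in>I. f i :: ('v, 'a::comm_semiring_1) mpoly) \<in> mpolys_in V"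
  by (induction I rule: infinite_finite_induct) (auto intro: mpolys_in_mult mpolys_in_one)

lemma mpolys_in_power: "(p :: ('v, 'a::comm_semiring_1) mpoly) \<in> mpolys_in V \<Longrightarrow> p ^ k \<in> mpolys_in V"
  by (induction k) (auto intro: mpolys_in_mult mpolys_in_one)

lemma mpolys_in_uminus: "(p :: ('v, 'a::comm_ring_1) mpoly) \<in> mpolys_in V \<Longrightarrow> - p \<in> mpolys_in V"
  by (simp add: mpolys_in_def in_keys_iff)

lemma mpolys_in_subst:
  fixes b :: "'v \<Rightarrow> ('w, 'a::comm_semiring_1) mpoly"
  assumes "p \<in> mpolys_in V" "\<And>v. v \<in> V \<Longrightarrow> b v \<in> mpolys_in W"
  shows "mpoly_subst mconst b p \<in> mpolys_in W"
proof -
  have "b v \<in> mpolys_in W" if "m \<in> keys p" "v \<in> keys m" for m v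
    using assms(1) that by (intro assms(2)) (auto simp: mpolys_in_def)
  then show ?thesis unfolding mpoly_subst_def
    by (intro mpolys_in_sum mpolys_in_mult mpolys_in_mconst mpolys_in_prod mpolys_in_power)
qed

section \<open>Degrees and homogeneous polynomials\<close>

definition homogeneous :: "nat \<Rightarrow> ('v, 'a::zero) mpoly \<Rightarrow> bool" where
  "homogeneous d p \<longleftrightarrow> (\<forall>m\<in>keys p. mdeg m = d)"

lemma mdeg_superset: "finite V \<Longrightarrow> keys m \<subseteq> V \<Longrightarrow> mdeg m = (\<Sum>v\<in>V. lookup m v)"
  unfolding mdeg_def by (intro sum.mono_neutral_left) (auto simp: in_keys_iff)

lemma mdeg_add: "mdeg (m + n) = mdeg m + mdeg n"
proof -
  let ?V = "keys m \<union> keys n"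
  have "mdeg (m + n) = (\<Sum>v\<in>?V. lookup (m + n) v)"
    using Poly_Mapping.keys_add[of m n] by (intro mdeg_superset) auto
  then show ?thesis by (simp add: lookup_add sum.distrib mdeg_superset[of ?V m] mdeg_superset[of ?V n])
qed

lemma mdeg_zero [simp]: "mdeg 0 = 0"
  by (simp add: mdeg_def)

lemma mdeg_single [simp]: "mdeg (single v k) = k"
  by (subst mdeg_superset[of "{v}"]) auto

lemma homogeneous_zero: "homogeneous d 0"
  by (simp add: homogeneous_def)

lemma homogeneous_add: "homogeneous d p \<Longrightarrow> homogeneous d q \<Longrightarrow> homogeneous d (p + q)"
  using Poly_Mapping.keys_add[of p q] by (auto simp: homogeneous_def)

lemma homogeneous_sum: "(\<And>i. i \<in> I \<Longrightarrow> homogeneous d (f i)) \<Longrightarrow> homogeneous d (\<Sum>i\<in>I. f i)"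
  by (induction I rule: infinite_finite_induct) (auto intro: homogeneous_add homogeneous_zero)

lemma homogeneous_mult: "homogeneous d p \<Longrightarrow> homogeneous e q \<Longrightarrow> homogeneous (d + e) (p * q)"
  using keys_mult[of p q] unfolding homogeneous_def by (auto simp: mdeg_add)

lemma homogeneous_mconst: "homogeneous 0 (mconst c)"
  by (simp add: homogeneous_def mconst_def)

lemma homogeneous_one: "homogeneous 0 (1::('v, 'a::comm_semiring_1) mpoly)"
  by (simp add: homogeneous_def)

lemma homogeneous_mvar: "homogeneous 1 (mvar v)"
  by (simp add: homogeneous_def mvar_def)

lemma homogeneous_mconst_mult: "homogeneous d p \<Longrightarrow> homogeneous d (mconst c * p)"
  using homogeneous_mult[OF homogeneous_mconst, of d p c] by simp

lemma homogeneous_power: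
  "homogeneous e (p :: ('v, 'a::comm_semiring_1) mpoly) \<Longrightarrow> homogeneous (k * e) (p ^ k)"
  by (induction k) (auto intro: homogeneous_mult homogeneous_one)

lemma homogeneous_prod:
  "(\<And>i. i \<in> I \<Longrightarrow> homogeneous (e i) (f i :: ('v, 'a::comm_semiring_1) mpoly)) \<Longrightarrow> homogeneous (\<Sum>i\<in>I. e i) (\<Prod>i\<in>I. f i)"
  by (induction I rule: infinite_finite_induct) (auto intro: homogeneous_mult homogeneous_one)

lemma homogeneous_subst:
  fixes b :: "'v \<Rightarrow> ('w, 'a::comm_semiring_1) mpoly"
  assumes "homogeneous d p" "\<And>v. homogeneous 1 (b v)"
  shows "homogeneous d (mpoly_subst mconst b p)"
  unfolding mpoly_subst_def
proof (intro homogeneous_sum homogeneous_mconst_mult)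
  fix m assume "m \<in> keys p"
  then have d: "d = (\<Sum>v\<in>keys m. lookup m v * 1)" using assms(1) by (simp add: homogeneous_def mdeg_def)
  show "homogeneous d (\<Prod>v\<in>keys m. b v ^ lookup m v)"
    unfolding d by (intro homogeneous_prod homogeneous_power assms(2))
qed

lemma mpoly_subst_scale:
  assumes "homogeneous d p"
  shows "mpoly_subst h (\<lambda>v. c * a v) p = c ^ d * mpoly_subst h a p"
proof -
  have "monom_val (\<lambda>v. c * a v) m = c ^ d * monom_val a m" if "m \<in> keys p" for m
    using assms that by (simp add: homogeneous_def monom_val_def power_mult_distrib prod.distrib mdeg_def power_sum[symmetric])
  then show ?thesis
    by (simp add: mpoly_subst_monom_val sum_distrib_left mult_ac)
qed

section \<open>Partial derivatives and the chain rule\<close>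

lemma lookup_mpderiv:
  fixes p :: "('v, 'a::comm_semiring_1) mpoly"
  shows "lookup (mpderiv v p) m = of_nat (Suc (lookup m v)) * lookup p (m + single v 1)"
proof -
  have *: "(if k - single v 1 = m then of_nat (lookup k v) * lookup p k else 0) =
      (if k = m + single v 1 then of_nat (Suc (lookup m v)) * lookup p k else 0)" for k
  proof (cases "lookup k v = 0")
    case True
    then have "k \<noteq> m + single v 1" by (auto simp: lookup_add)
    with True show ?thesis by simp
  next
    case False
    then have "k - single v 1 = m \<longleftrightarrow> k = m + single v 1"
      by (auto simp: poly_mapping_eq_iff fun_eq_iff lookup_add lookup_minus lookup_single when_def)
    then show ?thesis by (auto simp: lookup_add)
  qed
  have "lookup (mpderiv v p) m = (\<Sum>k\<in>keys p. if k - single v 1 = m then of_nat (lookup k v) * lookup p k else 0)"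
    by (simp add: mpderiv_def lookup_sum lookup_single when_def)
  also have "\<dots> = of_nat (Suc (lookup m v)) * lookup p (m + single v 1)"
    unfolding * by (simp add: in_keys_iff)
  finally show ?thesis .
qed

lemma mpderiv_add: "mpderiv v (p + q) = mpderiv v p + mpderiv v (q :: ('v, 'a::comm_semiring_1) mpoly)"
  by (rule poly_mapping_eqI) (simp add: lookup_mpderiv lookup_add distrib_left del: of_nat_Suc)

lemma mpderiv_zero: "mpderiv v 0 = 0"
  by (simp add: mpderiv_def)

lemma mpderiv_sum: "mpderiv v (\<Sum>i\<in>I. f i) = (\<Sum>i\<in>I. mpderiv v (f i :: ('v, 'a::comm_semiring_1) mpoly))"
  by (induction I rule: infinite_finite_induct) (auto simp: mpderiv_add mpderiv_zero)

lemma mpderiv_single: "mpderiv v (single m c) = single (m - single v 1) (of_nat (lookup m v) * c)"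
  by (cases "c = 0") (auto simp: mpderiv_def)

lemma keys_mpderiv_subset: "keys (mpderiv v p) \<subseteq> (\<lambda>m. m - single v 1) ` keys (p :: ('v, 'a::comm_semiring_1) mpoly)"
proof
  fix m assume "m \<in> keys (mpderiv v p)"
  then have "m + single v 1 \<in> keys p" by (auto simp: in_keys_iff lookup_mpderiv)
  moreover have "m = (m + single v 1) - single v 1" by simp
  ultimately show "m \<in> (\<lambda>m. m - single v 1) ` keys p" by (rule rev_image_eqI)
qed

lemma mpolys_in_mpderiv:
  assumes "(p :: ('v, 'a::comm_semiring_1) mpoly) \<in> mpolys_in V" shows "mpderiv v p \<in> mpolys_in V"
proof -
  have "keys (m - single v 1) \<subseteq> keys m" for m :: "'v \<Rightarrow>\<^sub>0 nat" by (auto simp: in_keys_iff lookup_minus)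
  then show ?thesis using assms keys_mpderiv_subset[of v p] by (fastforce simp: mpolys_in_def)
qed

lemma homogeneous_mpderiv:
  assumes "homogeneous d (p :: ('v, 'a::comm_semiring_1) mpoly)" shows "homogeneous (d - 1) (mpderiv v p)"
  unfolding homogeneous_def
proof
  fix m assume "m \<in> keys (mpderiv v p)"
  then have "m + single v 1 \<in> keys p" by (auto simp: in_keys_iff lookup_mpderiv)
  then have "mdeg (m + single v 1) = d" using assms by (auto simp: homogeneous_def)
  then show "mdeg m = d - 1" by (simp add: mdeg_add)
qed

text \<open>The chain rule along a polynomial curve \<open>a\<close>. Applied to lines it gives the
  derivative of a fibre, the partial derivatives at a point, and the double zero on lines through a
  singular point.\<close>

lemma pderiv_mpoly_subst:
  fixes p :: "('v, real) mpoly" and a :: "'v \<Rightarrow> complex poly"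
  assumes "finite V" "p \<in> mpolys_in V"
  shows "pderiv (mpoly_subst (\<lambda>c. [:of_real c:]) a p) =
    (\<Sum>v\<in>V. pderiv (a v) * mpoly_subst (\<lambda>c. [:of_real c:]) a (mpderiv v p))"
proof -
  let ?h = "\<lambda>c::real. [:complex_of_real c:]"
  note h = semiring_hom_poly_const
  have mono: "pderiv (?h c * monom_val a m) = (\<Sum>v\<in>V. pderiv (a v) * mpoly_subst ?h a (mpderiv v (single m c)))"
    if m: "keys m \<subseteq> V" for m c
  proof -
    have mv: "of_nat (lookup m v) * monom_val a (m - single v 1) =
       of_nat (lookup m v) * (a v ^ (lookup m v - 1) * (\<Prod>w\<in>V - {v}. a w ^ lookup m w))" if v: "v \<in> V" for v
    proof -
      have "monom_val a (m - single v 1) = (\<Prod>w\<in>V. a w ^ lookup (m - single v 1) w)"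
        using m by (intro monom_val_superset assms) (auto simp: in_keys_iff lookup_minus)
      also have "\<dots> = a v ^ lookup (m - single v 1) v * (\<Prod>w\<in>V - {v}. a w ^ lookup (m - single v 1) w)"
        using assms(1) v by (rule prod.remove)
      also have "\<dots> = a v ^ (lookup m v - 1) * (\<Prod>w\<in>V - {v}. a w ^ lookup m w)"
        by (intro arg_cong2[of _ _ _ _ "(*)"] prod.cong) (auto simp: lookup_minus lookup_single)
      finally show ?thesis by simp
    qed
    have "pderiv (monom_val a m) = (\<Sum>v\<in>V. (\<Prod>w\<in>V - {v}. a w ^ lookup m w) * pderiv (a v ^ lookup m v))"
      by (simp add: monom_val_superset[OF assms(1) m] pderiv_prod)
    also have "\<dots> = (\<Sum>v\<in>V. pderiv (a v) * (of_nat (lookup m v) * monom_val a (m - single v 1)))"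
    proof (intro sum.cong refl)
      fix v assume v: "v \<in> V"
      have "(\<Prod>w\<in>V - {v}. a w ^ lookup m w) * pderiv (a v ^ lookup m v) =
         pderiv (a v) * (of_nat (lookup m v) * (a v ^ (lookup m v - 1) * (\<Prod>w\<in>V - {v}. a w ^ lookup m w)))"
        by (simp add: pderiv_power of_nat_poly mult_ac)
      then show "(\<Prod>w\<in>V - {v}. a w ^ lookup m w) * pderiv (a v ^ lookup m v) =
         pderiv (a v) * (of_nat (lookup m v) * monom_val a (m - single v 1))"
        by (simp only: mv[OF v])
    qed
    finally have "pderiv (monom_val a m) = \<dots>" .
    moreover have "pderiv (?h c * q) = ?h c * pderiv q" for q by (simp add: pderiv_smult)
    ultimately have "pderiv (?h c * monom_val a m) =
        (\<Sum>v\<in>V. pderiv (a v) * (?h c * (of_nat (lookup m v) * monom_val a (m - single v 1))))"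
      by (simp only: sum_distrib_left) (simp add: mult_ac)
    also have "\<dots> = (\<Sum>v\<in>V. pderiv (a v) * mpoly_subst ?h a (mpderiv v (single m c)))"
      unfolding mpderiv_single mpoly_subst_single[OF h]
      by (intro sum.cong refl) (simp add: of_nat_poly mult_ac)
    finally show ?thesis .
  qed
  have "pderiv (mpoly_subst ?h a p) = (\<Sum>m\<in>keys p. pderiv (?h (lookup p m) * monom_val a m))"
  proof -
    have "pderiv (\<Sum>m\<in>S. f m) = (\<Sum>m\<in>S. pderiv (f m))" for S and f :: "('v \<Rightarrow>\<^sub>0 nat) \<Rightarrow> complex poly"
      by (induction S rule: infinite_finite_induct) (auto simp: pderiv_add)
    then show ?thesis by (simp only: mpoly_subst_monom_val)
  qed
  also have "\<dots> = (\<Sum>m\<in>keys p. \<Sum>v\<in>V. pderiv (a v) * mpoly_subst ?h a (mpderiv v (single m (lookup p m))))"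
    using assms(2) by (intro sum.cong refl mono) (auto simp: mpolys_in_def)
  also have "\<dots> = (\<Sum>v\<in>V. pderiv (a v) * mpoly_subst ?h a (mpderiv v (\<Sum>m\<in>keys p. single m (lookup p m))))"
    by (subst sum.swap) (simp add: mpderiv_sum mpoly_subst_sum[OF h] sum_distrib_left)
  finally show ?thesis by (simp only: mpoly_sum_single[symmetric])
qed

section \<open>Polynomial functions\<close>

text \<open>Distinct monomials are linearly independent as functions: with the other variables
  fixed, a univariate polynomial in \<open>w\<close> vanishes everywhere, and its coefficient at the
  power \<open>k\<close> is a relation in fewer variables.\<close>

lemma sum_monomials_eq_0:
  fixes c :: "'i \<Rightarrow> real" and e :: "'i \<Rightarrow> 'v \<Rightarrow> nat"
  assumes "finite V" "finite S" "\<And>i j. i \<in> S \<Longrightarrow> j \<in> S \<Longrightarrow> (\<forall>v\<in>V. e i v = e j v) \<Longrightarrow> i = j"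
    and "\<And>x. (\<Sum>i\<in>S. c i * (\<Prod>v\<in>V. x v ^ e i v)) = 0" "i \<in> S"
  shows "c i = 0"
  using assms
proof (induction V arbitrary: S i rule: finite_induct)
  case empty
  then have "S = {i}" by auto
  with empty(3) show ?case by simp
next
  case (insert w W)
  define k where "k = e i w"
  define T where "T = {j \<in> S. e j w = k}"
  show ?case
  proof (rule insert.IH[of T])
    show "finite T" using insert.prems by (simp add: T_def)
    show "j = l" if "j \<in> T" "l \<in> T" "\<forall>v\<in>W. e j v = e l v" for j l
      using that insert.prems(2)[of j l] by (auto simp: T_def)
    show "i \<in> T" using insert.prems by (simp add: T_def k_def)
    show "(\<Sum>j\<in>T. c j * (\<Prod>v\<in>W. x v ^ e j v)) = 0" for x
    proof -
      define P where "P = (\<Sum>j\<in>S. monom (c j * (\<Prod>v\<in>W. x v ^ e j v)) (e j w))"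
      have "poly P t = 0" for t
      proof -
        have "(\<Prod>v\<in>insert w W. (x(w := t)) v ^ e j v) = t ^ e j w * (\<Prod>v\<in>W. x v ^ e j v)" for j
        proof -
          have "(\<Prod>v\<in>W. (x(w := t)) v ^ e j v) = (\<Prod>v\<in>W. x v ^ e j v)"
            using insert.hyps by (intro prod.cong) auto
          then show ?thesis using insert.hyps by simp
        qed
        then show ?thesis using insert.prems(3)[of "x(w := t)"] by (simp add: P_def poly_sum poly_monom mult_ac)
      qed
      then have "P = 0" using poly_all_0_iff_0 by blast
      moreover have "coeff P k = (\<Sum>j\<in>S. if e j w = k then c j * (\<Prod>v\<in>W. x v ^ e j v) else 0)"
        by (simp add: P_def coeff_sum)
      moreover have "\<dots> = (\<Sum>j\<in>T. c j * (\<Prod>v\<in>W. x v ^ e j v))"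
        using insert.prems(1) by (simp add: T_def sum.inter_filter)
      ultimately show ?thesis by simp
    qed
  qed
qed

lemma mpoly_eq_0:
  assumes "finite V" "p \<in> mpolys_in V" "\<And>x. mpoly_subst (\<lambda>c. c) x p = (0::real)"
  shows "p = 0"
proof (rule ccontr)
  assume "p \<noteq> 0"
  then obtain m where m: "m \<in> keys p" by (metis keys_eq_empty ex_in_conv)
  have k: "keys m \<subseteq> V" if "m \<in> keys p" for m using assms(2) that by (auto simp: mpolys_in_def)
  have "lookup p m = 0"
  proof (rule sum_monomials_eq_0[OF assms(1) finite_keys[of p] _ _ m])
    show "m = n" if "m \<in> keys p" "n \<in> keys p" "\<forall>v\<in>V. lookup m v = lookup n v" for m n
    proof (rule poly_mapping_eqI)
      fix v show "lookup m v = lookup n v"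
      proof (cases "v \<in> V")
        case False
        then have "v \<notin> keys m" "v \<notin> keys n" using k[OF that(1)] k[OF that(2)] by auto
        then show ?thesis by (simp add: in_keys_iff)
      qed (use that(3) in blast)
    qed
    show "(\<Sum>i\<in>keys p. lookup p i * (\<Prod>v\<in>V. x v ^ lookup i v)) = 0" for x
    proof -
      have "(\<Sum>i\<in>keys p. lookup p i * (\<Prod>v\<in>V. x v ^ lookup i v)) = mpoly_subst (\<lambda>c. c) x p"
        unfolding mpoly_subst_monom_val using k assms(1)
        by (intro sum.cong refl arg_cong2[of _ _ _ _ "(*)"] monom_val_superset[symmetric]) auto
      then show ?thesis using assms(3) by simp
    qed
  qed
  with m show False by (simp add: in_keys_iff)
qed

lemma polyfun_imp_mpoly:
  assumes "polyfun V f"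
  shows "\<exists>p\<in>mpolys_in V. \<forall>x. f x = mpoly_subst (\<lambda>c. c) x p"
proof -
  note s = mpoly_subst_simps[OF semiring_hom_id]
  show ?thesis using assms
  proof (induction rule: polyfun.induct)
    case (const c) show ?case by (rule bexI[of _ "mconst c"]) (simp_all add: s mpolys_in_mconst)
  next
    case (var v) then show ?case by (intro bexI[of _ "mvar v"]) (simp_all add: s mpolys_in_mvar)
  next
    case (add f g)
    then obtain p q where "p \<in> mpolys_in V" "\<forall>x. f x = mpoly_subst (\<lambda>c. c) x p"
      "q \<in> mpolys_in V" "\<forall>x. g x = mpoly_subst (\<lambda>c. c) x q" by auto
    then show ?case by (intro bexI[of _ "p + q"]) (simp_all add: s mpolys_in_add)
  next
    case (mult f g)
    then obtain p q where "p \<in> mpolys_in V" "\<forall>x. f x = mpoly_subst (\<lambda>c. c) x p"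
      "q \<in> mpolys_in V" "\<forall>x. g x = mpoly_subst (\<lambda>c. c) x q" by auto
    then show ?case by (intro bexI[of _ "p * q"]) (simp_all add: s mpolys_in_mult)
  qed
qed

lemma polyfun_compose:
  assumes "polyfun V f" "\<And>v. v \<in> V \<Longrightarrow> polyfun W (\<lambda>x. \<sigma> x v)"
  shows "polyfun W (\<lambda>x. f (\<sigma> x))"
  using assms by (induction rule: polyfun.induct) (auto intro: polyfun.intros)

lemma polyfun_tendsto:
  assumes "polyfun V f" "\<And>v. v \<in> V \<Longrightarrow> ((\<lambda>e. \<gamma> e v) \<longlongrightarrow> x v) F"
  shows "((\<lambda>e. f (\<gamma> e)) \<longlongrightarrow> f x) F"
  using assms by (induction rule: polyfun.induct) (auto intro: tendsto_intros)

lemma sign_determined_compose: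
  assumes "sign_determined V g" "\<And>v. v \<in> V \<Longrightarrow> polyfun W (\<lambda>x. \<sigma> x v)"
  shows "sign_determined W (\<lambda>x. g (\<sigma> x))"
proof -
  obtain fs h where fs: "\<forall>f\<in>set fs. polyfun V f" "\<And>x. g x = h (map (\<lambda>f. sgn (f x)) fs)"
    using assms(1) by (auto simp: sign_determined_def)
  have "\<forall>f\<in>set (map (\<lambda>f x. f (\<sigma> x)) fs). polyfun W f" using fs(1) by (auto intro: polyfun_compose assms(2))
  moreover have "g (\<sigma> x) = h (map (\<lambda>f. sgn (f x)) (map (\<lambda>f x. f (\<sigma> x)) fs))" for x
    by (simp add: fs(2) comp_def)
  ultimately show ?thesis unfolding sign_determined_def by (intro exI conjI allI)
qed

section \<open>From sign conditions to semialgebraic sets\<close>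

lemma semialgebraic_inter:
  assumes "semialgebraic I A" "semialgebraic I B" "A \<subseteq> affine_space I"
  shows "semialgebraic I (A \<inter> B)"
proof -
  have "A \<inter> B = affine_space I - ((affine_space I - A) \<union> (affine_space I - B))" using assms(3) by auto
  then show ?thesis using assms by (auto intro: semialgebraic.intros)
qed

lemma semialgebraic_empty: "semialgebraic I {}"
proof -
  have "{x \<in> affine_space I. mpoly_subst (\<lambda>c. c) x 0 > (0::real)} = {}" by (simp add: mpoly_subst_zero)
  then show ?thesis using semialgebraic.pos[OF mpolys_in_zero] by metis
qed

lemma semialgebraic_full: "semialgebraic I (affine_space I)"
  using semialgebraic.compl[OF semialgebraic_empty] by simp

lemma semialgebraic_sgn_eq:
  assumes "polyfun I f"
  shows "semialgebraic I {x \<in> affine_space I. sgn (f x) = s}"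
proof -
  have pos: "semialgebraic I {x \<in> affine_space I. f x > 0}" if pf: "polyfun I f" for f
  proof -
    obtain p where p: "p \<in> mpolys_in I" "\<forall>x. f x = mpoly_subst (\<lambda>c. c) x p"
      using polyfun_imp_mpoly[OF pf] by auto
    show ?thesis unfolding p(2)[rule_format] by (rule semialgebraic.pos[OF p(1)])
  qed
  have p1: "semialgebraic I {x \<in> affine_space I. f x > 0}" and p2: "semialgebraic I {x \<in> affine_space I. - f x > 0}"
    using pos[OF assms] pos[OF polyfun_uminus[OF assms]] by auto
  consider "s = 1" | "s = -1" | "s = 0" | "s \<notin> {-1, 0, 1}" by auto
  then show ?thesis
  proof cases
    case 1
    then have "{x \<in> affine_space I. sgn (f x) = s} = {x \<in> affine_space I. f x > 0}" by (auto simp: sgn_1_pos)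
    then show ?thesis using p1 by simp
  next
    case 2
    then have "{x \<in> affine_space I. sgn (f x) = s} = {x \<in> affine_space I. - f x > 0}" by (auto simp: sgn_1_neg)
    then show ?thesis using p2 by simp
  next
    case 3
    then have "{x \<in> affine_space I. sgn (f x) = s} =
      affine_space I - ({x \<in> affine_space I. f x > 0} \<union> {x \<in> affine_space I. - f x > 0})" by (auto simp: sgn_zero_iff)
    then show ?thesis using semialgebraic.compl[OF semialgebraic.un[OF p1 p2]] by simp
  next
    case 4
    then have "sgn r \<noteq> s" for r by (auto simp: sgn_if)
    then have empty: "{x \<in> affine_space I. sgn (f x) = s} = {}" by auto
    show ?thesis unfolding empty by (rule semialgebraic_empty)
  qed
qed

text \<open>The set splits into finitely many cells with constant sign vector, and each cell is an
  intersection of sets given by the sign of one polynomial.\<close>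

lemma semialgebraic_sign_determined:
  assumes "sign_determined I g"
  shows "semialgebraic I {x \<in> affine_space I. g x}"
proof -
  obtain fs h where fs: "\<forall>f\<in>set fs. polyfun I f" "\<And>x. g x = h (map (\<lambda>f. sgn (f x)) fs)"
    using assms by (auto simp: sign_determined_def)
  have list: "semialgebraic I {x \<in> affine_space I. map (\<lambda>f. sgn (f x)) fs = l}" for l
    using fs(1)
  proof (induction fs arbitrary: l)
    case Nil
    then show ?case by (cases l) (auto simp: semialgebraic_full semialgebraic_empty)
  next
    case (Cons f fs)
    show ?case
    proof (cases l)
      case Nil then show ?thesis by (simp add: semialgebraic_empty)
    next
      case (Cons s l')
      then have "{x \<in> affine_space I. map (\<lambda>f. sgn (f x)) (f # fs) = l} =
        {x \<in> affine_space I. sgn (f x) = s} \<inter> {x \<in> affine_space I. map (\<lambda>f. sgn (f x)) fs = l'}" by auto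
      then show ?thesis using Cons.prems Cons.IH by (auto intro!: semialgebraic_inter semialgebraic_sgn_eq)
    qed
  qed
  define S where "S = {l::real list. set l \<subseteq> {-1, 0, 1} \<and> length l = length fs \<and> h l}"
  have "finite S" unfolding S_def
    by (rule finite_subset[OF _ finite_lists_length_eq[of "{-1, 0, 1}" "length fs"]]) auto
  have "semialgebraic I (\<Union>l\<in>S'. {x \<in> affine_space I. map (\<lambda>f. sgn (f x)) fs = l})" if "finite S'" for S'
    using that by (induction S' rule: finite_induct) (auto simp: semialgebraic_empty intro: semialgebraic.un list)
  moreover have "{x \<in> affine_space I. g x} = (\<Union>l\<in>S. {x \<in> affine_space I. map (\<lambda>f. sgn (f x)) fs = l})"
    by (auto simp: fs(2) S_def sgn_if)
  ultimately show ?thesis using \<open>finite S\<close> by simp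
qed

text \<open>Off a proper algebraic subset a sign-determined function is locally constant.\<close>

lemma sign_determined_generic:
  fixes V :: "'v::linorder set"
  assumes "sign_determined V g" "finite V"
  obtains F where "F \<in> mpolys_in V" "F \<noteq> 0"
    "\<And>\<gamma> x G. (\<And>v. v \<in> V \<Longrightarrow> ((\<lambda>e. \<gamma> e v) \<longlongrightarrow> x v) G) \<Longrightarrow> mpoly_subst (\<lambda>c. c) x F \<noteq> (0::real) \<Longrightarrow>
       eventually (\<lambda>e. g (\<gamma> e) = g x) G"
proof -
  obtain fs h where fs: "\<forall>f\<in>set fs. polyfun V f" "\<And>x. g x = h (map (\<lambda>f. sgn (f x)) fs)"
    using assms(1) by (auto simp: sign_determined_def)
  have "\<forall>f\<in>set fs. \<exists>p. p \<in> mpolys_in V \<and> (\<forall>x. f x = mpoly_subst (\<lambda>c. c) x p)"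
  proof
    fix f assume "f \<in> set fs"
    then have "polyfun V f" using fs(1) by blast
    from polyfun_imp_mpoly[OF this] show "\<exists>p. p \<in> mpolys_in V \<and> (\<forall>x. f x = mpoly_subst (\<lambda>c. c) x p)"
      unfolding Bex_def .
  qed
  then obtain P where P: "\<forall>f\<in>set fs. P f \<in> mpolys_in V \<and> (\<forall>x. f x = mpoly_subst (\<lambda>c. c) x (P f))"
    unfolding bchoice_iff by blast
  \<comment> \<open>Identically zero polynomials have constant sign and are left out to keep the
    product nonzero; each other polynomial keeps its sign near a point where it does not
    vanish.\<close>
  define F where "F = (\<Prod>f\<in>{f\<in>set fs. P f \<noteq> 0}. P f)"
  have "F \<in> mpolys_in V" unfolding F_def using P by (intro mpolys_in_prod) auto
  moreover have "F \<noteq> 0" unfolding F_def by (subst prod_zero_iff) auto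
  moreover have "eventually (\<lambda>e. g (\<gamma> e) = g x) G"
    if \<gamma>: "\<And>v. v \<in> V \<Longrightarrow> ((\<lambda>e. \<gamma> e v) \<longlongrightarrow> x v) G" and x: "mpoly_subst (\<lambda>c. c) x F \<noteq> (0::real)" for \<gamma> x G
  proof -
    have "eventually (\<lambda>e. sgn (f (\<gamma> e)) = sgn (f x)) G" if f: "f \<in> set fs" for f
    proof (cases "P f = 0")
      case True
      have "f y = mpoly_subst (\<lambda>c. c) y (P f)" for y using P f by blast
      then show ?thesis using True by (simp add: mpoly_subst_zero)
    next
      case False
      have "mpoly_subst (\<lambda>c. c) x F = (\<Prod>f\<in>{f\<in>set fs. P f \<noteq> 0}. mpoly_subst (\<lambda>c. c) x (P f))"
        unfolding F_def by (rule semiring_hom_prod[OF semiring_hom_mpoly_subst[OF semiring_hom_id]])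
      then have "mpoly_subst (\<lambda>c. c) x (P f) \<noteq> 0" using x f False by auto
      then have nz: "f x \<noteq> 0" using P f by auto
      have "polyfun V f" using fs(1) f by blast
      then have lim: "((\<lambda>e. f (\<gamma> e)) \<longlongrightarrow> f x) G" by (rule polyfun_tendsto[OF _ \<gamma>])
      show ?thesis
      proof (cases "f x > 0")
        case True
        then show ?thesis using order_tendstoD(1)[OF lim True] by (auto elim: eventually_mono)
      next
        case False
        then have neg: "f x < 0" using nz by simp
        from order_tendstoD(2)[OF lim neg] show ?thesis by (rule eventually_mono) (simp add: neg)
      qed
    qed
    then have "eventually (\<lambda>e. \<forall>f\<in>set fs. sgn (f (\<gamma> e)) = sgn (f x)) G" by (simp add: eventually_ball_finite)
    then show ?thesis by (rule eventually_mono) (simp add: fs(2) cong: map_cong)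
  qed
  ultimately show ?thesis using that by blast
qed

section \<open>Algebraic dependence and dimension\<close>

text \<open>Gaussian elimination: given a pivot \<open>p\<close> for the equation \<open>b\<close>,
  the other unknowns solve the reduced system \<open>M'\<close>, and \<open>b\<close> then forces
  the value \<open>t\<close> of the pivot unknown.\<close>

lemma underdetermined_linear_system:
  fixes M :: "'a \<Rightarrow> 'b \<Rightarrow> real"
  assumes "finite B" "finite A" "card B < card A"
  shows "\<exists>x. (\<exists>a\<in>A. x a \<noteq> 0) \<and> (\<forall>b\<in>B. (\<Sum>a\<in>A. x a * M a b) = 0)"
  using assms
proof (induction B arbitrary: A M rule: finite_induct)
  case empty
  then have "A \<noteq> {}" by auto
  then obtain a where "a \<in> A" by blast
  then show ?case by (intro exI[of _ "\<lambda>_. 1"]) auto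
next
  case (insert b B)
  show ?case
  proof (cases "\<forall>a\<in>A. M a b = 0")
    case True
    have "card B < card A" using insert.hyps insert.prems by simp
    from insert.IH[OF insert.prems(1) this, of M] obtain x
      where "\<exists>a\<in>A. x a \<noteq> 0" "\<forall>b\<in>B. (\<Sum>a\<in>A. x a * M a b) = 0" by auto
    then show ?thesis using True by (intro exI[of _ x]) auto
  next
    case False
    then obtain p where p: "p \<in> A" "M p b \<noteq> 0" by auto
    define M' where "M' a c = M a c - M a b / M p b * M p c" for a c
    have "card B < card (A - {p})" using insert.hyps insert.prems p by simp
    from insert.IH[OF _ this, of M'] insert.prems(1) obtain x
      where x: "\<exists>a\<in>A - {p}. x a \<noteq> 0" "\<forall>c\<in>B. (\<Sum>a\<in>A - {p}. x a * M' a c) = 0" by auto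
    define t where "t = - (\<Sum>a\<in>A - {p}. x a * M a b) / M p b"
    have sum: "(\<Sum>a\<in>A. (x(p := t)) a * M a c) = t * M p c + (\<Sum>a\<in>A - {p}. x a * M a c)" for c
      using insert.prems(1) p(1) by (subst sum.remove[of A p]) auto
    have "(\<Sum>a\<in>A. (x(p := t)) a * M a c) = 0" if "c \<in> B" for c
    proof -
      have "(\<Sum>a\<in>A - {p}. x a * M' a c) =
          (\<Sum>a\<in>A - {p}. x a * M a c) - (\<Sum>a\<in>A - {p}. x a * M a b) / M p b * M p c"
      proof -
        have "(\<Sum>a\<in>A - {p}. x a * (M a b / M p b * M p c)) = (\<Sum>a\<in>A - {p}. x a * M a b) * (1 / M p b * M p c)"
          unfolding sum_distrib_right by (intro sum.cong) auto
        then show ?thesis by (simp add: M'_def right_diff_distrib sum_subtractf)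
      qed
      then show ?thesis unfolding sum using x(2) that by (simp add: t_def)
    qed
    moreover have "(\<Sum>a\<in>A. (x(p := t)) a * M a b) = 0" unfolding sum using p(2) by (simp add: t_def)
    moreover have "\<exists>a\<in>A. (x(p := t)) a \<noteq> 0" using x(1) by auto
    ultimately show ?thesis by (intro exI[of _ "x(p := t)"]) auto
  qed
qed

text \<open>Exponents are bounded one by one rather than through the total degree: the bound is
  additive under products, and the monomials obeying it are counted by a plain power.\<close>

definition exps_le :: "nat \<Rightarrow> ('v, 'a::zero) mpoly \<Rightarrow> bool" where
  "exps_le N p \<longleftrightarrow> (\<forall>m\<in>keys p. \<forall>v. lookup m v \<le> N)"

lemma exps_le_mono: "exps_le M p \<Longrightarrow> M \<le> N \<Longrightarrow> exps_le N p"
  unfolding exps_le_def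
proof (intro ballI allI)
  fix m v assume *: "\<forall>m\<in>keys p. \<forall>v. lookup m v \<le> M" "M \<le> N" "m \<in> keys p"
  then have "lookup m v \<le> M" by blast
  then show "lookup m v \<le> N" using *(2) by (rule le_trans)
qed

lemma exps_le_mult:
  assumes "exps_le M p" "exps_le N (q :: ('v, 'a::comm_semiring_1) mpoly)"
  shows "exps_le (M + N) (p * q)"
  unfolding exps_le_def
proof (intro ballI allI)
  fix m v assume "m \<in> keys (p * q)"
  then obtain a b where "m = a + b" "a \<in> keys p" "b \<in> keys q" using keys_mult[of p q] by auto
  then show "lookup m v \<le> M + N" using assms by (auto simp: exps_le_def lookup_add intro: add_mono)
qed

lemma exps_le_one: "exps_le 0 (1 :: ('v, 'a::comm_semiring_1) mpoly)"
  by (simp add: exps_le_def)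

lemma exps_le_power: "exps_le N (p :: ('v, 'a::comm_semiring_1) mpoly) \<Longrightarrow> exps_le (k * N) (p ^ k)"
  by (induction k) (auto intro: exps_le_mult exps_le_one)

lemma exps_le_prod:
  "(\<And>i. i \<in> I \<Longrightarrow> exps_le (e i) (f i :: ('v, 'a::comm_semiring_1) mpoly)) \<Longrightarrow> exps_le (\<Sum>i\<in>I. e i) (\<Prod>i\<in>I. f i)"
  by (induction I rule: infinite_finite_induct) (auto intro: exps_le_mult exps_le_one)

lemma exps_le_exists:
  fixes p :: "('v, 'a::zero) mpoly"
  shows "\<exists>N. exps_le N p"
proof -
  have a: "\<forall>v. lookup m v \<le> mdeg m" for m :: "'v \<Rightarrow>\<^sub>0 nat"
  proof
    fix v show "lookup m v \<le> mdeg m"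
    proof (cases "v \<in> keys m")
      case True then show ?thesis unfolding mdeg_def by (intro member_le_sum) auto
    qed (simp add: in_keys_iff)
  qed
  have b: "mdeg m \<le> (\<Sum>m\<in>keys p. mdeg m)" if "m \<in> keys p" for m
    using that by (intro member_le_sum) auto
  have "lookup m v \<le> (\<Sum>m\<in>keys p. mdeg m)" if "m \<in> keys p" for m v
  proof (rule le_trans)
    show "lookup m v \<le> mdeg m" using a by blast
    show "mdeg m \<le> (\<Sum>m\<in>keys p. mdeg m)" by (rule b[OF that])
  qed
  then have "exps_le (\<Sum>m\<in>keys p. mdeg m) p" unfolding exps_le_def by blast
  then show ?thesis ..
qed

lemma card_monomials_le:
  fixes J :: "'v set" and K :: nat
  assumes "finite J"
  defines "B \<equiv> {m. keys m \<subseteq> J \<and> (\<forall>v. lookup m v \<le> K)}"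
  shows "finite B" "card B \<le> Suc K ^ card J"
proof -
  let ?r = "\<lambda>m. restrict (lookup m) J"
  have inj: "inj_on ?r B"
  proof (rule inj_onI, rule poly_mapping_eqI)
    fix m n v assume mn: "m \<in> B" "n \<in> B" "?r m = ?r n"
    show "lookup m v = lookup n v"
    proof (cases "v \<in> J")
      case True then show ?thesis using fun_cong[OF mn(3), of v] by simp
    next
      case False
      then have "v \<notin> keys m" "v \<notin> keys n" using mn by (auto simp: B_def)
      then show ?thesis by (simp add: in_keys_iff)
    qed
  qed
  have img: "?r ` B \<subseteq> PiE J (\<lambda>_. {..K})" by (auto simp: B_def)
  have fin: "finite (PiE J (\<lambda>_. {..K}))" using assms by (intro finite_PiE) auto
  show "finite B" by (rule inj_on_finite[OF inj img fin])
  have "card B \<le> card (PiE J (\<lambda>_. {..K}))" by (rule card_inj_on_le[OF inj img fin])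
  also have "\<dots> = Suc K ^ card J" using assms by (simp add: card_PiE)
  finally show "card B \<le> Suc K ^ card J" .
qed

text \<open>For \<open>N = (c + 1) ^ j\<close> the estimate
  \<open>N * c + 1 \<le> (c + 1) * (N + 1)\<close> costs a factor \<open>(c + 1) ^ j = N\<close>,
  which one more factor \<open>N + 1\<close> on the right outweighs.\<close>

lemma box_dimension_count: "j < i \<Longrightarrow> \<exists>N. Suc (N * c) ^ j < Suc N ^ i" for i j c :: nat
proof
  assume "j < i"
  let ?N = "Suc c ^ j"
  have "Suc (?N * c) \<le> Suc c * Suc ?N" by simp
  then have "Suc (?N * c) ^ j \<le> (Suc c * Suc ?N) ^ j" by (rule power_mono) simp
  also have "\<dots> = ?N * Suc ?N ^ j" by (simp only: power_mult_distrib)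
  also have "\<dots> < Suc ?N * Suc ?N ^ j" by (rule mult_strict_right_mono) auto
  also have "\<dots> = Suc ?N ^ Suc j" by simp
  also have "\<dots> \<le> Suc ?N ^ i" using \<open>j < i\<close> by (intro power_increasing) auto
  finally show "Suc (?N * c) ^ j < Suc ?N ^ i" .
qed

text \<open>The monomials in the \<open>P i\<close> with exponents at most \<open>N\<close> are \<open>(N + 1) ^ card I\<close> elements of a space of
  polynomials whose dimension grows like \<open>N ^ card J\<close> only.\<close>

lemma algebraically_dependent:
  fixes P :: "'i \<Rightarrow> ('v, real) mpoly"
  assumes "finite I" "finite J" "card J < card I" "\<And>i. i \<in> I \<Longrightarrow> P i \<in> mpolys_in J"
  shows "\<exists>g\<in>mpolys_in I. g \<noteq> 0 \<and> mpoly_subst mconst P g = 0"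
proof -
  have "\<forall>i. \<exists>N. exps_le N (P i)" by (intro allI exps_le_exists)
  then obtain e where e: "\<And>i. exps_le (e i) (P i)" unfolding choice_iff by blast
  define D where "D = (\<Sum>i\<in>I. e i)"
  have D: "exps_le D (P i)" if "i \<in> I" for i
    using e[of i] member_le_sum[OF that, of e] assms(1) by (auto simp: D_def intro: exps_le_mono)
  obtain N where N: "Suc (N * (card I * D)) ^ card J < Suc N ^ card I"
    using box_dimension_count[OF assms(3)] by blast
  define K where "K = N * (card I * D)"
  define B where "B = {m. keys m \<subseteq> J \<and> (\<forall>v. lookup m v \<le> K)}"
  define A where "A = PiE I (\<lambda>_. {..N})"
  define mk where "mk a = (\<Sum>i\<in>I. single i (a i))" for a :: "'i \<Rightarrow> nat"
  have lookup_mk: "lookup (mk a) i = (if i \<in> I then a i else 0)" for a i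
    using assms(1) by (simp add: mk_def lookup_sum lookup_single when_def)
  then have keys_mk: "keys (mk a) \<subseteq> I" for a by (auto simp: in_keys_iff split: if_splits)
  have finA: "finite A" and cardA: "card A = Suc N ^ card I"
    using assms(1) by (auto simp: A_def card_PiE intro: finite_PiE)
  have inj: "inj_on mk A"
  proof (rule inj_onI)
    fix a b assume ab: "a \<in> A" "b \<in> A" "mk a = mk b"
    have "a i = b i" if "i \<in> I" for i using lookup_mk[of a i] lookup_mk[of b i] that ab(3) by simp
    then show "a = b" using ab(1,2) unfolding A_def by (intro PiE_ext) auto
  qed
  note B = card_monomials_le[OF assms(2), of K, folded B_def]
  have "card B < card A" using B(2) N by (simp add: cardA K_def)
  \<comment> \<open>The unknowns are the coefficients of the relation, one for each product of
    powers; the equations are the coefficients at the monomials of the box \<open>B\<close>, which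
    are fewer.\<close>
  from underdetermined_linear_system[OF B(1) finA this, of "\<lambda>a. lookup (monom_val P (mk a))"]
  obtain x where x: "\<exists>a\<in>A. x a \<noteq> 0" "\<forall>b\<in>B. (\<Sum>a\<in>A. x a * lookup (monom_val P (mk a)) b) = 0"
    by blast
  define g where "g = (\<Sum>a\<in>A. single (mk a) (x a))"
  have "g \<in> mpolys_in I" unfolding g_def by (intro mpolys_in_sum mpolys_in_single keys_mk)
  moreover have "g \<noteq> 0"
  proof
    assume "g = 0"
    obtain a where a: "a \<in> A" "x a \<noteq> 0" using x(1) by blast
    have "lookup g (mk a) = (\<Sum>b\<in>A. if b = a then x b else 0)"
      unfolding g_def lookup_sum lookup_single when_def
      using inj a(1) by (intro sum.cong refl if_cong) (auto dest: inj_onD)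
    also have "\<dots> = x a" using finA a by simp
    finally show False using a \<open>g = 0\<close> by simp
  qed
  moreover have "mpoly_subst mconst P g = 0"
  proof (rule poly_mapping_eqI)
    fix b
    \<comment> \<open>Outside \<open>B\<close> there is nothing to solve: the product has
      \<open>card I\<close> factors with powers at most \<open>N\<close> of polynomials with
      exponents at most \<open>D\<close>, so it stays within the bound \<open>K\<close>.\<close>
    have supp: "lookup (monom_val P (mk a)) b = 0" if "a \<in> A" "b \<notin> B" for a
    proof -
      have "monom_val P (mk a) = (\<Prod>i\<in>I. P i ^ lookup (mk a) i)"
        using keys_mk assms(1) by (intro monom_val_superset)
      also have "\<dots> = (\<Prod>i\<in>I. P i ^ a i)" by (intro prod.cong) (auto simp: lookup_mk)
      finally have mv: "monom_val P (mk a) = (\<Prod>i\<in>I. P i ^ a i)" .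
      have "exps_le (\<Sum>i\<in>I. a i * D) (\<Prod>i\<in>I. P i ^ a i)"
        by (intro exps_le_prod exps_le_power D)
      moreover have "(\<Sum>i\<in>I. a i * D) \<le> K"
      proof -
        have "(\<Sum>i\<in>I. a i * D) \<le> of_nat (card I) * (N * D)"
          by (rule sum_bounded_above) (use that(1) in \<open>auto simp: A_def PiE_def Pi_def\<close>)
        then show ?thesis by (simp add: K_def mult_ac)
      qed
      ultimately have "exps_le K (monom_val P (mk a))" unfolding mv by (rule exps_le_mono)
      moreover have "monom_val P (mk a) \<in> mpolys_in J" unfolding mv
        by (intro mpolys_in_prod mpolys_in_power assms(4))
      ultimately have "keys (monom_val P (mk a)) \<subseteq> B" by (auto simp: B_def exps_le_def mpolys_in_def)
      with that(2) show ?thesis by (auto simp: in_keys_iff)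
    qed
    have "mpoly_subst mconst P g = (\<Sum>a\<in>A. mconst (x a) * monom_val P (mk a))"
      by (simp add: g_def mpoly_subst_sum[OF semiring_hom_mconst] mpoly_subst_single[OF semiring_hom_mconst])
    moreover have "lookup (mconst c * p) b = c * lookup p b" for c and p :: "('v, real) mpoly"
    proof -
      have "mconst c * p = (\<Sum>m\<in>keys p. single m (c * lookup p m))"
        by (subst (1) mpoly_sum_single) (simp add: mconst_def sum_distrib_left mult_single)
      then show ?thesis by (simp add: lookup_sum lookup_single when_def in_keys_iff)
    qed
    ultimately have "lookup (mpoly_subst mconst P g) b = (\<Sum>a\<in>A. x a * lookup (monom_val P (mk a)) b)"
      by (simp add: lookup_sum)
    also have "\<dots> = 0"
    proof (cases "b \<in> B")
      case True then show ?thesis using x(2) by blast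
    next
      case False then show ?thesis using supp by simp
    qed
    finally show "lookup (mpoly_subst mconst P g) b = lookup 0 b" by simp
  qed
  ultimately show ?thesis by blast
qed

lemma polynomial_image_in_hypersurface:
  fixes \<phi> :: "'i \<Rightarrow> ('v \<Rightarrow> real) \<Rightarrow> real"
  assumes "finite I" "finite J" "card J < card I" "\<And>i. i \<in> I \<Longrightarrow> polyfun J (\<phi> i)"
  obtains g where "g \<in> mpolys_in I" "g \<noteq> 0" "\<And>y. mpoly_subst (\<lambda>c. c) (\<lambda>i. \<phi> i y) g = 0"
proof -
  have "\<forall>i\<in>I. \<exists>p. p \<in> mpolys_in J \<and> (\<forall>x. \<phi> i x = mpoly_subst (\<lambda>c. c) x p)"
    using polyfun_imp_mpoly[OF assms(4)] unfolding Bex_def by blast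
  then obtain P where P: "\<forall>i\<in>I. P i \<in> mpolys_in J \<and> (\<forall>x. \<phi> i x = mpoly_subst (\<lambda>c. c) x (P i))"
    unfolding bchoice_iff by blast
  have "\<exists>g\<in>mpolys_in I. g \<noteq> 0 \<and> mpoly_subst mconst P g = 0"
    by (rule algebraically_dependent[OF assms(1-3)]) (use P in auto)
  then obtain g where g: "g \<in> mpolys_in I" "g \<noteq> 0" "mpoly_subst mconst P g = 0" by auto
  have "mpoly_subst (\<lambda>c. c) (\<lambda>i. \<phi> i y) g = 0" for y
  proof -
    have "mpoly_subst (\<lambda>c. c) (\<lambda>i. \<phi> i y) g = mpoly_subst (\<lambda>c. c) (\<lambda>i. mpoly_subst (\<lambda>c. c) y (P i)) g"
      using P by (intro mpoly_subst_cong[OF g(1)]) auto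
    also have "\<dots> = mpoly_subst (\<lambda>c. c) y (mpoly_subst mconst P g)"
      by (rule mpoly_subst_mpoly_subst[OF semiring_hom_id, symmetric])
    finally show ?thesis by (simp add: g(3) mpoly_subst_zero)
  qed
  with g that show ?thesis by blast
qed

section \<open>Chains of prime ideals and Krull dimension\<close>

lemma polynomial_ring_simps [simp]:
  "carrier (polynomial_ring I) = mpolys_in I" "mult (polynomial_ring I) = (*)" "one (polynomial_ring I) = 1"
  "zero (polynomial_ring I) = 0" "add (polynomial_ring I) = (+)"
  by (simp_all add: polynomial_ring_def)

lemma cring_polynomial_ring: "cring (polynomial_ring I)"
proof (rule cringI)
  show "abelian_group (polynomial_ring I)"
  proof (rule abelian_groupI)
    fix x assume x: "x \<in> carrier (polynomial_ring I)"
    show "\<exists>y\<in>carrier (polynomial_ring I). y \<oplus>\<^bsub>polynomial_ring I\<^esub> x = \<zero>\<^bsub>polynomial_ring I\<^esub>"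
      using x by (intro bexI[of _ "- x"]) (auto intro: mpolys_in_uminus)
  qed (auto simp: mpolys_in_zero algebra_simps intro: mpolys_in_add)
  show "comm_monoid (polynomial_ring I)"
    by (rule comm_monoidI) (auto simp: mpolys_in_one algebra_simps intro: mpolys_in_mult)
qed (auto simp: algebra_simps)

text \<open>The linear order on the variables induces one on the monomials, on which the absence of
  zero divisors rests.\<close>

lemma domain_polynomial_ring: "domain (polynomial_ring (I :: 'i::linorder set))"
  by (rule domain.intro[OF cring_polynomial_ring], rule domain_axioms.intro) auto

lemma primeideal_polynomial_ring_simps:
  assumes "primeideal Q (polynomial_ring I)"
  shows "Q \<subseteq> mpolys_in I" "0 \<in> Q" "a \<in> Q \<Longrightarrow> b \<in> Q \<Longrightarrow> a + b \<in> Q"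
    "a \<in> Q \<Longrightarrow> r \<in> mpolys_in I \<Longrightarrow> r * a \<in> Q"
    "a \<in> mpolys_in I \<Longrightarrow> b \<in> mpolys_in I \<Longrightarrow> a * b \<in> Q \<Longrightarrow> a \<in> Q \<or> b \<in> Q" "1 \<notin> Q"
proof -
  interpret primeideal Q "polynomial_ring I" by fact
  show "Q \<subseteq> mpolys_in I" using a_subset by simp
  show "0 \<in> Q" using additive_subgroup.zero_closed[OF is_additive_subgroup] by simp
  show "a \<in> Q \<Longrightarrow> b \<in> Q \<Longrightarrow> a + b \<in> Q" using additive_subgroup.a_closed[OF is_additive_subgroup, of a b] by simp
  show "a \<in> Q \<Longrightarrow> r \<in> mpolys_in I \<Longrightarrow> r * a \<in> Q" using I_l_closed[of a r] by simp
  show "a \<in> mpolys_in I \<Longrightarrow> b \<in> mpolys_in I \<Longrightarrow> a * b \<in> Q \<Longrightarrow> a \<in> Q \<or> b \<in> Q" using I_prime[of a b] by simp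
  show "1 \<notin> Q" using one_imp_carrier I_notcarr by auto
qed

text \<open>Elements \<open>f i \<in> Q (i + 1) - Q i\<close> of a chain of primes are algebraically independent: dividing a
  relation in \<open>Q j\<close> by the lowest power of \<open>f j\<close> leaves a relation in \<open>Q (j + 1)\<close> among the later ones.\<close>

lemma no_relation_along_prime_chain:
  fixes Q :: "nat \<Rightarrow> ('v, real) mpoly set" and c :: "(nat \<Rightarrow>\<^sub>0 nat) \<Rightarrow> real"
  assumes prime: "\<And>i. i \<le> k \<Longrightarrow> primeideal (Q i) (polynomial_ring I)"
    and f: "\<And>i. i < k \<Longrightarrow> f i \<in> Q (Suc i) - Q i"
    and chain: "\<And>i. i < k \<Longrightarrow> Q i \<subseteq> Q (Suc i)"
  shows "j \<le> k \<Longrightarrow> finite S \<Longrightarrow> S \<noteq> {} \<Longrightarrow> (\<And>m. m \<in> S \<Longrightarrow> c m \<noteq> 0 \<and> keys m \<subseteq> {..<k}) \<Longrightarrow>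
    (\<And>m m' v. m \<in> S \<Longrightarrow> m' \<in> S \<Longrightarrow> v < j \<Longrightarrow> lookup m v = lookup m' v) \<Longrightarrow>
    (\<Sum>m\<in>S. mconst (c m) * (\<Prod>v\<in>{j..<k}. f v ^ lookup m v)) \<notin> Q j"
proof (induction "k - j" arbitrary: j S)
  case 0
  then have j: "j = k" by simp
  obtain m where m: "m \<in> S" using 0 by blast
  \<comment> \<open>At the end of the chain the monomials of \<open>S\<close> agree in all
    variables, so a single nonzero constant is left, and a prime ideal contains no unit.\<close>
  have "S = {m}"
  proof -
    have "m' = m" if "m' \<in> S" for m'
    proof (rule poly_mapping_eqI)
      fix v show "lookup m' v = lookup m v"
      proof (cases "v < k")
        case True then show ?thesis using 0(6)[OF that m] j by simp
      next
        case False
        then have "v \<notin> keys m" "v \<notin> keys m'" using 0(5)[OF that] 0(5)[OF m] by auto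
        then show ?thesis by (simp add: in_keys_iff)
      qed
    qed
    then show ?thesis using m by blast
  qed
  moreover have "mconst (c m) \<notin> Q k"
  proof
    assume "mconst (c m) \<in> Q k"
    then have "mconst (1 / c m) * mconst (c m) \<in> Q k"
      by (intro primeideal_polynomial_ring_simps(4)[OF prime] mpolys_in_mconst) auto
    moreover have "mconst (1 / c m) * mconst (c m) = (1 :: ('v, real) mpoly)"
      using 0(5)[OF m] by (simp add: mconst_def mult_single)
    ultimately show False using primeideal_polynomial_ring_simps(6)[OF prime[of k]] by simp
  qed
  ultimately show ?case using j by simp
next
  case (Suc d)
  then have jk: "j < k" by simp
  note Qj = primeideal_polynomial_ring_simps[OF prime[OF less_imp_le[OF jk]]]
  note QS = primeideal_polynomial_ring_simps[OF prime[OF Suc_leI[OF jk]]]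
  have fI: "f v \<in> mpolys_in I" if "v < k" for v
    using f[OF that] primeideal_polynomial_ring_simps(1)[OF prime[of "Suc v"]] that by auto
  \<comment> \<open>The terms with the lowest power of \<open>f j\<close> are collected in
    \<open>A\<close>; after division by that power the others keep a factor
    \<open>f j\<close>.\<close>
  define e where "e = Min ((\<lambda>m. lookup m j) ` S)"
  have emin: "e \<le> lookup m j" if "m \<in> S" for m using that Suc(4) by (simp add: e_def)
  have "e \<in> (\<lambda>m. lookup m j) ` S" unfolding e_def using Suc(4,5) by (intro Min_in) auto
  then obtain m0 where m0: "m0 \<in> S" "lookup m0 j = e" by auto
  define S0 where "S0 = {m \<in> S. lookup m j = e}"
  define T where "T m = mconst (c m) * (\<Prod>v\<in>{Suc j..<k}. f v ^ lookup m v)" for m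
  define A where "A = (\<Sum>m\<in>S0. T m)"
  define B where "B = (\<Sum>m\<in>S - S0. f j ^ (lookup m j - Suc e) * T m)"
  have TI: "T m \<in> mpolys_in I" for m unfolding T_def
    by (intro mpolys_in_mult mpolys_in_mconst mpolys_in_prod mpolys_in_power fI) auto
  have AI: "A \<in> mpolys_in I" unfolding A_def by (intro mpolys_in_sum TI)
  have BI: "B \<in> mpolys_in I" unfolding B_def
    by (intro mpolys_in_sum mpolys_in_mult TI mpolys_in_power fI jk)
  have split: "mconst (c m) * (\<Prod>v\<in>{j..<k}. f v ^ lookup m v) = f j ^ lookup m j * T m" for m
    using jk by (simp add: T_def prod.atLeast_Suc_lessThan mult_ac)
  have "(\<Sum>m\<in>S. mconst (c m) * (\<Prod>v\<in>{j..<k}. f v ^ lookup m v)) =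
      (\<Sum>m\<in>S0. f j ^ lookup m j * T m) + (\<Sum>m\<in>S - S0. f j ^ lookup m j * T m)"
    unfolding split using Suc(4) by (subst sum.subset_diff[of S0 S]) (auto simp: S0_def add.commute)
  also have "(\<Sum>m\<in>S0. f j ^ lookup m j * T m) = f j ^ e * A"
    unfolding A_def sum_distrib_left by (intro sum.cong) (auto simp: S0_def)
  also have "(\<Sum>m\<in>S - S0. f j ^ lookup m j * T m) = f j ^ e * (f j * B)"
    unfolding B_def sum_distrib_left
  proof (intro sum.cong refl)
    fix m assume "m \<in> S - S0"
    then have "e < lookup m j" using emin[of m] by (auto simp: S0_def)
    then have "f j ^ lookup m j = f j ^ (e + Suc (lookup m j - Suc e))" by simp
    then have "f j ^ lookup m j = f j ^ e * (f j * f j ^ (lookup m j - Suc e))" by (simp only: power_add power_Suc)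
    then show "f j ^ lookup m j * T m = f j ^ e * (f j * (f j ^ (lookup m j - Suc e) * T m))"
      by (simp only: mult.assoc)
  qed
  finally have eq: "(\<Sum>m\<in>S. mconst (c m) * (\<Prod>v\<in>{j..<k}. f v ^ lookup m v)) = f j ^ e * (A + f j * B)"
    by (simp only: distrib_left)
  \<comment> \<open>\<open>Q j\<close> is prime and does not contain \<open>f j\<close>, so powers
    of \<open>f j\<close> can be cancelled in it.\<close>
  have pow: "f j ^ l * x \<in> Q j \<Longrightarrow> x \<in> Q j" if "x \<in> mpolys_in I" for l x
  proof (induction l)
    case (Suc l)
    then have "f j * (f j ^ l * x) \<in> Q j" by (simp add: mult.assoc)
    then have "f j \<in> Q j \<or> f j ^ l * x \<in> Q j"
      by (intro Qj(5)) (auto intro: fI jk mpolys_in_mult mpolys_in_power that)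
    then show ?case using f[OF jk] Suc.IH by auto
  qed simp
  show ?case
  proof
    assume "(\<Sum>m\<in>S. mconst (c m) * (\<Prod>v\<in>{j..<k}. f v ^ lookup m v)) \<in> Q j"
    then have "A + f j * B \<in> Q j" unfolding eq by (rule pow[rotated]) (intro mpolys_in_add mpolys_in_mult AI BI fI jk)
    then have "A + f j * B \<in> Q (Suc j)" using chain[OF jk] by blast
    \<comment> \<open>One step up the chain \<open>f j\<close> itself lies in the ideal, so the
      terms with a further factor \<open>f j\<close> drop out and \<open>A\<close> remains.\<close>
    moreover have "(- B) * f j \<in> Q (Suc j)" using f[OF jk] by (intro QS(4) mpolys_in_uminus BI) auto
    ultimately have "(A + f j * B) + (- B) * f j \<in> Q (Suc j)" by (rule QS(3))
    then have "A \<in> Q (Suc j)" by (simp add: algebra_simps)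
    moreover have "A \<notin> Q (Suc j)" unfolding A_def T_def
    proof (rule Suc.hyps(1))
      show "d = k - Suc j" using Suc.hyps(2) by simp
      show "Suc j \<le> k" using jk by simp
      show "finite S0" "S0 \<noteq> {}" using Suc(4) m0 by (auto simp: S0_def)
      show "c m \<noteq> 0 \<and> keys m \<subseteq> {..<k}" if "m \<in> S0" for m using that Suc(6) by (simp add: S0_def)
      show "lookup m v = lookup m' v" if "m \<in> S0" "m' \<in> S0" "v < Suc j" for m m' v
        using that Suc(7)[of m m' v] by (cases "v = j") (auto simp: S0_def)
    qed
    ultimately show False by simp
  qed
qed

definition prime_chain :: "('a, 'b) ring_scheme \<Rightarrow> nat \<Rightarrow> (nat \<Rightarrow> 'a set) \<Rightarrow> bool" where
  "prime_chain R k P \<longleftrightarrow> (\<forall>i\<le>k. primeideal (P i) R) \<and> (\<forall>i<k. P i \<subset> P (Suc i))"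

lemma krull_dim_prime_chain: "krull_dim R = Sup {ereal (real k) | k. \<exists>P. prime_chain R k P}"
  by (simp add: krull_dim_def prime_chain_def)

text \<open>A longer chain would yield more than \<open>card I\<close> algebraically independent
  elements in a polynomial ring with \<open>card I\<close> variables.\<close>

lemma prime_chain_length_le:
  assumes "finite I" "prime_chain (polynomial_ring I :: ('v, real) mpoly ring) k Q"
  shows "k \<le> card I"
proof (rule ccontr)
  assume "\<not> k \<le> card I"
  then have k: "card I < card {..<k}" by simp
  have prime: "\<And>i. i \<le> k \<Longrightarrow> primeideal (Q i) (polynomial_ring I)"
    and chain: "\<And>i. i < k \<Longrightarrow> Q i \<subset> Q (Suc i)"
    using assms(2) by (auto simp: prime_chain_def)
  have "\<forall>i\<in>{..<k}. \<exists>f. f \<in> Q (Suc i) - Q i" using chain by blast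
  then obtain f where f: "\<forall>i\<in>{..<k}. f i \<in> Q (Suc i) - Q i" unfolding bchoice_iff by blast
  have fI: "f i \<in> mpolys_in I" if "i \<in> {..<k}" for i
    using f that primeideal_polynomial_ring_simps(1)[OF prime[of "Suc i"]] by auto
  obtain g where g: "g \<in> mpolys_in {..<k}" "g \<noteq> 0" "mpoly_subst mconst f g = 0"
    using algebraically_dependent[OF _ assms(1) k, of f] fI by auto
  have "(\<Sum>m\<in>keys g. mconst (lookup g m) * (\<Prod>v\<in>{0..<k}. f v ^ lookup m v)) \<notin> Q 0"
  proof (rule no_relation_along_prime_chain[OF prime])
    show "f i \<in> Q (Suc i) - Q i" if "i < k" for i using f that by auto
    show "Q i \<subseteq> Q (Suc i)" if "i < k" for i using chain[OF that] by blast
    show "keys g \<noteq> {}" using g(2) by simp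
    show "lookup g m \<noteq> 0 \<and> keys m \<subseteq> {..<k}" if "m \<in> keys g" for m
      using that g(1) by (auto simp: mpolys_in_def in_keys_iff)
  qed auto
  moreover have "(\<Sum>m\<in>keys g. mconst (lookup g m) * (\<Prod>v\<in>{0..<k}. f v ^ lookup m v)) = mpoly_subst mconst f g"
    unfolding mpoly_subst_monom_val
  proof (intro sum.cong refl arg_cong2[of _ _ _ _ "(*)"] monom_val_superset[symmetric])
    show "keys m \<subseteq> {0..<k}" if "m \<in> keys g" for m
      using g(1) that unfolding mpolys_in_def by (simp add: atLeast0LessThan)
  qed simp
  ultimately show False using g(3) primeideal_polynomial_ring_simps(2)[OF prime[of 0]] by simp
qed

text \<open>Surjectivity of \<open>h\<close> is what keeps the inclusions between the preimages
  strict.\<close>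

lemma prime_chain_vimage:
  assumes "ring_hom_ring R S h" "cring R" "h ` carrier R = carrier S" "prime_chain S k P"
  shows "prime_chain R k (\<lambda>i. {r \<in> carrier R. h r \<in> P i})"
  unfolding prime_chain_def
proof (intro conjI allI impI)
  fix i assume "i \<le> k"
  then show "primeideal {r \<in> carrier R. h r \<in> P i} R"
    using assms by (intro ring_hom_ring.primeideal_vimage) (auto simp: prime_chain_def)
next
  fix i assume i: "i < k"
  then have "P i \<subset> P (Suc i)" and "primeideal (P (Suc i)) S" using assms(4) by (auto simp: prime_chain_def)
  then have "P (Suc i) \<subseteq> carrier S"
    using additive_subgroup.a_subset[OF ideal.axioms(1)[OF primeideal.axioms(1)]] by blast
  moreover obtain y where y: "y \<in> P (Suc i)" "y \<notin> P i" using \<open>P i \<subset> P (Suc i)\<close> by blast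
  ultimately have "y \<in> h ` carrier R" using assms(3) by blast
  then obtain x where "x \<in> carrier R" "y = h x" by blast
  with y show "{r \<in> carrier R. h r \<in> P i} \<subset> {r \<in> carrier R. h r \<in> P (Suc i)}"
    using \<open>P i \<subset> P (Suc i)\<close> by blast
qed

lemma ideal_vanishing_ideal: "ideal (vanishing_ideal I A) (polynomial_ring I)"
proof (rule idealI)
  note s = mpoly_subst_simps[OF semiring_hom_id]
  show "ring (polynomial_ring I)" using cring_polynomial_ring by (rule cring.axioms)
  interpret R: cring "polynomial_ring I" by (rule cring_polynomial_ring)
  show "subgroup (vanishing_ideal I A) (add_monoid (polynomial_ring I))"
  proof (rule R.add.subgroupI)
    show "vanishing_ideal I A \<subseteq> carrier (polynomial_ring I)" by (auto simp: vanishing_ideal_def)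
    have "0 \<in> vanishing_ideal I A" by (simp add: vanishing_ideal_def mpolys_in_zero mpoly_subst_zero)
    then show "vanishing_ideal I A \<noteq> {}" by blast
    fix a assume a: "a \<in> vanishing_ideal I A"
    have "a \<oplus>\<^bsub>polynomial_ring I\<^esub> (- a) = \<zero>\<^bsub>polynomial_ring I\<^esub>" by simp
    then have "\<ominus>\<^bsub>polynomial_ring I\<^esub> a = - a"
      using a by (intro R.minus_equality) (auto simp: vanishing_ideal_def intro: mpolys_in_uminus)
    moreover have "- a = mconst (-1) * a" by (simp add: mconst_def single_uminus)
    ultimately show "\<ominus>\<^bsub>polynomial_ring I\<^esub> a \<in> vanishing_ideal I A"
      using a by (simp add: vanishing_ideal_def s mpolys_in_mult mpolys_in_mconst)
    fix b assume "b \<in> vanishing_ideal I A"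
    then show "a \<oplus>\<^bsub>polynomial_ring I\<^esub> b \<in> vanishing_ideal I A"
      using a by (simp add: vanishing_ideal_def s mpolys_in_add)
  qed
qed (auto simp: vanishing_ideal_def mpoly_subst_mult[OF semiring_hom_id] mpolys_in_mult)

lemma vanishing_ideal_affine_space:
  assumes "finite I"
  shows "vanishing_ideal I (affine_space I) = {0}"
proof -
  have "f = 0" if f: "f \<in> mpolys_in I" "\<forall>x\<in>affine_space I. mpoly_subst (\<lambda>c. c) x f = (0::real)" for f
  proof (rule mpoly_eq_0[OF assms f(1)])
    fix x :: "'a \<Rightarrow> real"
    have "mpoly_subst (\<lambda>c. c) x f = mpoly_subst (\<lambda>c. c) (restrict x I) f"
      by (rule mpoly_subst_cong[OF f(1)]) simp
    then show "mpoly_subst (\<lambda>c. c) x f = 0" using f(2) by simp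
  qed
  then show ?thesis by (auto simp: vanishing_ideal_def mpolys_in_zero mpoly_subst_zero)
qed

text \<open>A chain of primes over the vanishing ideal of \<open>A\<close> can be prolonged
  downwards by the zero ideal, since all its members contain the nonzero \<open>F\<close>. So the
  dimension of \<open>A\<close> is at least one less than that of the affine space, which is
  finite.\<close>

lemma semialg_dim_less:
  fixes I :: "'i::linorder set"
  assumes "finite I" "F \<in> mpolys_in I" "F \<noteq> 0" "\<And>x. x \<in> A \<Longrightarrow> mpoly_subst (\<lambda>c. c) x F = (0::real)"
  shows "semialg_dim I A < semialg_dim I (affine_space I)"
proof -
  let ?R = "polynomial_ring I :: ('i, real) mpoly ring"
  let ?J = "vanishing_ideal I A"
  interpret R: domain ?R by (rule domain_polynomial_ring)
  have proj: "prime_chain ?R k (\<lambda>i. {r \<in> carrier ?R. J +>\<^bsub>?R\<^esub> r \<in> P i})"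
    if "ideal J ?R" "prime_chain (?R Quot J) k P" for J k P
  proof (rule prime_chain_vimage[OF _ cring_polynomial_ring _ that(2)])
    show "ring_hom_ring ?R (?R Quot J) ((+>\<^bsub>?R\<^esub>) J)" by (rule ideal.rcos_ring_hom_ring[OF that(1)])
    show "(+>\<^bsub>?R\<^esub>) J ` carrier ?R = carrier (?R Quot J)" by (auto simp: FactRing_def A_RCOSETS_def')
  qed
  \<comment> \<open>The dimension of affine space is defined through the quotient by its vanishing
    ideal, here the zero ideal, so chains of the polynomial ring have to be carried over by the
    isomorphism.\<close>
  have lift: "\<exists>P. prime_chain (?R Quot {0}) k P" if "prime_chain ?R k Q" for k Q
  proof -
    have "?R Quot {\<zero>\<^bsub>?R\<^esub>} \<simeq> ?R" by (rule R.FactRing_zeroideal(1))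
    then obtain h where h: "h \<in> ring_iso (?R Quot {0}) ?R" by (auto simp: is_ring_iso_def)
    have "ideal {0} ?R" using R.zeroideal by simp
    then have cr: "cring (?R Quot {0})" by (rule ideal.quotient_is_cring[OF _ cring_polynomial_ring])
    have "ring_hom_ring (?R Quot {0}) ?R h"
      using h cr R.ring_axioms by (intro ring_hom_ringI2) (auto simp: ring_iso_def cring.axioms)
    from prime_chain_vimage[OF this cr _ that] show ?thesis using h by (auto simp: ring_iso_def bij_betw_def)
  qed
  define S0 where "S0 = semialg_dim I (affine_space I)"
  have S0: "S0 = Sup {ereal (real k) | k. \<exists>P. prime_chain (?R Quot {0}) k P}"
    unfolding S0_def semialg_dim_def krull_dim_prime_chain vanishing_ideal_affine_space[OF assms(1)] ..
  have "S0 \<le> ereal (real (card I))"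
    unfolding S0
  proof (rule Sup_least)
    fix x assume "x \<in> {ereal (real k) | k. \<exists>P. prime_chain (?R Quot {0}) k P}"
    then obtain k P where "x = ereal (real k)" "prime_chain (?R Quot {0}) k P" by blast
    moreover have "ideal {0} ?R" using R.zeroideal by simp
    ultimately show "x \<le> ereal (real (card I))"
      using prime_chain_length_le[OF assms(1) proj] by auto
  qed
  have up: "ereal (real k) \<le> S0" if "prime_chain ?R k Q" for k Q
    unfolding S0 using lift[OF that] by (intro Sup_upper) auto
  have zero: "primeideal {0} ?R" using R.zeroprimeideal by simp
  have "prime_chain ?R 0 (\<lambda>_. {0})" using zero by (simp add: prime_chain_def)
  from up[OF this] have "0 \<le> S0" by (simp add: zero_ereal_def)
  have ext: "ereal (real (Suc k)) \<le> S0" if P: "prime_chain (?R Quot ?J) k P" for k P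
  proof -
    define Q where "Q i = {r \<in> carrier ?R. ?J +>\<^bsub>?R\<^esub> r \<in> P i}" for i
    have Q: "prime_chain ?R k Q" unfolding Q_def[abs_def] by (rule proj[OF ideal_vanishing_ideal P])
    interpret J: ideal ?J ?R by (rule ideal_vanishing_ideal)
    have FJ: "F \<in> ?J" using assms by (simp add: vanishing_ideal_def)
    have "primeideal (P 0) (?R Quot ?J)" using P by (simp add: prime_chain_def)
    then have "\<zero>\<^bsub>?R Quot ?J\<^esub> \<in> P 0"
      using additive_subgroup.zero_closed[OF ideal.axioms(1)[OF primeideal.axioms(1)]] by blast
    moreover have "?J +>\<^bsub>?R\<^esub> F = ?J" using J.a_rcos_const[OF FJ] .
    ultimately have "F \<in> Q 0" using assms(2) by (simp add: Q_def FactRing_def)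
    moreover have "0 \<in> Q 0"
      using Q primeideal_polynomial_ring_simps(2)[of "Q 0" I] by (simp add: prime_chain_def)
    ultimately have "{0} \<subset> Q 0" using assms(3) by auto
    then have "prime_chain ?R (Suc k) (case_nat {0} Q)"
      using Q zero by (auto simp: prime_chain_def split: nat.splits)
    from up[OF this] show ?thesis .
  qed
  \<comment> \<open>Finiteness matters: for an infinite value in the extended reals, a difference of
    one would give no strict inequality.\<close>
  have "S0 \<noteq> \<infinity>" "S0 \<noteq> -\<infinity>" using \<open>S0 \<le> ereal (real (card I))\<close> \<open>0 \<le> S0\<close> by auto
  then obtain s where s: "S0 = ereal s" by (cases S0) auto
  have "semialg_dim I A \<le> ereal (s - 1)"
    unfolding semialg_dim_def krull_dim_prime_chain
  proof (rule Sup_least)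
    fix x assume "x \<in> {ereal (real k) | k. \<exists>P. prime_chain (?R Quot ?J) k P}"
    then obtain k P where "x = ereal (real k)" "prime_chain (?R Quot ?J) k P" by blast
    then show "x \<le> ereal (s - 1)" using ext[of k P] s by simp
  qed
  also have "ereal (s - 1) < S0" using s by simp
  finally show ?thesis by (simp add: S0_def)
qed

section \<open>The operators preserve hyperbolicity\<close>

lemma order_eq_1_iff:
  fixes f :: "complex poly"
  assumes "f \<noteq> 0" "poly f x = 0"
  shows "Polynomial.order x f = 1 \<longleftrightarrow> poly (pderiv f) x \<noteq> 0"
proof -
  have "pderiv f \<noteq> 0"
  proof
    assume "pderiv f = 0"
    then obtain c where "f = [:c:]" by (auto simp: pderiv_eq_0_iff elim: degree_eq_zeroE)
    with assms show False by auto
  qed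
  then show ?thesis using order_pderiv[OF assms] by (auto simp: order_root)
qed

lemma real_rooted_factorization:
  fixes f :: "complex poly"
  assumes "f \<noteq> 0" "\<And>z. poly f z = 0 \<Longrightarrow> z \<in> \<real>"
  shows "\<exists>c xs. c \<noteq> 0 \<and> f = smult c (\<Prod>x\<leftarrow>xs. [:- complex_of_real x, 1:])"
  using assms
proof (induction "degree f" arbitrary: f)
  case 0
  then obtain c where "f = [:c:]" by (auto elim: degree_eq_zeroE)
  then show ?case using 0 by (intro exI[of _ c] exI[of _ "[]"]) auto
next
  case (Suc n)
  then have "\<not> constant (poly f)" by (simp add: constant_degree)
  then obtain z where z: "poly f z = 0" using fundamental_theorem_of_algebra by blast
  then obtain x where x: "z = complex_of_real x" using Suc.prems(2) by (auto elim: Reals_cases)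
  obtain g where g: "f = [:-z, 1:] * g" using z by (auto simp: poly_eq_0_iff_dvd)
  have g0: "g \<noteq> 0" using g Suc.prems by auto
  have "degree f = Suc (degree g)" unfolding g using g0 by (subst degree_mult_eq) auto
  then have "n = degree g" using Suc.hyps(2) by simp
  moreover have "\<And>z. poly g z = 0 \<Longrightarrow> z \<in> \<real>" using Suc.prems(2) by (simp add: g)
  ultimately obtain c xs where "c \<noteq> 0" "g = smult c (\<Prod>x\<leftarrow>xs. [:- complex_of_real x, 1:])"
    using Suc.hyps(1)[of g] g0 by blast
  then show ?case unfolding g x by (intro exI[of _ c] exI[of _ "x # xs"]) (simp add: mult_smult_right)
qed

text \<open>\<open>S1\<close> is the logarithmic derivative \<open>F' / F\<close>, and its own
  derivative is \<open>- S2\<close>, whence \<open>F'' / F = S1\<^sup>2 - S2\<close>.\<close>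

lemma log_derivatives:
  fixes xs :: "real list" and z :: complex
  defines "F \<equiv> \<Prod>x\<leftarrow>xs. [:- complex_of_real x, 1:]"
    and "S1 \<equiv> \<Sum>x\<leftarrow>xs. 1 / (z - complex_of_real x)" and "S2 \<equiv> \<Sum>x\<leftarrow>xs. 1 / (z - complex_of_real x) ^ 2"
  assumes "poly F z \<noteq> 0"
  shows "poly (pderiv F) z = poly F z * S1" "poly (pderiv (pderiv F)) z = poly F z * (S1 ^ 2 - S2)"
proof -
  have "poly (pderiv F) z = poly F z * S1 \<and> poly (pderiv (pderiv F)) z = poly F z * (S1 ^ 2 - S2)"
    using assms(4) unfolding F_def S1_def S2_def
  proof (induction xs)
    case Nil
    then show ?case by (simp add: pderiv_1)
  next
    case (Cons a xs)
    define G where "G = (\<Prod>x\<leftarrow>xs. [:- complex_of_real x, 1:])"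
    define s1 where "s1 = (\<Sum>x\<leftarrow>xs. 1 / (z - complex_of_real x))"
    define s2 where "s2 = (\<Sum>x\<leftarrow>xs. 1 / (z - complex_of_real x) ^ 2)"
    have nz: "z - complex_of_real a \<noteq> 0" "poly G z \<noteq> 0" using Cons.prems by (auto simp: G_def)
    have IH: "poly (pderiv G) z = poly G z * s1" "poly (pderiv (pderiv G)) z = poly G z * (s1 ^ 2 - s2)"
      using Cons.IH nz(2) by (auto simp: G_def s1_def s2_def)
    define w where "w = z - complex_of_real a"
    have w: "w \<noteq> 0" using nz(1) by (simp add: w_def)
    define X where "X = [:- complex_of_real a, 1:]"
    have X: "pderiv X = 1" "poly X z = w" by (simp_all add: X_def w_def pderiv_pCons)
    have "pderiv (X * G) = X * pderiv G + G" by (simp add: pderiv_mult X)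
    moreover have "pderiv (X * pderiv G + G) = X * pderiv (pderiv G) + 2 * pderiv G"
      by (simp add: pderiv_mult pderiv_add X)
    ultimately have "poly (pderiv (X * G)) z = poly (X * G) z * (1 / w + s1)"
      "poly (pderiv (pderiv (X * G))) z = poly (X * G) z * ((1 / w + s1) ^ 2 - (1 / w ^ 2 + s2))"
      using w by (simp_all add: IH X field_simps power2_eq_square)
    then show ?case by (simp add: X_def G_def s1_def s2_def w_def)
  qed
  then show "poly (pderiv F) z = poly F z * S1" "poly (pderiv (pderiv F)) z = poly F z * (S1 ^ 2 - S2)" by auto
qed

lemma sum_list_pos_real:
  fixes f :: "'a \<Rightarrow> real"
  shows "xs \<noteq> [] \<Longrightarrow> (\<And>x. x \<in> set xs \<Longrightarrow> f x > 0) \<Longrightarrow> sum_list (map f xs) > 0"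
proof (induction xs)
  case (Cons a xs)
  then show ?case by (cases "xs = []") (auto intro: add_pos_pos)
qed simp

text \<open>At such \<open>z\<close> the equation reads \<open>1 + c * S1 = 0\<close>. Off the real
  line all terms of \<open>S1\<close> have imaginary parts of the same sign, so \<open>S1\<close>
  cannot be the real number \<open>- 1 / c\<close>. At a real \<open>z\<close> the derivative of
  \<open>g\<close> reduces to \<open>- c * S2\<close> times the value of \<open>f\<close>, and
  \<open>S2\<close> is a sum of positive terms.\<close>

lemma nuij_new_root:
  fixes f :: "complex poly" and c :: real
  assumes f: "f \<noteq> 0" "\<And>z. poly f z = 0 \<Longrightarrow> z \<in> \<real>"
    and g: "g = f + smult (of_real c) (pderiv f)" "poly g z = 0" "poly f z \<noteq> 0"
  shows "z \<in> \<real>" "poly (pderiv g) z \<noteq> 0"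
proof -
  obtain k xs where k: "k \<noteq> 0" "f = smult k (\<Prod>x\<leftarrow>xs. [:- complex_of_real x, 1:])"
    using real_rooted_factorization[OF f] by blast
  define F where "F = (\<Prod>x\<leftarrow>xs. [:- complex_of_real x, 1:])"
  define S1 where "S1 = (\<Sum>x\<leftarrow>xs. 1 / (z - complex_of_real x))"
  define S2 where "S2 = (\<Sum>x\<leftarrow>xs. 1 / (z - complex_of_real x) ^ 2)"
  have F0: "poly F z \<noteq> 0" using g(3) k by (simp add: F_def)
  note ld = log_derivatives[of xs z, folded F_def S1_def S2_def, OF F0]
  have fF: "f = smult k F" using k(2) by (simp add: F_def)
  have "poly g z = k * (poly F z * (1 + of_real c * S1))"
    unfolding g(1) fF by (simp add: pderiv_smult ld algebra_simps)
  then have S1: "1 + of_real c * S1 = 0" using g(2) F0 k(1) by simp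
  then have c0: "c \<noteq> 0" and S10: "S1 \<noteq> 0" by auto
  then have xs: "xs \<noteq> []" by (auto simp: S1_def)
  have nz: "z \<noteq> complex_of_real x" if "x \<in> set xs" for x
  proof
    assume "z = complex_of_real x"
    then have "0 \<in> set (map (\<lambda>x. poly [:- complex_of_real x, 1:] z) xs)" using that by force
    then have "poly F z = 0" unfolding F_def
      using that \<open>z = complex_of_real x\<close> by (induction xs) auto
    with F0 show False by simp
  qed
  show real: "z \<in> \<real>"
  proof (rule ccontr)
    assume "z \<notin> \<real>"
    then have im: "Im z \<noteq> 0" by (simp add: complex_is_Real_iff)
    have "Im (sum_list (map f ys)) = (\<Sum>x\<leftarrow>ys. Im (f x))" for f :: "real \<Rightarrow> complex" and ys
      by (induction ys) auto
    then have "Im S1 = (\<Sum>x\<leftarrow>xs. Im (1 / (z - complex_of_real x)))" by (simp add: S1_def)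
    also have "\<dots> = (\<Sum>x\<leftarrow>xs. - Im z * (1 / (cmod (z - complex_of_real x))\<^sup>2))"
      by (simp add: Im_divide cmod_power2)
    also have "\<dots> = - Im z * (\<Sum>x\<leftarrow>xs. 1 / (cmod (z - complex_of_real x))\<^sup>2)"
      by (rule sum_list_const_mult)
    also have "(\<Sum>x\<leftarrow>xs. 1 / (cmod (z - complex_of_real x))\<^sup>2) > 0"
      by (rule sum_list_pos_real[OF xs]) (use nz in auto)
    ultimately have "Im S1 \<noteq> 0" using im by auto
    moreover have "S1 = - (1 / of_real c)" using S1 c0 by (simp add: field_simps) (metis add_eq_0_iff)
    then have "Im S1 = 0" by simp
    ultimately show False by simp
  qed
  then obtain t where t: "z = complex_of_real t" by (auto elim: Reals_cases)
  have "S2 = complex_of_real (\<Sum>x\<leftarrow>xs. 1 / (t - x)\<^sup>2)"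
    unfolding S2_def t by (induction xs) auto
  moreover have "(\<Sum>x\<leftarrow>xs. 1 / (t - x)\<^sup>2) > 0"
    by (rule sum_list_pos_real[OF xs]) (use nz t in auto)
  ultimately have S2: "S2 \<noteq> 0" by simp
  have "poly (pderiv g) z = k * (poly F z * (S1 * (1 + of_real c * S1) - of_real c * S2))"
    unfolding g(1) fF by (simp add: pderiv_smult pderiv_add ld algebra_simps power2_eq_square)
  also have "\<dots> \<noteq> 0" unfolding S1 using k(1) F0 c0 S2 by simp
  finally show "poly (pderiv g) z \<noteq> 0" .
qed

text \<open>If \<open>f = X ^ (m + 1) * q\<close> with \<open>q\<close> nonzero at \<open>z\<close>,
  then \<open>g\<close> is \<open>X ^ m\<close> times a polynomial whose value at \<open>z\<close>
  is \<open>c * (m + 1)\<close> times that of \<open>q\<close>.\<close>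

lemma nuij_old_root:
  fixes f :: "complex poly" and c :: real
  assumes "f \<noteq> 0" "c \<noteq> 0" and g: "g = f + smult (of_real c) (pderiv f)" and "poly f z = 0"
  shows "Polynomial.order z g = Polynomial.order z f - 1"
proof -
  obtain q where q: "f = [:-z, 1:] ^ Polynomial.order z f * q" "\<not> [:-z, 1:] dvd q"
    using order_decomp[OF assms(1)] by blast
  have qz: "poly q z \<noteq> 0" using q(2) by (simp add: poly_eq_0_iff_dvd)
  obtain m where m: "Polynomial.order z f = Suc m" using assms(1,4) by (metis not0_implies_Suc order_root)
  define X where "X = [:-z, 1:]"
  have X: "pderiv X = 1" "poly X z = 0" "X \<noteq> 0" by (simp_all add: X_def pderiv_pCons)
  define r where "r = X * q + smult (of_real c) (smult (of_nat (Suc m)) q + X * pderiv q)"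
  have "pderiv (X ^ Suc m * q) = X ^ m * (smult (of_nat (Suc m)) q + X * pderiv q)"
    by (simp add: pderiv_mult pderiv_power_Suc X algebra_simps del: of_nat_Suc power_Suc) simp
  moreover have f: "f = X ^ Suc m * q" using q(1) unfolding m X_def .
  ultimately have gr: "g = X ^ m * r"
    unfolding g f r_def by (simp add: algebra_simps smult_add_right del: of_nat_Suc)
  have rz: "poly r z \<noteq> 0" using qz assms(2) X(2) by (simp add: r_def del: of_nat_Suc)
  then have "r \<noteq> 0" by auto
  then have "Polynomial.order z g = Polynomial.order z (X ^ m) + Polynomial.order z r"
    unfolding gr using X(3) by (intro order_mult) simp
  also have "\<dots> = m" using order_power_n_n[of z m] order_0I[OF rz] by (simp add: X_def)
  finally show ?thesis using m by simp
qed

section \<open>Fibres over real directions\<close>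

definition eval_complex :: "(nat, real) mpoly \<Rightarrow> (nat \<Rightarrow> complex) \<Rightarrow> complex" where
  "eval_complex p z = mpoly_subst of_real z p"

lemma eval_complex_simps:
  "eval_complex 0 z = 0" "eval_complex 1 z = 1" "eval_complex (p + q) z = eval_complex p z + eval_complex q z"
  "eval_complex (p * q) z = eval_complex p z * eval_complex q z" "eval_complex (mconst c) z = of_real c"
  "eval_complex (mvar i) z = z i"
  by (simp_all add: eval_complex_def mpoly_subst_zero mpoly_subst_simps[OF semiring_hom_of_real])

definition fibre_point :: "(nat \<Rightarrow> real) \<Rightarrow> complex \<Rightarrow> nat \<Rightarrow> complex" where
  "fibre_point u z = (\<lambda>i. if i = 0 then z else of_real (u i))"

lemma poly_fibre: "poly (fibre p u) z = eval_complex p (fibre_point u z)"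
  unfolding fibre_def eval_complex_def fibre_point_def
  by (subst hom_mpoly_subst[OF semiring_hom_poly])
    (simp, rule arg_cong[where f = "\<lambda>a. mpoly_subst complex_of_real a p"], auto)

lemma pderiv_fibre:
  assumes "p \<in> mpolys_in {0..n}"
  shows "pderiv (fibre p u) = fibre (mpderiv 0 p) u"
proof -
  have "pderiv (fibre p u) = (\<Sum>v\<in>{0..n}. pderiv (if v = 0 then [:0, 1:] else [:of_real (u v):]) * fibre (mpderiv v p) u)"
    unfolding fibre_def by (rule pderiv_mpoly_subst[OF _ assms]) simp
  also have "\<dots> = (\<Sum>v\<in>{0..n}. if v = 0 then fibre (mpderiv 0 p) u else 0)"
    by (intro sum.cong) (auto simp: pderiv_pCons)
  finally show ?thesis by simp
qed

lemma fibre_T_op: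
  assumes "p \<in> mpolys_in {0..n}" "i \<noteq> 0"
  shows "fibre (T_op (mvar i) s p) u = fibre p u + smult (of_real (s * u i)) (pderiv (fibre p u))"
  unfolding pderiv_fibre[OF assms(1)]
  using assms(2) by (simp add: fibre_def T_op_def mpoly_subst_simps[OF semiring_hom_poly_const] mult.commute)

lemma FR_iff: "p \<in> FR n d \<longleftrightarrow> p \<in> mpolys_in {0..n} \<and> homogeneous d p \<and>
    mpoly_subst (\<lambda>c. c) (\<lambda>i. if i = 0 then 1 else 0) p = 1"
  by (auto simp: FR_def homogeneous_def)

lemma lookup_FR:
  assumes "homogeneous d p"
  shows "mpoly_subst (\<lambda>c. c) (\<lambda>i. if i = 0 then 1 else 0) p = (lookup p (single (0::nat) d) :: real)"
proof -
  have mv: "monom_val (\<lambda>i. if i = 0 then 1 else 0) m = (if m = single (0::nat) d then 1 else 0 :: real)"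
    if "mdeg m = d" for m
  proof (cases "keys m \<subseteq> {0}")
    case True
    then have "mdeg m = lookup m 0" by (subst mdeg_superset[of "{0}"]) auto
    then have "m = single 0 d"
      using True that by (intro poly_mapping_eqI) (auto simp: lookup_single when_def in_keys_iff)
    then show ?thesis by (simp add: monom_val_single)
  next
    case False
    then obtain v where v: "v \<in> keys m" "v \<noteq> 0" by auto
    then have "monom_val (\<lambda>i. if i = 0 then 1 else 0) m = (0 :: real)"
      unfolding monom_val_def by (intro prod_zero) (auto intro!: bexI[of _ v] simp: in_keys_iff)
    moreover have "m \<noteq> single 0 d" using v by (auto split: if_splits)
    ultimately show ?thesis by simp
  qed
  have "mpoly_subst (\<lambda>c. c) (\<lambda>i. if i = 0 then 1 else 0) p =
      (\<Sum>m\<in>keys p. if m = single 0 d then lookup p m else 0)"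
    unfolding mpoly_subst_monom_val using assms by (intro sum.cong) (auto simp: homogeneous_def mv)
  then show ?thesis by (simp add: in_keys_iff)
qed

lemma fibre_sum_monom:
  assumes "p \<in> mpolys_in {0..n}"
  shows "fibre p u = (\<Sum>m\<in>keys p. monom (of_real (lookup p m) * (\<Prod>i\<in>{1..n}. of_real (u i) ^ lookup m i)) (lookup m 0))"
  unfolding fibre_def mpoly_subst_monom_val
proof (intro sum.cong refl)
  fix m assume "m \<in> keys p"
  then have m: "keys m \<subseteq> {0..n}" using assms by (simp add: mpolys_in_def)
  let ?a = "\<lambda>i. if i = 0 then [:0, 1:] else [:complex_of_real (u i):]"
  have "monom_val ?a m = (\<Prod>i\<in>{0..n}. ?a i ^ lookup m i)" by (rule monom_val_superset[OF _ m]) simp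
  also have "\<dots> = [:0, 1:] ^ lookup m 0 * (\<Prod>i\<in>{1..n}. ?a i ^ lookup m i)"
  proof -
    have "{0..n} = insert 0 {1..n}" by auto
    then show ?thesis by simp
  qed
  also have "(\<Prod>i\<in>{1..n}. ?a i ^ lookup m i) = (\<Prod>i\<in>{1..n}. [:complex_of_real (u i) ^ lookup m i:])"
    by (intro prod.cong) (auto simp: poly_const_pow)
  also have "\<dots> = [:\<Prod>i\<in>{1..n}. complex_of_real (u i) ^ lookup m i:]"
    by (rule semiring_hom_prod[symmetric]) (simp add: semiring_hom_def one_pCons)
  also have "[:0, 1:] ^ lookup m 0 = (monom 1 (lookup m 0) :: complex poly)" by (simp add: monom_altdef)
  finally show "[:complex_of_real (lookup p m):] * monom_val ?a m =
      monom (complex_of_real (lookup p m) * (\<Prod>i\<in>{1..n}. of_real (u i) ^ lookup m i)) (lookup m 0)"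
    by (simp add: smult_monom mult_ac)
qed

lemma lookup_le_mdeg: "lookup m v \<le> mdeg m"
proof (cases "v \<in> keys m")
  case True then show ?thesis unfolding mdeg_def by (intro member_le_sum) auto
qed (simp add: in_keys_iff)

lemma fibre_FR:
  assumes "p \<in> FR n d"
  shows "coeff (fibre p u) d = 1" "degree (fibre p u) \<le> d" "fibre p u \<noteq> 0"
proof -
  have p: "p \<in> mpolys_in {0..n}" "homogeneous d p" "lookup p (single 0 d) = 1"
    using assms lookup_FR[of d p] by (auto simp: FR_iff)
  \<comment> \<open>Among the monomials of degree \<open>d\<close> only the power of
    \<open>t\<close> has degree \<open>d\<close> in \<open>t\<close>, so every fibre is monic of
    degree \<open>d\<close>, whatever \<open>u\<close> is.\<close>
  have eq: "lookup m 0 = d \<longleftrightarrow> m = single 0 d" if "m \<in> keys p" for m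
  proof
    assume l: "lookup m 0 = d"
    have "m = single 0 d"
    proof (rule poly_mapping_eqI)
      fix v show "lookup m v = lookup (single 0 d) v"
      proof (cases "v = 0")
        case False
        have "lookup m v = 0"
        proof (rule ccontr)
          assume "lookup m v \<noteq> 0"
          have "lookup m 0 + lookup m v = (\<Sum>w\<in>{0, v}. lookup m w)" using False by simp
          also have "\<dots> \<le> (\<Sum>w\<in>{0, v} \<union> keys m. lookup m w)" by (intro sum_mono2) auto
          also have "\<dots> = mdeg m" by (intro mdeg_superset[symmetric]) auto
          finally show False using p(2) that l \<open>lookup m v \<noteq> 0\<close> by (simp add: homogeneous_def)
        qed
        then show ?thesis using False by (simp add: lookup_single)
      qed (simp add: l)
    qed
    then show "m = single 0 d" .
  qed simp
  have "coeff (fibre p u) d = (\<Sum>m\<in>keys p. if m = single 0 d then of_real (lookup p m) * (\<Prod>i\<in>{1..n}. complex_of_real (u i) ^ lookup m i) else 0)"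
    unfolding fibre_sum_monom[OF p(1)] coeff_sum by (intro sum.cong refl) (auto simp: eq)
  also have "\<dots> = 1" using p(3) by (auto simp: in_keys_iff lookup_single)
  finally show "coeff (fibre p u) d = 1" .
  then show "fibre p u \<noteq> 0" by auto
  show "degree (fibre p u) \<le> d" unfolding fibre_sum_monom[OF p(1)]
  proof (intro degree_sum_le order_trans[OF degree_monom_le])
    fix m assume "m \<in> keys p"
    then show "lookup m 0 \<le> d" using p(2) lookup_le_mdeg[of m 0] by (auto simp: homogeneous_def)
  qed simp
qed

lemma FR_T_op:
  assumes "p \<in> FR n d" "d \<ge> 1" "i \<in> {1..n}"
  shows "T_op (mvar i) s p \<in> FR n d"
proof -
  have "homogeneous (1 + (d - 1)) (mvar i * mpderiv 0 p)"
    using assms by (intro homogeneous_mult homogeneous_mvar homogeneous_mpderiv) (simp add: FR_iff)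
  then have "homogeneous d (mconst s * mvar i * mpderiv 0 p)"
    using assms(2) homogeneous_mconst_mult by (simp add: mult.assoc)
  then show ?thesis
    using assms unfolding FR_iff T_op_def
    by (auto intro!: mpolys_in_add mpolys_in_mult mpolys_in_mconst mpolys_in_mvar mpolys_in_mpderiv homogeneous_add
        simp: mpoly_subst_simps[OF semiring_hom_id])
qed

lemma hyperbolic_T_op:
  assumes "p \<in> FR n d" "hyperbolic p" "i \<in> {1..n}"
  shows "hyperbolic (T_op (mvar i) s p)"
  unfolding hyperbolic_def
proof (intro allI impI)
  fix u z assume z: "poly (fibre (T_op (mvar i) s p) u) z = 0"
  have "p \<in> mpolys_in {0..n}" using assms(1) by (simp add: FR_iff)
  then have eq: "fibre (T_op (mvar i) s p) u = fibre p u + smult (of_real (s * u i)) (pderiv (fibre p u))"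
    using assms(3) by (intro fibre_T_op) auto
  have hyp: "\<And>z. poly (fibre p u) z = 0 \<Longrightarrow> z \<in> \<real>" using assms(2) by (auto simp: hyperbolic_def)
  show "z \<in> \<real>"
    using hyp nuij_new_root(1)[OF fibre_FR(3)[OF assms(1)] hyp eq z] by blast
qed

text \<open>An old root loses one in multiplicity if \<open>s * u i \<noteq> 0\<close>, and a new
  root is simple. The maximum with \<open>1\<close> covers both cases and allows iteration.\<close>

lemma order_fibre_T_op:
  assumes "p \<in> FR n d" "d \<ge> 1" "hyperbolic p" "i \<in> {1..n}"
  shows "Polynomial.order z (fibre (T_op (mvar i) s p) u) \<le>
    max 1 (Polynomial.order z (fibre p u) - (if s * u i = 0 then 0 else 1))"
proof -
  have "p \<in> mpolys_in {0..n}" using assms(1) by (simp add: FR_iff)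
  then have eq: "fibre (T_op (mvar i) s p) u = fibre p u + smult (of_real (s * u i)) (pderiv (fibre p u))"
    using assms(4) by (intro fibre_T_op) auto
  have hyp: "\<And>z. poly (fibre p u) z = 0 \<Longrightarrow> z \<in> \<real>" using assms(3) by (auto simp: hyperbolic_def)
  note f0 = fibre_FR(3)[OF assms(1)] and g0 = fibre_FR(3)[OF FR_T_op[OF assms(1,2,4)]]
  consider "s * u i = 0" | "s * u i \<noteq> 0" "poly (fibre p u) z = 0"
    | "poly (fibre (T_op (mvar i) s p) u) z \<noteq> 0"
    | "poly (fibre p u) z \<noteq> 0" "poly (fibre (T_op (mvar i) s p) u) z = 0" by blast
  then show ?thesis
  proof cases
    case 1
    then have "complex_of_real (s * u i) = 0" by simp
    then have "fibre (T_op (mvar i) s p) u = fibre p u" unfolding eq by simp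
    with 1 show ?thesis by simp
  next
    case 2 then show ?thesis using nuij_old_root[OF f0 2(1) eq 2(2)] by simp
  next
    case 3 then show ?thesis by (simp add: order_0I)
  next
    case 4
    have "poly (pderiv (fibre (T_op (mvar i) s p) u)) z \<noteq> 0" by (rule nuij_new_root(2)[OF f0 hyp eq 4(2,1)])
    then have "Polynomial.order z (fibre (T_op (mvar i) s p) u) = 1" using order_eq_1_iff[OF g0 4(2)] by simp
    then show ?thesis by simp
  qed
qed

lemma T_op_power:
  assumes "p \<in> FR n d" "d \<ge> 1" "hyperbolic p" "i \<in> {1..n}"
  shows "(T_op (mvar i) s ^^ k) p \<in> FR n d \<and> hyperbolic ((T_op (mvar i) s ^^ k) p) \<and>
    Polynomial.order z (fibre ((T_op (mvar i) s ^^ k) p) u) \<le>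
      max 1 (Polynomial.order z (fibre p u) - (if s * u i = 0 then 0 else k))"
proof (induction k)
  case 0
  then show ?case using assms by simp
next
  case (Suc k)
  let ?q = "(T_op (mvar i) s ^^ k) p"
  have "T_op (mvar i) s ?q \<in> FR n d" "hyperbolic (T_op (mvar i) s ?q)"
    using Suc assms by (auto intro: FR_T_op hyperbolic_T_op)
  moreover have "Polynomial.order z (fibre (T_op (mvar i) s ?q) u) \<le>
      max 1 (Polynomial.order z (fibre p u) - (if s * u i = 0 then 0 else Suc k))"
    using order_fibre_T_op[of ?q n d i z s u] Suc assms by (auto split: if_splits simp: max_def)
  ultimately show ?case by simp
qed

text \<open>\<open>F_op\<close> over an arbitrary list of indices, to make induction on the list
  possible.\<close>

definition F_list :: "nat \<Rightarrow> real \<Rightarrow> nat list \<Rightarrow> (nat, real) mpoly \<Rightarrow> (nat, real) mpoly" where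
  "F_list d s is = foldr (\<lambda>i g. (T_op (mvar i) s ^^ d) \<circ> g) is id"

lemma F_list_simps [simp]: "F_list d s [] p = p" "F_list d s (i # is) p = (T_op (mvar i) s ^^ d) (F_list d s is p)"
  by (simp_all add: F_list_def)

lemma F_op_F_list: "F_op n d s = F_list d s [1..<Suc n]"
  by (simp add: F_op_def F_list_def)

lemma F_list_hyperbolic:
  assumes "p \<in> FR n d" "d \<ge> 1" "hyperbolic p" "set is \<subseteq> {1..n}"
  shows "F_list d s is p \<in> FR n d \<and> hyperbolic (F_list d s is p) \<and>
    Polynomial.order z (fibre (F_list d s is p) u) \<le>
      max 1 (if \<exists>i\<in>set is. s * u i \<noteq> 0 then 1 else Polynomial.order z (fibre p u))"
  using assms(4)
proof (induction "is")
  case Nil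
  then show ?case using assms by simp
next
  case (Cons i "is")
  let ?q = "F_list d s is p"
  have IH: "?q \<in> FR n d" "hyperbolic ?q" "Polynomial.order z (fibre ?q u) \<le>
      max 1 (if \<exists>i\<in>set is. s * u i \<noteq> 0 then 1 else Polynomial.order z (fibre p u))"
    using Cons by auto
  have i: "i \<in> {1..n}" using Cons.prems by simp
  note T = T_op_power[OF IH(1) assms(2) IH(2) i, where s = s and k = d and z = z and u = u]
  \<comment> \<open>This accounts for the exponent \<open>d\<close> in the operators: no
    multiplicity exceeds the degree, so \<open>d\<close> applications with
    \<open>s * u i \<noteq> 0\<close> leave only simple roots.\<close>
  have "Polynomial.order z (fibre ?q u) \<le> d"
    using order_degree[OF fibre_FR(3)[OF IH(1)]] fibre_FR(2)[OF IH(1)] le_trans by blast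
  then show ?case using T IH(3) by (auto split: if_splits)
qed

lemma F_op_hyperbolic:
  assumes "p \<in> FR n d" "d \<ge> 1" "hyperbolic p"
  shows "F_op n d s p \<in> FR n d" "hyperbolic (F_op n d s p)"
proof -
  have "set [1..<Suc n] \<subseteq> {1..n}" by auto
  from F_list_hyperbolic[OF assms this]
  show "F_op n d s p \<in> FR n d" "hyperbolic (F_op n d s p)" unfolding F_op_F_list by blast+
qed

lemma order_fibre_F_op:
  assumes "p \<in> FR n d" "d \<ge> 1" "hyperbolic p"
  shows "Polynomial.order z (fibre (F_op n d s p) u) \<le>
      max 1 (if \<exists>i\<in>{1..n}. s * u i \<noteq> 0 then 1 else Polynomial.order z (fibre p u))"
proof -
  have "set [1..<Suc n] = {1..n}" by auto
  then show ?thesis using F_list_hyperbolic[OF assms, of "[1..<Suc n]" s z u] unfolding F_op_F_list by simp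
qed

lemma strictly_hyperbolic_iff:
  assumes "p \<in> FR n d"
  shows "strictly_hyperbolic n p \<longleftrightarrow> hyperbolic p \<and>
    (\<forall>u z. (\<exists>i\<in>{1..n}. u i \<noteq> 0) \<longrightarrow> Polynomial.order z (fibre p u) \<le> 1)"
proof -
  have "(poly (fibre p u) z = 0 \<longrightarrow> Polynomial.order z (fibre p u) = 1) \<longleftrightarrow> Polynomial.order z (fibre p u) \<le> 1" for u z
    using fibre_FR(3)[OF assms, of u] by (auto simp: order_root order_0I le_Suc_eq)
  then show ?thesis unfolding strictly_hyperbolic_def by blast
qed

lemma strictly_hyperbolic_F_op:
  assumes "p \<in> FR n d" "d \<ge> 1" "hyperbolic p" "s \<noteq> 0"
  shows "strictly_hyperbolic n (F_op n d s p)"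
  unfolding strictly_hyperbolic_iff[OF F_op_hyperbolic(1)[OF assms(1-3)]]
proof (intro conjI allI impI F_op_hyperbolic(2)[OF assms(1-3)])
  fix u z assume "\<exists>i\<in>{1..n}. u i \<noteq> (0::real)"
  then have "\<exists>i\<in>{1..n}. s * u i \<noteq> 0" using assms(4) by simp
  then show "Polynomial.order z (fibre (F_op n d s p) u) \<le> 1"
    using order_fibre_F_op[OF assms(1-3), of z s u] by simp
qed

lemma strictly_hyperbolic_F_op':
  assumes "p \<in> FR n d" "d \<ge> 1" "strictly_hyperbolic n p"
  shows "strictly_hyperbolic n (F_op n d s p)"
proof -
  have hyp: "hyperbolic p" using assms(3) by (simp add: strictly_hyperbolic_def)
  show ?thesis
    unfolding strictly_hyperbolic_iff[OF F_op_hyperbolic(1)[OF assms(1,2) hyp]]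
  proof (intro conjI allI impI F_op_hyperbolic(2)[OF assms(1,2) hyp])
    fix u z assume "\<exists>i\<in>{1..n}. u i \<noteq> (0::real)"
    then have "Polynomial.order z (fibre p u) \<le> 1" using assms(3) strictly_hyperbolic_iff[OF assms(1)] by blast
    then show "Polynomial.order z (fibre (F_op n d s p) u) \<le> 1"
      using order_fibre_F_op[OF assms(1,2) hyp, of z s u] by (auto split: if_splits)
  qed
qed

section \<open>Rescaling and its commutation with the operators\<close>

lemma G_op_sum_single: "G_op s p = (\<Sum>m\<in>keys p. single m (lookup p m * s ^ (mdeg m - lookup m 0)))"
proof -
  have mv: "monom_val (\<lambda>i. if i = 0 then mvar 0 else mconst s * mvar i) m = single m (s ^ (mdeg m - lookup m 0))" for m :: "nat \<Rightarrow>\<^sub>0 nat"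
  proof -
    let ?K = "insert 0 (keys m)"
    have "monom_val (\<lambda>i. if i = 0 then mvar 0 else mconst s * mvar i) m =
        (\<Prod>i\<in>?K. (if i = 0 then 1 else mconst s ^ lookup m i) * mvar i ^ lookup m i)"
      by (subst monom_val_superset[of ?K]) (auto simp: power_mult_distrib intro!: prod.cong)
    also have "\<dots> = (\<Prod>i\<in>?K. if i = 0 then 1 else mconst s ^ lookup m i) * monom_val mvar m"
      by (simp only: prod.distrib monom_val_superset[of ?K m mvar, OF finite.insertI[OF finite_keys] subset_insertI])
    finally have 1: "monom_val (\<lambda>i. if i = 0 then mvar 0 else mconst s * mvar i) m =
        (\<Prod>i\<in>?K. (if i = 0 then 1 else mconst s ^ lookup m i)) * monom_val mvar m" .
    have "(\<Prod>i\<in>?K. if i = 0 then 1 else mconst s ^ lookup m i :: (nat, real) mpoly) =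
        (\<Prod>i\<in>?K - {0}. mconst s ^ lookup m i)"
      by (subst prod.remove[of ?K 0]) (auto intro!: prod.cong)
    also have "\<dots> = mconst s ^ (\<Sum>i\<in>?K - {0}. lookup m i)" by (rule power_sum[symmetric])
    also have "(\<Sum>i\<in>?K - {0}. lookup m i) = mdeg m - lookup m 0"
    proof -
      have "mdeg m = (\<Sum>i\<in>?K. lookup m i)" by (rule mdeg_superset) auto
      also have "\<dots> = lookup m 0 + (\<Sum>i\<in>?K - {0}. lookup m i)" by (rule sum.remove) auto
      finally show ?thesis by simp
    qed
    also have "mconst s ^ (mdeg m - lookup m 0) = (mconst (s ^ (mdeg m - lookup m 0)) :: (nat, real) mpoly)"
      by (rule semiring_hom_power[OF semiring_hom_mconst, symmetric])
    finally have "(\<Prod>i\<in>?K. if i = 0 then 1 else mconst s ^ lookup m i :: (nat, real) mpoly) =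
        mconst (s ^ (mdeg m - lookup m 0))" .
    with 1 show ?thesis by (simp add: monom_val_mvar mconst_def mult_single)
  qed
  show ?thesis unfolding G_op_def mpoly_subst_monom_val mv by (simp add: mconst_def mult_single)
qed

lemma lookup_G_op: "lookup (G_op s p) m = lookup p m * s ^ (mdeg m - lookup m 0)"
proof -
  have "lookup (G_op s p) m = (\<Sum>k\<in>keys p. if k = m then lookup p k * s ^ (mdeg k - lookup k 0) else 0)"
    unfolding G_op_sum_single lookup_sum lookup_single when_def ..
  also have "\<dots> = lookup p m * s ^ (mdeg m - lookup m 0)" by (simp add: in_keys_iff)
  finally show ?thesis .
qed

lemma mpderiv_G_op: "mpderiv i (G_op s p) = mconst (if i = 0 then 1 else s) * G_op s (mpderiv i p)"
proof (rule poly_mapping_eqI)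
  fix m
  have c: "lookup (mconst c * p) m = c * lookup p m" for c :: real and p :: "(nat, real) mpoly"
  proof -
    have "mconst c * p = (\<Sum>m\<in>keys p. single m (c * lookup p m))"
      by (subst (1) mpoly_sum_single) (simp add: mconst_def sum_distrib_left mult_single)
    then show ?thesis by (simp add: lookup_sum lookup_single when_def in_keys_iff)
  qed
  show "lookup (mpderiv i (G_op s p)) m = lookup (mconst (if i = 0 then 1 else s) * G_op s (mpderiv i p)) m"
  proof (cases "i = 0")
    case True
    then show ?thesis by (simp add: c lookup_mpderiv lookup_G_op mdeg_add lookup_add)
  next
    case False
    then have "mdeg (m + single i 1) - lookup (m + single i 1) 0 = Suc (mdeg m - lookup m 0)"
      using lookup_le_mdeg[of m 0] by (simp add: mdeg_add lookup_add lookup_single Suc_diff_le)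
    then show ?thesis using False by (simp add: c lookup_mpderiv lookup_G_op)
  qed
qed

lemma FR_G_op:
  assumes "p \<in> FR n d" shows "G_op s p \<in> FR n d"
proof -
  have keys: "keys (G_op s p) \<subseteq> keys p" by (auto simp: in_keys_iff lookup_G_op)
  have h: "homogeneous d (G_op s p)" using assms keys by (auto simp: FR_iff homogeneous_def)
  moreover have "G_op s p \<in> mpolys_in {0..n}" using assms keys by (auto simp: FR_iff mpolys_in_def)
  moreover have "lookup (G_op s p) (single 0 d) = 1"
    using assms lookup_FR[of d p] by (simp add: FR_iff lookup_G_op)
  ultimately show ?thesis by (simp add: FR_iff lookup_FR[OF h])
qed

lemma eval_complex_G_op: "eval_complex (G_op s p) z = eval_complex p (\<lambda>i. if i = 0 then z 0 else of_real s * z i)"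
  unfolding eval_complex_def G_op_def
  by (subst mpoly_subst_mpoly_subst[OF semiring_hom_of_real],
      rule arg_cong[where f = "\<lambda>a. mpoly_subst complex_of_real a p"], rule ext)
    (simp add: mpoly_subst_simps[OF semiring_hom_of_real])

lemma fibre_G_op: "fibre (G_op s p) u = fibre p (\<lambda>i. s * u i)"
proof -
  have "poly (fibre (G_op s p) u) = poly (fibre p (\<lambda>i. s * u i))"
  proof
    fix z
    have "(\<lambda>i. if i = 0 then fibre_point u z 0 else complex_of_real s * fibre_point u z i) = fibre_point (\<lambda>i. s * u i) z"
      by (rule ext) (simp add: fibre_point_def)
    then show "poly (fibre (G_op s p) u) z = poly (fibre p (\<lambda>i. s * u i)) z"
      by (simp add: poly_fibre eval_complex_G_op)
  qed
  then show ?thesis by (simp add: poly_eq_poly_eq_iff)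
qed

lemma G_op_T_op:
  assumes "i \<noteq> 0"
  shows "G_op s (T_op (mvar i) c p) = T_op (mvar i) (c * s) (G_op s p)"
proof -
  have hom: "G_op s (p + q) = G_op s p + G_op s q" "G_op s (p * q) = G_op s p * G_op s q"
    "G_op s (mconst c) = mconst c" "G_op s (mvar j) = (if j = 0 then mvar 0 else mconst s * mvar j)" for p q j
    by (simp_all add: G_op_def mpoly_subst_simps[OF semiring_hom_mconst])
  have "G_op s (T_op (mvar i) c p) = G_op s p + mconst c * (mconst s * mvar i) * G_op s (mpderiv 0 p)"
    using assms unfolding T_op_def hom by simp
  moreover have "mpderiv 0 (G_op s p) = G_op s (mpderiv 0 p)"
    by (simp add: mpderiv_G_op semiring_hom_simps(2)[OF semiring_hom_mconst])
  moreover have "mconst (c * s) = mconst c * (mconst s :: (nat, real) mpoly)"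
    by (rule semiring_hom_simps(4)[OF semiring_hom_mconst])
  ultimately show ?thesis by (simp add: T_op_def mult_ac)
qed

text \<open>\<open>G_op s\<close> commutes with the derivative in \<open>t\<close> and multiplies
  each \<open>x\<close> variable by \<open>s\<close>. For \<open>c = (1 - s) / s\<close> the
  identity presents \<open>N_op n d s\<close> as \<open>F_op n d c\<close> followed by
  \<open>G_op s\<close>.\<close>

lemma G_op_F_op: "G_op s (F_op n d c p) = F_op n d (c * s) (G_op s p)"
proof -
  have "G_op s ((T_op (mvar i) c ^^ k) p) = (T_op (mvar i) (c * s) ^^ k) (G_op s p)" if "i \<noteq> 0" for i k p
    using that by (induction k) (auto simp: G_op_T_op)
  note T = this
  have "0 \<notin> set is \<Longrightarrow> G_op s (F_list d c is p) = F_list d (c * s) is (G_op s p)" for "is"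
    by (induction "is") (simp_all add: T)
  moreover have "0 \<notin> set [1..<Suc n]" by auto
  ultimately show ?thesis unfolding F_op_F_list by blast
qed

lemma N_op_strictly_hyperbolic:
  assumes "p \<in> FR n d" "d \<ge> 1" "strictly_hyperbolic n p" "s \<noteq> 0"
  shows "N_op n d s p \<in> FR n d" "strictly_hyperbolic n (N_op n d s p)"
proof -
  have G: "G_op s p \<in> FR n d" by (rule FR_G_op[OF assms(1)])
  have hyp: "hyperbolic p" using assms(3) by (simp add: strictly_hyperbolic_def)
  have "strictly_hyperbolic n (G_op s p)"
    unfolding strictly_hyperbolic_iff[OF G]
  proof (intro conjI allI impI)
    show "hyperbolic (G_op s p)" using hyp by (simp add: hyperbolic_def fibre_G_op)
    fix u z assume "\<exists>i\<in>{1..n}. u i \<noteq> (0::real)"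
    then have "\<exists>i\<in>{1..n}. s * u i \<noteq> 0" using assms(4) by simp
    moreover have "\<forall>u z. (\<exists>i\<in>{1..n}. u i \<noteq> 0) \<longrightarrow> Polynomial.order z (fibre p u) \<le> 1"
      using assms(3) unfolding strictly_hyperbolic_iff[OF assms(1)] ..
    ultimately show "Polynomial.order z (fibre (G_op s p) u) \<le> 1"
      unfolding fibre_G_op by (elim allE[of _ "\<lambda>i. s * u i"] allE[of _ z] mp)
  qed
  note strict = this
  then have "hyperbolic (G_op s p)" by (simp add: strictly_hyperbolic_def)
  then show "N_op n d s p \<in> FR n d" "strictly_hyperbolic n (N_op n d s p)"
    using F_op_hyperbolic(1)[OF G assms(2)] strictly_hyperbolic_F_op'[OF G assms(2) strict]
    unfolding N_op_def by simp_all
qed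

definition singular_point :: "nat \<Rightarrow> (nat, real) mpoly \<Rightarrow> (nat \<Rightarrow> complex) \<Rightarrow> bool" where
  "singular_point n p z \<longleftrightarrow> (\<exists>i\<in>{0..n}. z i \<noteq> 0) \<and> eval_complex p z = 0 \<and>
     (\<forall>i\<in>{0..n}. eval_complex (mpderiv i p) z = 0)"

lemma not_smooth_iff: "\<not> smooth_hypersurface n p \<longleftrightarrow> (\<exists>z. singular_point n p z)"
  unfolding smooth_hypersurface_def singular_point_def eval_complex_def by simp

text \<open>For \<open>s \<noteq> 0\<close> rescaling is an invertible change of coordinates, so it
  carries singular points to singular points.\<close>

lemma singular_point_N_op:
  assumes "s \<noteq> 0" "singular_point n (N_op n d s p) z"
  shows "\<exists>z. singular_point n (F_op n d ((1 - s) / s) p) z"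
proof -
  let ?q = "F_op n d ((1 - s) / s) p"
  let ?w = "\<lambda>i. if i = 0 then z 0 else complex_of_real s * z i"
  have N: "N_op n d s p = G_op s ?q" using assms(1) by (simp add: N_op_def G_op_F_op)
  have "singular_point n ?q ?w"
    unfolding singular_point_def
  proof (intro conjI ballI)
    obtain i where "i \<in> {0..n}" "z i \<noteq> 0" using assms(2) by (auto simp: singular_point_def)
    then show "\<exists>i\<in>{0..n}. ?w i \<noteq> 0" using assms(1) by (intro bexI[of _ i]) auto
    show "eval_complex ?q ?w = 0"
      using assms(2) by (simp add: singular_point_def N eval_complex_G_op)
    fix i assume "i \<in> {0..n}"
    then have "eval_complex (mpderiv i (G_op s ?q)) z = 0" using assms(2) unfolding singular_point_def N by blast
    then have "complex_of_real (if i = 0 then 1 else s) * eval_complex (mpderiv i ?q) ?w = 0"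
      unfolding mpderiv_G_op eval_complex_simps eval_complex_G_op .
    then show "eval_complex (mpderiv i ?q) ?w = 0"
      using assms(1) by (auto split: if_splits)
  qed
  then show ?thesis by blast
qed

section \<open>The bad set is semialgebraic\<close>

lemma finite_coord_monomials: "finite (coord_monomials n d)"
proof (rule finite_subset)
  show "finite {m::nat \<Rightarrow>\<^sub>0 nat. keys m \<subseteq> {0..n} \<and> (\<forall>v. lookup m v \<le> d)}"
    by (rule card_monomials_le) simp
  show "coord_monomials n d \<subseteq> {m. keys m \<subseteq> {0..n} \<and> (\<forall>v. lookup m v \<le> d)}"
    using lookup_le_mdeg by (auto simp: coord_monomials_def)
qed

text \<open>Inverse of the chart \<open>coords\<close>; it exposes the coefficients as free
  variables for the quantifier elimination.\<close>

definition poly_of :: "nat \<Rightarrow> nat \<Rightarrow> ((nat \<Rightarrow>\<^sub>0 nat) \<Rightarrow> real) \<Rightarrow> (nat, real) mpoly" where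
  "poly_of n d c = single (single 0 d) 1 + (\<Sum>m\<in>coord_monomials n d. single m (c m))"

lemma lookup_poly_of:
  "lookup (poly_of n d c) m = (if m = single 0 d then 1 else if m \<in> coord_monomials n d then c m else 0)"
proof -
  have "lookup (\<Sum>m\<in>coord_monomials n d. single m (c m)) m = (if m \<in> coord_monomials n d then c m else 0)"
    using finite_coord_monomials[of n d] by (simp add: lookup_sum lookup_single when_def)
  moreover have "single 0 d \<notin> coord_monomials n d" by (simp add: coord_monomials_def)
  ultimately show ?thesis by (auto simp: poly_of_def lookup_add lookup_single when_def)
qed

lemma keys_poly_of: "keys (poly_of n d c) \<subseteq> insert (single 0 d) (coord_monomials n d)"
  by (auto simp: in_keys_iff lookup_poly_of split: if_splits)

lemma poly_of_FR: "poly_of n d c \<in> FR n d"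
proof -
  have k: "keys m \<subseteq> {0..n} \<and> mdeg m = d" if "m \<in> keys (poly_of n d c)" for m
    using subsetD[OF keys_poly_of that] by (auto simp: coord_monomials_def split: if_splits)
  then have h: "homogeneous d (poly_of n d c)" by (simp add: homogeneous_def)
  show ?thesis using h k unfolding FR_iff lookup_FR[OF h] by (auto simp: lookup_poly_of mpolys_in_def)
qed

lemma keys_FR: "p \<in> FR n d \<Longrightarrow> keys p \<subseteq> insert (single 0 d) (coord_monomials n d)"
  by (auto simp: FR_def coord_monomials_def mpolys_in_def)

lemma poly_of_coords:
  assumes "p \<in> FR n d" shows "poly_of n d (coords n d p) = p"
proof (rule poly_mapping_eqI)
  fix m
  have 1: "lookup p (single 0 d) = 1" using assms lookup_FR[of d p] by (simp add: FR_iff)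
  have 2: "lookup p m = 0" if "m \<noteq> single 0 d" "m \<notin> coord_monomials n d"
  proof -
    have "m \<notin> keys p" using keys_FR[OF assms] that by blast
    then show ?thesis by (simp add: in_keys_iff)
  qed
  show "lookup (poly_of n d (coords n d p)) m = lookup p m"
    using 1 2 by (auto simp: lookup_poly_of coords_def)
qed

lemma coords_poly_of: "c \<in> affine_space (coord_monomials n d) \<Longrightarrow> coords n d (poly_of n d c) = c"
  by (rule ext) (auto simp: coords_def lookup_poly_of restrict_def PiE_def extensional_def coord_monomials_def)

lemma coords_affine_space: "coords n d p \<in> affine_space (coord_monomials n d)"
  by (simp add: coords_def)

lemma coords_image:
  assumes "A \<subseteq> FR n d"
  shows "coords n d ` A = {c \<in> affine_space (coord_monomials n d). poly_of n d c \<in> A}"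
proof
  show "coords n d ` A \<subseteq> {c \<in> affine_space (coord_monomials n d). poly_of n d c \<in> A}"
  proof
    fix c assume "c \<in> coords n d ` A"
    then obtain p where "p \<in> A" "c = coords n d p" by blast
    then show "c \<in> {c \<in> affine_space (coord_monomials n d). poly_of n d c \<in> A}"
      using assms coords_affine_space poly_of_coords by auto
  qed
  show "{c \<in> affine_space (coord_monomials n d). poly_of n d c \<in> A} \<subseteq> coords n d ` A"
  proof
    fix c assume "c \<in> {c \<in> affine_space (coord_monomials n d). poly_of n d c \<in> A}"
    then show "c \<in> coords n d ` A" using coords_poly_of[of c n d] by (intro image_eqI[of _ _ "poly_of n d c"]) auto
  qed
qed

text \<open>The multivariate counterpart of \<open>param_poly\<close>. One finite set contains all
  supports, so that products, substitutions and values are finite sums of the same shape for every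
  parameter.\<close>

definition poly_family :: "'v set \<Rightarrow> (('v \<Rightarrow> real) \<Rightarrow> (nat, real) mpoly) \<Rightarrow> bool" where
  "poly_family V P \<longleftrightarrow> (\<exists>M. finite M \<and> (\<forall>x. keys (P x) \<subseteq> M)) \<and> (\<forall>m. polyfun V (\<lambda>x. lookup (P x) m))"

lemma poly_family_single: "polyfun V f \<Longrightarrow> poly_family V (\<lambda>x. single m (f x))"
  unfolding poly_family_def
  by (intro conjI exI[of _ "{m}"] allI) (auto simp: lookup_single when_def intro: polyfun_if polyfun.const)

lemma poly_family_const: "poly_family V (\<lambda>x. p)"
  unfolding poly_family_def by (intro conjI exI[of _ "keys p"] allI polyfun.const) auto

lemma poly_family_mconst: "polyfun V f \<Longrightarrow> poly_family V (\<lambda>x. mconst (f x))"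
  unfolding mconst_def by (rule poly_family_single)

lemma poly_family_add:
  assumes "poly_family V P" "poly_family V Q" shows "poly_family V (\<lambda>x. P x + Q x)"
proof -
  obtain M N where M: "finite M" "\<forall>x. keys (P x) \<subseteq> M" and N: "finite N" "\<forall>x. keys (Q x) \<subseteq> N"
    using assms by (auto simp: poly_family_def)
  have "keys (P x + Q x) \<subseteq> M \<union> N" for x
    by (rule order_trans[OF Poly_Mapping.keys_add Un_mono]) (use M N in auto)
  moreover have "finite (M \<union> N)" using M N by simp
  moreover have "polyfun V (\<lambda>x. lookup (P x + Q x) m)" for m
    unfolding lookup_add using assms by (intro polyfun.add) (auto simp: poly_family_def)
  ultimately show ?thesis unfolding poly_family_def by auto
qed

lemma poly_family_sum:
  "(\<And>i. i \<in> I \<Longrightarrow> poly_family V (P i)) \<Longrightarrow> poly_family V (\<lambda>x. \<Sum>i\<in>I. P i x)"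
  by (induction I rule: infinite_finite_induct) (auto intro: poly_family_add poly_family_const)

lemma poly_family_mult:
  assumes "poly_family V P" "poly_family V Q" shows "poly_family V (\<lambda>x. P x * Q x)"
proof -
  obtain M N where M: "finite M" "\<And>x. keys (P x) \<subseteq> M" and N: "finite N" "\<And>x. keys (Q x) \<subseteq> N"
    using assms by (auto simp: poly_family_def)
  have "P x * Q x = (\<Sum>m\<in>M. \<Sum>k\<in>N. single (m + k) (lookup (P x) m * lookup (Q x) k))" for x
  proof -
    have "(\<Sum>m\<in>M. \<Sum>k\<in>N. single (m + k) (lookup (P x) m * lookup (Q x) k)) =
        (\<Sum>m\<in>M. \<Sum>k\<in>keys (Q x). single (m + k) (lookup (P x) m * lookup (Q x) k))"
      using N by (intro sum.cong refl sum.mono_neutral_right) (auto simp: in_keys_iff)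
    also have "\<dots> = (\<Sum>m\<in>keys (P x). \<Sum>k\<in>keys (Q x). single (m + k) (lookup (P x) m * lookup (Q x) k))"
      using M by (intro sum.mono_neutral_right) (auto simp: in_keys_iff)
    finally show ?thesis unfolding mpoly_mult_sum_single[of "P x" "Q x"] by simp
  qed
  moreover have "poly_family V (\<lambda>x. \<Sum>m\<in>M. \<Sum>k\<in>N. single (m + k) (lookup (P x) m * lookup (Q x) k))"
    using assms by (intro poly_family_sum poly_family_single polyfun.mult) (auto simp: poly_family_def)
  ultimately show ?thesis by simp
qed

lemma poly_family_prod:
  "(\<And>i. i \<in> I \<Longrightarrow> poly_family V (P i)) \<Longrightarrow> poly_family V (\<lambda>x. \<Prod>i\<in>I. P i x)"
  by (induction I rule: infinite_finite_induct) (auto intro: poly_family_mult poly_family_const)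

lemma poly_family_power: "poly_family V P \<Longrightarrow> poly_family V (\<lambda>x. P x ^ k)"
  by (induction k) (auto intro: poly_family_mult poly_family_const)

lemma poly_family_mpderiv:
  assumes "poly_family V P" shows "poly_family V (\<lambda>x. mpderiv i (P x))"
proof -
  obtain M where M: "finite M" "\<forall>x. keys (P x) \<subseteq> M" using assms by (auto simp: poly_family_def)
  have "keys (mpderiv i (P x)) \<subseteq> (\<lambda>m. m - single i 1) ` M" for x
    using M(2) by (intro order_trans[OF keys_mpderiv_subset image_mono]) simp
  moreover have "finite ((\<lambda>m. m - single i 1) ` M)" using M(1) by simp
  moreover have "polyfun V (\<lambda>x. lookup (mpderiv i (P x)) m)" for m
    unfolding lookup_mpderiv using assms by (intro polyfun.mult polyfun.const) (auto simp: poly_family_def)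
  ultimately show ?thesis unfolding poly_family_def by auto
qed

lemma poly_family_subst:
  assumes P: "poly_family V P" and b: "\<And>i. poly_family V (\<lambda>x. b x i)"
  shows "poly_family V (\<lambda>x. mpoly_subst mconst (b x) (P x))"
proof -
  obtain M where M: "finite M" "\<And>x. keys (P x) \<subseteq> M" using P by (auto simp: poly_family_def)
  have eq: "mpoly_subst mconst (b x) (P x) = (\<Sum>m\<in>M. mconst (lookup (P x) m) * (\<Prod>v\<in>keys m. b x v ^ lookup m v))" for x
    unfolding mpoly_subst_superset[OF semiring_hom_mconst M] monom_val_def ..
  show ?thesis unfolding eq using P
    by (intro poly_family_sum poly_family_mult poly_family_mconst poly_family_prod poly_family_power b)
      (simp add: poly_family_def)
qed

lemma poly_family_T_op:
  "polyfun V f \<Longrightarrow> poly_family V P \<Longrightarrow> poly_family V (\<lambda>x. T_op l (f x) (P x))"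
  unfolding T_op_def
  by (intro poly_family_add poly_family_mult poly_family_mconst poly_family_const poly_family_mpderiv)

lemma poly_family_F_op:
  assumes "polyfun V f" "poly_family V P" shows "poly_family V (\<lambda>x. F_op n d (f x) (P x))"
proof -
  have T: "poly_family V (\<lambda>x. (T_op l (f x) ^^ k) (P x))" if "poly_family V P" for l k P
    using that by (induction k) (auto intro: poly_family_T_op assms(1))
  have "poly_family V (\<lambda>x. F_list d (f x) is (P x))" for "is"
    by (induction "is") (auto intro: T assms(2))
  then show ?thesis unfolding F_op_F_list by blast
qed

lemma poly_family_G_op:
  assumes "polyfun V f" "poly_family V P" shows "poly_family V (\<lambda>x. G_op (f x) (P x))"
  unfolding G_op_def
proof (rule poly_family_subst[OF assms(2)])
  fix i
  show "poly_family V (\<lambda>x. if i = 0 then mvar 0 else mconst (f x) * mvar i)"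
    using assms(1) by (cases "i = 0") (auto intro: poly_family_mult poly_family_mconst poly_family_const)
qed

lemma poly_family_N_op:
  "polyfun V f \<Longrightarrow> poly_family V P \<Longrightarrow> poly_family V (\<lambda>x. N_op n d (f x) (P x))"
  unfolding N_op_def comp_def by (intro poly_family_F_op poly_family_G_op polyfun_diff polyfun.const)

lemma poly_family_poly_of:
  assumes "\<And>m. m \<in> coord_monomials n d \<Longrightarrow> polyfun V (\<lambda>x. c x m)"
  shows "poly_family V (\<lambda>x. poly_of n d (c x))"
  unfolding poly_of_def by (intro poly_family_add poly_family_sum poly_family_single polyfun.const assms)

text \<open>Complex quantities enter the real quantifier elimination through their real and
  imaginary parts.\<close>

definition complex_polyfun :: "'v set \<Rightarrow> (('v \<Rightarrow> real) \<Rightarrow> complex) \<Rightarrow> bool" where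
  "complex_polyfun V f \<longleftrightarrow> polyfun V (\<lambda>x. Re (f x)) \<and> polyfun V (\<lambda>x. Im (f x))"

lemma complex_polyfun_of_real: "polyfun V f \<Longrightarrow> complex_polyfun V (\<lambda>x. of_real (f x))"
  by (simp add: complex_polyfun_def polyfun.const)

lemma complex_polyfun_const: "complex_polyfun V (\<lambda>x. c)"
  by (simp add: complex_polyfun_def polyfun.const)

lemma complex_polyfun_Complex: "polyfun V f \<Longrightarrow> polyfun V g \<Longrightarrow> complex_polyfun V (\<lambda>x. Complex (f x) (g x))"
  by (simp add: complex_polyfun_def)

lemma complex_polyfun_add: "complex_polyfun V f \<Longrightarrow> complex_polyfun V g \<Longrightarrow> complex_polyfun V (\<lambda>x. f x + g x)"
  by (simp add: complex_polyfun_def polyfun.add)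

lemma complex_polyfun_mult: "complex_polyfun V f \<Longrightarrow> complex_polyfun V g \<Longrightarrow> complex_polyfun V (\<lambda>x. f x * g x)"
  by (simp add: complex_polyfun_def polyfun.add polyfun.mult polyfun_diff)

lemma complex_polyfun_sum: "(\<And>i. i \<in> I \<Longrightarrow> complex_polyfun V (f i)) \<Longrightarrow> complex_polyfun V (\<lambda>x. \<Sum>i\<in>I. f i x)"
  by (induction I rule: infinite_finite_induct) (auto intro: complex_polyfun_add complex_polyfun_const)

lemma complex_polyfun_prod: "(\<And>i. i \<in> I \<Longrightarrow> complex_polyfun V (f i)) \<Longrightarrow> complex_polyfun V (\<lambda>x. \<Prod>i\<in>I. f i x)"
  by (induction I rule: infinite_finite_induct) (auto intro: complex_polyfun_mult complex_polyfun_const)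

lemma complex_polyfun_power: "complex_polyfun V f \<Longrightarrow> complex_polyfun V (\<lambda>x. f x ^ k)"
  by (induction k) (auto intro: complex_polyfun_mult complex_polyfun_const)

lemma complex_polyfun_eval:
  assumes P: "poly_family V P" and z: "\<And>i. complex_polyfun V (\<lambda>x. z x i)"
  shows "complex_polyfun V (\<lambda>x. eval_complex (P x) (z x))"
proof -
  obtain M where M: "finite M" "\<And>x. keys (P x) \<subseteq> M" using P by (auto simp: poly_family_def)
  have eq: "eval_complex (P x) (z x) = (\<Sum>m\<in>M. of_real (lookup (P x) m) * (\<Prod>v\<in>keys m. z x v ^ lookup m v))" for x
    unfolding eval_complex_def mpoly_subst_superset[OF semiring_hom_of_real M] monom_val_def ..
  show ?thesis unfolding eq using P
    by (intro complex_polyfun_sum complex_polyfun_mult complex_polyfun_of_real complex_polyfun_prod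
        complex_polyfun_power z) (simp add: poly_family_def)
qed

lemma sign_determined_complex_eq_0:
  assumes "complex_polyfun V f" shows "sign_determined V (\<lambda>x. f x = 0)"
  using assms unfolding complex_polyfun_def complex_eq_iff zero_complex.simps
  by (intro sign_determined_conj sign_determined_eq_0) auto

text \<open>The coefficients are the free variables \<open>Inl m\<close>, the quantified reals are
  the \<open>Inr k\<close>. By the congruence assumption \<open>g\<close> reads only the first
  \<open>N\<close> entries of \<open>w\<close>, so a quantifier over the whole sequence is one over
  a finite block.\<close>

lemma sign_determined_ex_nat_vars:
  fixes g :: "('i \<Rightarrow> real) \<Rightarrow> (nat \<Rightarrow> real) \<Rightarrow> bool"
  assumes "sign_determined (Inl ` I \<union> Inr ` {..<N}) (\<lambda>x. g (\<lambda>m. x (Inl m)) (\<lambda>k. x (Inr k)))"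
    and cong: "\<And>c w w'. (\<And>k. k < N \<Longrightarrow> w k = w' k) \<Longrightarrow> g c w = g c w'"
  shows "sign_determined (Inl ` I :: ('i + nat) set) (\<lambda>x. \<exists>w. g (\<lambda>m. x (Inl m)) w)"
proof -
  let ?W = "Inr ` {..<N} :: ('i + nat) set"
  let ?g = "\<lambda>x. g (\<lambda>m. x (Inl m)) (\<lambda>k. x (Inr k))"
  have "sign_determined (Inl ` I) (\<lambda>x. \<exists>w. ?g (\<lambda>v. if v \<in> ?W then w v else x v))"
    using assms(1) by (intro sign_determined_ex_block) auto
  moreover have "(\<exists>w. ?g (\<lambda>v. if v \<in> ?W then w v else x v)) \<longleftrightarrow> (\<exists>w. g (\<lambda>m. x (Inl m)) w)" for x
  proof
    assume "\<exists>w. ?g (\<lambda>v. if v \<in> ?W then w v else x v)"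
    then obtain w where "?g (\<lambda>v. if v \<in> ?W then w v else x v)" ..
    moreover have "(\<lambda>m. if Inl m \<in> ?W then w (Inl m) else x (Inl m)) = (\<lambda>m. x (Inl m))" by auto
    ultimately show "\<exists>w. g (\<lambda>m. x (Inl m)) w" by auto
  next
    assume "\<exists>w. g (\<lambda>m. x (Inl m)) w"
    then obtain w where w: "g (\<lambda>m. x (Inl m)) w" ..
    let ?w = "\<lambda>v. case v of Inl _ \<Rightarrow> 0 | Inr k \<Rightarrow> w k"
    have eq: "(\<lambda>m. if Inl m \<in> ?W then ?w (Inl m) else x (Inl m)) = (\<lambda>m. x (Inl m))" by auto
    have "g (\<lambda>m. x (Inl m)) (\<lambda>k. if Inr k \<in> ?W then ?w (Inr k) else x (Inr k)) = g (\<lambda>m. x (Inl m)) w"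
      by (rule cong) auto
    then have "?g (\<lambda>v. if v \<in> ?W then ?w v else x v)" using w unfolding eq by simp
    then show "\<exists>w. ?g (\<lambda>v. if v \<in> ?W then w v else x v)" by (rule exI[of _ ?w])
  qed
  ultimately show ?thesis by simp
qed

section \<open>The defining conditions as formulas over the reals\<close>

lemma eval_complex_cong:
  "p \<in> mpolys_in {0..n} \<Longrightarrow> (\<And>i. i \<le> n \<Longrightarrow> a i = b i) \<Longrightarrow> eval_complex p a = eval_complex p b"
  unfolding eval_complex_def by (rule mpoly_subst_cong) auto

context
  fixes n d :: nat
begin

private abbreviation "P \<equiv> poly_of n d"
private abbreviation "I \<equiv> coord_monomials n d"
private abbreviation "vars N \<equiv> Inl ` I \<union> Inr ` {..<N} :: ((nat \<Rightarrow>\<^sub>0 nat) + nat) set"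

private lemma P_in: "P c \<in> mpolys_in {0..n}"
  using poly_of_FR by (simp add: FR_iff)

private lemma family_P: "poly_family (vars N) (\<lambda>x. P (\<lambda>m. x (Inl m)))"
  by (intro poly_family_poly_of polyfun.var) auto

private lemma polyfun_Inr: "k < N \<Longrightarrow> polyfun (vars N) (\<lambda>x. x (Inr k))"
  by (intro polyfun.var) auto

text \<open>Packs a real direction and a complex value of \<open>t\<close> into \<open>n + 2\<close>
  reals; the imaginary part of \<open>t\<close> goes into the extra entry after those of the
  direction.\<close>

definition real_fibre_point :: "(nat \<Rightarrow> real) \<Rightarrow> nat \<Rightarrow> complex" where
  "real_fibre_point w i = (if i = 0 then Complex (w 0) (w (Suc n)) else if i \<le> n then of_real (w i) else 0)"

private lemma eval_fibre_point:
  assumes "p \<in> mpolys_in {0..n}"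
  shows "eval_complex p (fibre_point w (Complex (w 0) (w (Suc n)))) = eval_complex p (real_fibre_point w)"
  by (rule eval_complex_cong[OF assms]) (simp add: fibre_point_def real_fibre_point_def)

private lemma ex_fibre_point:
  assumes "\<And>u u' z. (\<And>i. i \<in> {1..n} \<Longrightarrow> u i = u' i) \<Longrightarrow> Q u z = Q u' z"
  shows "(\<exists>u z. Q u z) \<longleftrightarrow> (\<exists>w. Q w (Complex (w 0) (w (Suc n))))"
proof
  assume "\<exists>u z. Q u z"
  then obtain u z where uz: "Q u z" by blast
  let ?w = "\<lambda>i. if i = 0 then Re z else if i = Suc n then Im z else u i"
  have "Q ?w z = Q u z" by (rule assms) auto
  then have "Q ?w (Complex (?w 0) (?w (Suc n)))" using uz by simp
  then show "\<exists>w. Q w (Complex (w 0) (w (Suc n)))" by (rule exI[of _ ?w])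
qed blast

private lemma complex_polyfun_fibre_point:
  "complex_polyfun (vars (n + 2)) (\<lambda>x. real_fibre_point (\<lambda>k. x (Inr k)) i)"
proof (cases "i = 0")
  case True
  then show ?thesis by (auto simp: real_fibre_point_def intro!: complex_polyfun_Complex polyfun_Inr)
next
  case False
  then show ?thesis
    by (cases "i \<le> n") (auto simp: real_fibre_point_def intro!: complex_polyfun_of_real complex_polyfun_const polyfun_Inr)
qed

private lemma fibre_point_cong:
  assumes "p \<in> mpolys_in {0..n}" "\<And>i. i \<in> {1..n} \<Longrightarrow> u i = u' i"
  shows "eval_complex p (fibre_point u z) = eval_complex p (fibre_point u' z)"
  by (rule eval_complex_cong[OF assms(1)]) (use assms(2) in \<open>simp add: fibre_point_def\<close>)

private lemma real_fibre_point_cong: "(\<And>k. k < n + 2 \<Longrightarrow> w k = w' k) \<Longrightarrow> real_fibre_point w = real_fibre_point w'"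
  by (rule ext) (simp add: real_fibre_point_def)

text \<open>Failure of hyperbolicity is the existence of a root with nonzero imaginary part in some
  fibre, a statement about \<open>n + 2\<close> real numbers.\<close>

lemma sign_determined_hyperbolic:
  "sign_determined (Inl ` I :: ((nat \<Rightarrow>\<^sub>0 nat) + nat) set) (\<lambda>x. hyperbolic (P (\<lambda>m. x (Inl m))))"
proof -
  let ?g = "\<lambda>c w. eval_complex (P c) (real_fibre_point w) = 0 \<and> w (Suc n) \<noteq> 0"
  have iff: "hyperbolic (P c) \<longleftrightarrow> \<not> (\<exists>w. ?g c w)" for c
  proof -
    have "hyperbolic (P c) \<longleftrightarrow> \<not> (\<exists>u z. eval_complex (P c) (fibre_point u z) = 0 \<and> Im z \<noteq> 0)"
      by (simp add: hyperbolic_def poly_fibre complex_is_Real_iff)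
    also have "(\<exists>u z. eval_complex (P c) (fibre_point u z) = 0 \<and> Im z \<noteq> 0) \<longleftrightarrow>
      (\<exists>w. eval_complex (P c) (fibre_point w (Complex (w 0) (w (Suc n)))) = 0 \<and> Im (Complex (w 0) (w (Suc n))) \<noteq> 0)"
    proof (rule ex_fibre_point)
      fix u u' :: "nat \<Rightarrow> real" and z assume u: "\<And>i. i \<in> {1..n} \<Longrightarrow> u i = u' i"
      show "(eval_complex (P c) (fibre_point u z) = 0 \<and> Im z \<noteq> 0) =
          (eval_complex (P c) (fibre_point u' z) = 0 \<and> Im z \<noteq> 0)"
        using fibre_point_cong[OF P_in u] by simp
    qed
    finally show ?thesis by (simp only: eval_fibre_point[OF P_in] complex.sel)
  qed
  have "sign_determined (vars (n + 2)) (\<lambda>x. ?g (\<lambda>m. x (Inl m)) (\<lambda>k. x (Inr k)))"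
    by (intro sign_determined_conj sign_determined_not sign_determined_complex_eq_0 sign_determined_eq_0
      complex_polyfun_eval family_P complex_polyfun_fibre_point polyfun_Inr) auto
  then have "sign_determined (Inl ` I :: ((nat \<Rightarrow>\<^sub>0 nat) + nat) set) (\<lambda>x. \<exists>w. ?g (\<lambda>m. x (Inl m)) w)"
  proof (rule sign_determined_ex_nat_vars)
    fix c and w w' :: "nat \<Rightarrow> real" assume w: "\<And>k. k < n + 2 \<Longrightarrow> w k = w' k"
    show "?g c w = ?g c w'" using real_fibre_point_cong[OF w] w[of "Suc n"] by simp
  qed
  then show ?thesis unfolding iff by (rule sign_determined_not)
qed

text \<open>Simplicity of a root becomes nonvanishing of the derivative in \<open>t\<close>, which
  makes the condition polynomial in the coefficients, the direction and the root.\<close>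

lemma strictly_hyperbolic_eval:
  assumes "p \<in> FR n d" "hyperbolic p"
  shows "strictly_hyperbolic n p \<longleftrightarrow> \<not> (\<exists>u z. (\<exists>i\<in>{1..n}. u i \<noteq> 0) \<and>
    eval_complex p (fibre_point u z) = 0 \<and> eval_complex (mpderiv 0 p) (fibre_point u z) = 0)"
proof -
  have p: "p \<in> mpolys_in {0..n}" using assms(1) by (simp add: FR_iff)
  have key: "(poly (fibre p u) z = 0 \<longrightarrow> Polynomial.order z (fibre p u) = 1) \<longleftrightarrow>
     \<not> (eval_complex p (fibre_point u z) = 0 \<and> eval_complex (mpderiv 0 p) (fibre_point u z) = 0)" for u z
    using order_eq_1_iff[OF fibre_FR(3)[OF assms(1)], of u z]
    unfolding pderiv_fibre[OF p] poly_fibre by auto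
  show ?thesis using assms(2) unfolding strictly_hyperbolic_def key by blast
qed

lemma sign_determined_not_strict:
  "sign_determined (Inl ` I :: ((nat \<Rightarrow>\<^sub>0 nat) + nat) set)
     (\<lambda>x. hyperbolic (P (\<lambda>m. x (Inl m))) \<and> \<not> strictly_hyperbolic n (P (\<lambda>m. x (Inl m))))"
proof -
  let ?g = "\<lambda>c w. (\<exists>i\<in>{1..n}. w i \<noteq> 0) \<and> eval_complex (P c) (real_fibre_point w) = 0 \<and>
      eval_complex (mpderiv 0 (P c)) (real_fibre_point w) = 0"
  have D_in: "mpderiv 0 (P c) \<in> mpolys_in {0..n}" for c by (rule mpolys_in_mpderiv[OF P_in])
  have iff: "(hyperbolic (P c) \<and> \<not> strictly_hyperbolic n (P c)) \<longleftrightarrow> hyperbolic (P c) \<and> (\<exists>w. ?g c w)" for c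
  proof (rule conj_cong[OF refl])
    assume "hyperbolic (P c)"
    then have "\<not> strictly_hyperbolic n (P c) \<longleftrightarrow> (\<exists>u z. (\<exists>i\<in>{1..n}. u i \<noteq> 0) \<and>
        eval_complex (P c) (fibre_point u z) = 0 \<and> eval_complex (mpderiv 0 (P c)) (fibre_point u z) = 0)"
      by (simp add: strictly_hyperbolic_eval[OF poly_of_FR])
    also have "\<dots> \<longleftrightarrow> (\<exists>w. (\<exists>i\<in>{1..n}. w i \<noteq> 0) \<and>
        eval_complex (P c) (fibre_point w (Complex (w 0) (w (Suc n)))) = 0 \<and>
        eval_complex (mpderiv 0 (P c)) (fibre_point w (Complex (w 0) (w (Suc n)))) = 0)"
    proof (rule ex_fibre_point)
      fix u u' :: "nat \<Rightarrow> real" and z assume u: "\<And>i. i \<in> {1..n} \<Longrightarrow> u i = u' i"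
      show "((\<exists>i\<in>{1..n}. u i \<noteq> 0) \<and>
          eval_complex (P c) (fibre_point u z) = 0 \<and> eval_complex (mpderiv 0 (P c)) (fibre_point u z) = 0) =
        ((\<exists>i\<in>{1..n}. u' i \<noteq> 0) \<and>
          eval_complex (P c) (fibre_point u' z) = 0 \<and> eval_complex (mpderiv 0 (P c)) (fibre_point u' z) = 0)"
        using u fibre_point_cong[OF P_in u] fibre_point_cong[OF D_in u] by simp
    qed
    finally show "\<not> strictly_hyperbolic n (P c) \<longleftrightarrow> (\<exists>w. ?g c w)"
      by (simp add: eval_fibre_point[OF P_in] eval_fibre_point[OF D_in])
  qed
  have "sign_determined (vars (n + 2)) (\<lambda>x. ?g (\<lambda>m. x (Inl m)) (\<lambda>k. x (Inr k)))"
    by (intro sign_determined_conj sign_determined_Ex sign_determined_not sign_determined_complex_eq_0 sign_determined_eq_0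
      complex_polyfun_eval family_P poly_family_mpderiv complex_polyfun_fibre_point polyfun_Inr) auto
  then have "sign_determined (Inl ` I :: ((nat \<Rightarrow>\<^sub>0 nat) + nat) set) (\<lambda>x. \<exists>w. ?g (\<lambda>m. x (Inl m)) w)"
  proof (rule sign_determined_ex_nat_vars)
    fix c and w w' :: "nat \<Rightarrow> real" assume w: "\<And>k. k < n + 2 \<Longrightarrow> w k = w' k"
    have "(\<exists>i\<in>{1..n}. w i \<noteq> 0) \<longleftrightarrow> (\<exists>i\<in>{1..n}. w' i \<noteq> 0)" using w by auto
    then show "?g c w = ?g c w'" using real_fibre_point_cong[OF w] by simp
  qed
  then show ?thesis unfolding iff by (rule sign_determined_conj[OF sign_determined_hyperbolic])
qed

text \<open>Entry \<open>0\<close> is reserved for the parameter \<open>s\<close>; the real and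
  imaginary parts of the coordinates \<open>0\<close> to \<open>n\<close> follow in pairs, which
  takes \<open>2 n + 3\<close> reals in all.\<close>

definition bad_s_point :: "(nat \<Rightarrow> real) \<Rightarrow> nat \<Rightarrow> complex" where
  "bad_s_point w i = (if i \<le> n then Complex (w (2 * i + 1)) (w (2 * i + 2)) else 0)"

lemma FR_N_op: "p \<in> FR n d \<Longrightarrow> d \<ge> 1 \<Longrightarrow> N_op n d s p \<in> mpolys_in {0..n}"
proof -
  assume p: "p \<in> FR n d" and d: "d \<ge> 1"
  have T: "(T_op (mvar i) c ^^ k) q \<in> FR n d" if "q \<in> FR n d" "i \<in> {1..n}" for i c k q
    using that d by (induction k) (auto intro: FR_T_op)
  have "set is \<subseteq> {1..n} \<Longrightarrow> F_list d c is q \<in> FR n d" if "q \<in> FR n d" for "is" c q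
    using that by (induction "is") (auto intro: T)
  moreover have "set [1..<Suc n] \<subseteq> {1..n}" by auto
  ultimately have "F_op n d c q \<in> FR n d" if "q \<in> FR n d" for c q
    using that unfolding F_op_F_list by blast
  then show ?thesis using FR_G_op[OF p] by (simp add: N_op_def FR_iff)
qed

lemma sign_determined_N_op_singular:
  assumes "d \<ge> 1"
  shows "sign_determined (Inl ` I :: ((nat \<Rightarrow>\<^sub>0 nat) + nat) set)
     (\<lambda>x. \<exists>s\<in>{0<..1}. \<not> smooth_hypersurface n (N_op n d s (P (\<lambda>m. x (Inl m)))))"
proof -
  \<comment> \<open>The bound \<open>s \<le> 1\<close> is written as a negated strict inequality
    with \<open>0\<close>, which is the form that \<open>sign_determined_pos\<close> treats.\<close>
  let ?g = "\<lambda>c w. 0 < w 0 \<and> \<not> 0 < w 0 - 1 \<and> singular_point n (N_op n d (w 0) (P c)) (bad_s_point w)"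
  have iff: "(\<exists>s\<in>{0<..1}. \<not> smooth_hypersurface n (N_op n d s (P c))) \<longleftrightarrow> (\<exists>w. ?g c w)" for c
  proof
    assume "\<exists>s\<in>{0<..1}. \<not> smooth_hypersurface n (N_op n d s (P c))"
    then obtain s z where s: "0 < s" "s \<le> 1" "singular_point n (N_op n d s (P c)) z"
      by (auto simp: not_smooth_iff)
    let ?w = "\<lambda>k. if k = 0 then s else if odd k then Re (z ((k - 1) div 2)) else Im (z ((k - 2) div 2))"
    have w: "bad_s_point ?w i = z i" if "i \<le> n" for i using that by (simp add: bad_s_point_def)
    have N: "N_op n d s (P c) \<in> mpolys_in {0..n}" by (rule FR_N_op[OF poly_of_FR assms])
    have "singular_point n (N_op n d s (P c)) (bad_s_point ?w)"
      unfolding singular_point_def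
    proof (intro conjI ballI)
      obtain i where "i \<in> {0..n}" "z i \<noteq> 0" using s(3) by (auto simp: singular_point_def)
      then show "\<exists>i\<in>{0..n}. bad_s_point ?w i \<noteq> 0" using w by (intro bexI[of _ i]) auto
      show "eval_complex (N_op n d s (P c)) (bad_s_point ?w) = 0"
        using s(3) eval_complex_cong[OF N w] by (simp add: singular_point_def)
      fix i assume i: "i \<in> {0..n}"
      show "eval_complex (mpderiv i (N_op n d s (P c))) (bad_s_point ?w) = 0"
        using s(3) i eval_complex_cong[OF mpolys_in_mpderiv[OF N] w] by (simp add: singular_point_def)
    qed
    then have "?g c ?w" using s by simp
    then show "\<exists>w. ?g c w" by (rule exI[of _ ?w])
  next
    assume "\<exists>w. ?g c w"
    then obtain w where w: "?g c w" by blast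
    then have "w 0 \<in> {0<..1}" by auto
    moreover have "\<not> smooth_hypersurface n (N_op n d (w 0) (P c))" using w not_smooth_iff by blast
    ultimately show "\<exists>s\<in>{0<..1}. \<not> smooth_hypersurface n (N_op n d s (P c))" by blast
  qed
  have pt: "complex_polyfun (vars (2 * n + 3)) (\<lambda>x. bad_s_point (\<lambda>k. x (Inr k)) i)" for i
    by (cases "i \<le> n") (auto simp: bad_s_point_def intro!: complex_polyfun_Complex complex_polyfun_const polyfun_Inr)
  have N: "poly_family (vars (2 * n + 3)) (\<lambda>x. N_op n d (x (Inr 0)) (P (\<lambda>m. x (Inl m))))"
    by (intro poly_family_N_op family_P polyfun_Inr) simp
  have "sign_determined (vars (2 * n + 3)) (\<lambda>x. ?g (\<lambda>m. x (Inl m)) (\<lambda>k. x (Inr k)))"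
    unfolding singular_point_def
    by (intro sign_determined_conj sign_determined_Ex sign_determined_All sign_determined_not sign_determined_complex_eq_0
      sign_determined_pos polyfun_diff polyfun.const complex_polyfun_eval poly_family_mpderiv N pt polyfun_Inr) auto
  then have "sign_determined (Inl ` I :: ((nat \<Rightarrow>\<^sub>0 nat) + nat) set) (\<lambda>x. \<exists>w. ?g (\<lambda>m. x (Inl m)) w)"
  proof (rule sign_determined_ex_nat_vars)
    fix c and w w' :: "nat \<Rightarrow> real" assume w: "\<And>k. k < 2 * n + 3 \<Longrightarrow> w k = w' k"
    have "bad_s_point w = bad_s_point w'" by (rule ext) (simp add: bad_s_point_def w)
    then show "?g c w = ?g c w'" using w[of 0] by simp
  qed
  then show ?thesis unfolding iff .
qed

text \<open>For strictly hyperbolic \<open>p\<close> all \<open>N_op n d s p\<close> in question are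
  hyperbolic again, so only smoothness can fail; any other hyperbolic \<open>p\<close> is bad by the
  first alternative.\<close>

lemma bad_iff:
  assumes "p \<in> FR n d" "d \<ge> 1"
  shows "p \<in> Hyp n d - good_set n d \<longleftrightarrow> (hyperbolic p \<and> \<not> strictly_hyperbolic n p) \<or>
    (hyperbolic p \<and> (\<exists>s\<in>{0<..1}. \<not> smooth_hypersurface n (N_op n d s p)))"
proof (cases "strictly_hyperbolic n p")
  case True
  have "N_op n d s p \<in> Hyp n d" if "s \<in> {0<..1}" for s
    using N_op_strictly_hyperbolic[OF assms True, of s] that by (simp add: Hyp_def strictly_hyperbolic_def)
  then show ?thesis using assms(1) True by (auto simp: Hyp_def good_set_def Hyp_smooth_def)
next
  case False
  then show ?thesis using assms(1) by (auto simp: Hyp_def good_set_def)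
qed

lemma sign_determined_Inl:
  assumes "sign_determined (Inl ` I :: ((nat \<Rightarrow>\<^sub>0 nat) + nat) set) (\<lambda>x. g (\<lambda>m. x (Inl m)))"
  shows "sign_determined I g"
proof -
  have "sign_determined I (\<lambda>y. g (\<lambda>m. case Inl m of Inl m \<Rightarrow> y m | Inr (k::nat) \<Rightarrow> 0))"
    by (rule sign_determined_compose[OF assms, where \<sigma> = "\<lambda>y v. case v of Inl m \<Rightarrow> y m | Inr k \<Rightarrow> 0"])
      (auto intro: polyfun.var)
  then show ?thesis by simp
qed

lemma semialgebraic_bad:
  assumes "d \<ge> 1"
  shows "semialgebraic_in_FR n d (Hyp n d - good_set n d)"
proof -
  have "sign_determined (Inl ` I :: ((nat \<Rightarrow>\<^sub>0 nat) + nat) set) (\<lambda>x. P (\<lambda>m. x (Inl m)) \<in> Hyp n d - good_set n d)"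
    unfolding bad_iff[OF poly_of_FR assms]
    by (intro sign_determined_disj sign_determined_not_strict sign_determined_conj[OF sign_determined_hyperbolic]
      sign_determined_N_op_singular assms)
  from semialgebraic_sign_determined[OF sign_determined_Inl[OF this]]
  have "semialgebraic I (coords n d ` (Hyp n d - good_set n d))"
    by (subst coords_image) (auto simp: Hyp_def)
  then show ?thesis unfolding semialgebraic_in_FR_def by (auto simp: Hyp_def)
qed

end

section \<open>Nonreal singular points\<close>

lemma eval_complex_scale: "homogeneous k p \<Longrightarrow> eval_complex p (\<lambda>v. c * z v) = c ^ k * eval_complex p z"
  unfolding eval_complex_def by (rule mpoly_subst_scale)

lemma eval_complex_cnj: "eval_complex p (\<lambda>v. cnj (z v)) = cnj (eval_complex p z)"
  unfolding eval_complex_def mpoly_subst_def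
  by (simp only: cnj_sum cnj_prod complex_cnj_mult complex_cnj_power complex_cnj_complex_of_real)

lemma eval_complex_FR:
  assumes "p \<in> FR n d" shows "eval_complex p (\<lambda>i. if i = 0 then 1 else 0) = 1"
proof -
  have "complex_of_real (mpoly_subst (\<lambda>c. c) (\<lambda>i. if i = 0 then 1 else 0) p) =
      mpoly_subst of_real (\<lambda>i. of_real (if i = 0 then 1 else 0)) p"
    by (rule hom_mpoly_subst[OF semiring_hom_of_real])
  moreover have "(\<lambda>i::nat. complex_of_real (if i = 0 then 1 else 0)) = (\<lambda>i. if i = 0 then 1 else 0)" by auto
  ultimately show ?thesis using assms by (simp add: FR_iff eval_complex_def)
qed

lemma singular_point_scale:
  assumes "homogeneous d p" "singular_point n p z" "c \<noteq> 0"
  shows "singular_point n p (\<lambda>v. c * z v)"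
  unfolding singular_point_def eval_complex_scale[OF assms(1)] eval_complex_scale[OF homogeneous_mpderiv[OF assms(1)]]
proof (intro conjI ballI)
  show "\<exists>i\<in>{0..n}. c * z i \<noteq> 0" using assms(2,3) by (simp add: singular_point_def)
  show "c ^ d * eval_complex p z = 0" using assms(2) by (simp add: singular_point_def)
  fix i assume "i \<in> {0..n}"
  then show "c ^ (d - 1) * eval_complex (mpderiv i p) z = 0" using assms(2) by (simp add: singular_point_def)
qed

abbreviation complex_subst :: "(nat \<Rightarrow> complex poly) \<Rightarrow> (nat, real) mpoly \<Rightarrow> complex poly" where
  "complex_subst \<equiv> mpoly_subst (\<lambda>c. [:of_real c:])"

lemma poly_complex_subst: "poly (complex_subst a p) t = eval_complex p (\<lambda>v. poly (a v) t)"
  unfolding eval_complex_def by (subst hom_mpoly_subst[OF semiring_hom_poly]) simp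

lemma degree_complex_subst:
  assumes "homogeneous k p" "\<And>v. degree (a v) \<le> 1"
  shows "degree (complex_subst a p) \<le> k"
  unfolding mpoly_subst_def
proof (rule degree_sum_le)
  fix m assume "m \<in> keys p"
  then have k: "k = (\<Sum>v\<in>keys m. lookup m v)" using assms(1) by (simp add: homogeneous_def mdeg_def)
  have pow: "degree (a v ^ lookup m v) \<le> lookup m v" for v
    using mult_le_mono1[OF assms(2), of v "lookup m v"] by (intro order_trans[OF degree_power_le]) simp
  have "degree (\<Prod>v\<in>keys m. a v ^ lookup m v) \<le> (\<Sum>v\<in>keys m. degree (a v ^ lookup m v))"
    using degree_prod_sum_le[of "keys m" "\<lambda>v. a v ^ lookup m v"] by (simp add: comp_def)
  also have "\<dots> \<le> k" unfolding k by (intro sum_mono pow)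
  finally have "degree (\<Prod>v\<in>keys m. a v ^ lookup m v) \<le> k" .
  then show "degree ([:of_real (lookup p m):] * (\<Prod>v\<in>keys m. a v ^ lookup m v)) \<le> k"
    by (intro order_trans[OF degree_mult_le]) simp
qed simp

text \<open>By the chain rule, restriction to a curve that passes through a singular point at time
  \<open>0\<close> has a double zero there.\<close>

lemma poly_pderiv_complex_subst_singular:
  assumes "p \<in> mpolys_in {0..n}" "singular_point n p z" "\<And>v. v \<le> n \<Longrightarrow> poly (a v) 0 = z v"
  shows "poly (complex_subst a p) 0 = 0" "poly (pderiv (complex_subst a p)) 0 = 0"
proof -
  show "poly (complex_subst a p) 0 = 0"
    using assms(2) eval_complex_cong[OF assms(1,3)] by (simp add: poly_complex_subst singular_point_def)
  have "poly (pderiv (complex_subst a p)) 0 = (\<Sum>v\<in>{0..n}. poly (pderiv (a v)) 0 * eval_complex (mpderiv v p) z)"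
    unfolding pderiv_mpoly_subst[OF finite_atLeastAtMost assms(1)] poly_sum poly_mult poly_complex_subst
  proof (intro sum.cong refl arg_cong2[of _ _ _ _ "(*)"])
    fix k show "eval_complex (mpderiv k p) (\<lambda>v. poly (a v) 0) = eval_complex (mpderiv k p) z"
      by (rule eval_complex_cong[OF mpolys_in_mpderiv[OF assms(1)] assms(3)])
  qed
  also have "\<dots> = 0" using assms(2) by (intro sum.neutral) (auto simp: singular_point_def)
  finally show "poly (pderiv (complex_subst a p)) 0 = 0" .
qed

lemma strictly_hyperbolicD:
  assumes "q \<in> FR n d" "strictly_hyperbolic n q" "i \<in> {1..n}" "u i \<noteq> 0"
    "eval_complex q (fibre_point u z) = 0" "eval_complex (mpderiv 0 q) (fibre_point u z) = 0"
  shows False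
proof -
  have "hyperbolic q" using assms(2) by (simp add: strictly_hyperbolic_def)
  moreover have "\<exists>u z. (\<exists>i\<in>{1..n}. u i \<noteq> 0) \<and> eval_complex q (fibre_point u z) = 0 \<and>
      eval_complex (mpderiv 0 q) (fibre_point u z) = 0"
    using assms(3-6) by (intro exI[of _ u] exI[of _ z] conjI bexI[of _ i])
  ultimately show False using assms(2) strictly_hyperbolic_eval[OF assms(1)] by simp
qed

text \<open>A singular point of a strictly hyperbolic polynomial is, up to scaling, not real, since a real one
  would be a double root of a fibre.\<close>

lemma strictly_hyperbolic_singular_point:
  assumes q: "q \<in> FR n d" "strictly_hyperbolic n q" and sing: "singular_point n q z"
  obtains w i j where "singular_point n q w" "i \<in> {1..n}" "j \<in> {1..n}" "w i = 1" "Im (w j) \<noteq> 0"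
proof -
  have h: "homogeneous d q" and qin: "q \<in> mpolys_in {0..n}" using q(1) by (auto simp: FR_iff)
  have hyp: "hyperbolic q" using q(2) by (simp add: strictly_hyperbolic_def)
  \<comment> \<open>Otherwise \<open>z\<close> is a multiple of \<open>(1, 0, ..., 0)\<close>, where
    \<open>q\<close> takes the value \<open>1\<close>.\<close>
  have "\<exists>i\<in>{1..n}. z i \<noteq> 0"
  proof (rule ccontr)
    assume "\<not> ?thesis"
    then have z: "\<And>i. i \<le> n \<Longrightarrow> z i = z 0 * (if i = 0 then 1 else 0)" by auto
    have "eval_complex q z = eval_complex q (\<lambda>i. z 0 * (if i = 0 then 1 else 0))"
      by (rule eval_complex_cong[OF qin z])
    also have "\<dots> = z 0 ^ d" unfolding eval_complex_scale[OF h] eval_complex_FR[OF q(1)] by simp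
    finally have "eval_complex q z = z 0 ^ d" .
    moreover have "z 0 \<noteq> 0"
    proof
      assume "z 0 = 0"
      then have "z i = 0" if "i \<le> n" for i by (subst z[OF that]) simp
      then have "\<forall>i\<in>{0..n}. z i = 0" by simp
      then show False using sing by (auto simp: singular_point_def)
    qed
    ultimately show False using sing by (simp add: singular_point_def)
  qed
  then obtain i where i: "i \<in> {1..n}" "z i \<noteq> 0" by blast
  define w where "w = (\<lambda>v. 1 / z i * z v)"
  have w: "singular_point n q w" unfolding w_def using i by (intro singular_point_scale[OF h sing]) auto
  have wi: "w i = 1" using i by (simp add: w_def)
  have "\<exists>j\<in>{1..n}. Im (w j) \<noteq> 0"
  proof (rule ccontr)
    assume no: "\<not> ?thesis"
    let ?u = "\<lambda>k. Re (w k)"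
    have fp: "\<And>k. k \<le> n \<Longrightarrow> w k = fibre_point ?u (w 0) k"
      using no by (auto simp: fibre_point_def complex_eq_iff)
    have "eval_complex q (fibre_point ?u (w 0)) = 0"
      using w eval_complex_cong[OF qin fp] by (simp add: singular_point_def)
    moreover have "eval_complex (mpderiv 0 q) (fibre_point ?u (w 0)) = 0"
      using w eval_complex_cong[OF mpolys_in_mpderiv[OF qin] fp] by (simp add: singular_point_def)

    ultimately show False by (rule strictly_hyperbolicD[OF q i(1), rotated]) (simp add: wi)
  qed
  then obtain j where "j \<in> {1..n}" "Im (w j) \<noteq> 0" by blast
  then show ?thesis using that w i(1) wi by blast
qed

lemma poly_1_sum_coeff: "degree (p :: complex poly) \<le> N \<Longrightarrow> poly p 1 = (\<Sum>k\<le>N. coeff p k)"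
proof -
  assume "degree p \<le> N"
  then have "(\<Sum>k\<le>degree p. coeff p k) = (\<Sum>k\<le>N. coeff p k)"
    by (intro sum.mono_neutral_left) (auto simp: not_le coeff_eq_0)
  then show ?thesis by (simp add: poly_altdef)
qed

text \<open>A quadric that is singular at a point and its conjugate is singular on the line joining them.\<close>

lemma strictly_hyperbolic_singular_degree:
  assumes q: "q \<in> FR n d" "strictly_hyperbolic n q" and w: "singular_point n q w" "i \<in> {1..n}" "w i = 1"
  shows "d \<ge> 3"
proof (rule ccontr)
  assume "\<not> d \<ge> 3"
  then have d: "d \<le> 2" by simp
  have h: "homogeneous d q" and qin: "q \<in> mpolys_in {0..n}" using q(1) by (auto simp: FR_iff)
  have hyp: "hyperbolic q" using q(2) by (simp add: strictly_hyperbolic_def)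
  \<comment> \<open>The line from \<open>w\<close> at time \<open>0\<close> to its conjugate at time
    \<open>1\<close>. On it \<open>q\<close> has degree at most 2, a double zero at \<open>0\<close>
    and a zero at \<open>1\<close>, so it vanishes; so does its derivative in \<open>t\<close>, of
    degree at most 1 with zeros at both times.\<close>
  let ?a = "\<lambda>v. [:w v, cnj (w v) - w v:]"
  define Q where "Q = complex_subst ?a q"
  define D where "D = complex_subst ?a (mpderiv 0 q)"
  have Q0: "poly Q 0 = 0" "poly (pderiv Q) 0 = 0"
    unfolding Q_def by (rule poly_pderiv_complex_subst_singular[OF qin w(1)]; simp)+
  have "degree [:x, y:] \<le> 1" for x y :: complex by (cases "y = 0") auto
  note a1 = this
  have degQ: "degree Q \<le> 2" unfolding Q_def using degree_complex_subst[OF h a1] d by (rule order_trans)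
  have "degree D \<le> d - 1" unfolding D_def by (rule degree_complex_subst[OF homogeneous_mpderiv[OF h] a1])
  then have degD: "degree D \<le> 1" using d by simp
  have Q1: "poly Q 1 = 0" unfolding Q_def using w(1) by (simp add: poly_complex_subst eval_complex_cnj singular_point_def)
  have D01: "poly D 0 = 0" "poly D 1 = 0"
    unfolding D_def using w(1) by (simp_all add: poly_complex_subst eval_complex_cnj singular_point_def)
  have "coeff Q 0 = 0" "coeff Q 1 = 0" using Q0 by (simp_all add: poly_0_coeff_0 coeff_pderiv)
  moreover have "poly Q 1 = coeff Q 0 + coeff Q 1 + coeff Q 2"
    unfolding poly_1_sum_coeff[OF degQ] by (simp add: numeral_2_eq_2)
  ultimately have c: "coeff Q k = 0" if "k \<le> 2" for k using Q1 that by (auto simp: le_Suc_eq numeral_2_eq_2)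
  have "Q = 0" using c[OF degQ] by simp
  have "coeff D 0 = 0" using D01 by (simp add: poly_0_coeff_0)
  moreover have "poly D 1 = coeff D 0 + coeff D 1"
    unfolding poly_1_sum_coeff[OF degD] by simp
  ultimately have c: "coeff D k = 0" if "k \<le> 1" for k using D01 that by (auto simp: le_Suc_eq)
  have "D = 0" using c[OF degD] by simp
  let ?u = "\<lambda>k. Re (w k)"
  \<comment> \<open>The midpoint is real and, because of \<open>w i = 1\<close>, lies over a nonzero
    direction, so a fibre of \<open>q\<close> has a double root there.\<close>
  have pt: "(\<lambda>v. poly (?a v) (1 / 2)) = fibre_point ?u (complex_of_real (Re (w 0)))"
    by (rule ext) (auto simp: fibre_point_def complex_eq_iff)
  have "poly Q (1 / 2) = 0" "poly D (1 / 2) = 0" using \<open>Q = 0\<close> \<open>D = 0\<close> by auto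
  then have "eval_complex q (fibre_point ?u (of_real (Re (w 0)))) = 0"
    "eval_complex (mpderiv 0 q) (fibre_point ?u (of_real (Re (w 0)))) = 0"
    unfolding Q_def D_def poly_complex_subst pt by auto
  then show False by (rule strictly_hyperbolicD[OF q w(2), rotated]) (simp add: w(3))
qed

text \<open>The linear map whose columns at \<open>i\<close> and \<open>j\<close> are the vectors
  \<open>a\<close> and \<open>b\<close>, the other columns being those of the identity. It sends the
  point with coordinate \<open>1\<close> at \<open>i\<close> and \<open>\<i>\<close> at
  \<open>j\<close> to \<open>a + \<i> b\<close>, so the real and imaginary parts of a singular point
  serve as \<open>a\<close> and \<open>b\<close>.\<close>

definition linear_change :: "nat \<Rightarrow> nat \<Rightarrow> (nat \<Rightarrow> real) \<Rightarrow> (nat \<Rightarrow> real) \<Rightarrow> nat \<Rightarrow> (nat, real) mpoly" where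
  "linear_change i j a b v =
     (if v \<in> {i, j} then 0 else mvar v) + mconst (a v) * mvar i + mconst (b v) * mvar j"

lemma linear_change_in: "i \<le> n \<Longrightarrow> j \<le> n \<Longrightarrow> v \<le> n \<Longrightarrow> linear_change i j a b v \<in> mpolys_in {0..n}"
proof -
  assume *: "i \<le> n" "j \<le> n" "v \<le> n"
  then have "(if v \<in> {i, j} then 0 else mvar v) \<in> mpolys_in {0..n}"
    by (cases "v \<in> {i, j}") (simp_all add: mpolys_in_zero mpolys_in_mvar)
  then show ?thesis unfolding linear_change_def
    using * by (intro mpolys_in_add mpolys_in_mult mpolys_in_mconst mpolys_in_mvar) simp_all
qed

lemma homogeneous_linear_change: "homogeneous 1 (linear_change i j a b v)"
proof -
  have "homogeneous 1 (if v \<in> {i, j} then 0 else mvar v)"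
    by (cases "v \<in> {i, j}") (simp_all only: if_True if_False homogeneous_zero homogeneous_mvar not_False_eq_True)
  then show ?thesis unfolding linear_change_def
    by (intro homogeneous_add homogeneous_mconst_mult homogeneous_mvar)
qed

text \<open>The block of rows and columns \<open>i\<close>, \<open>j\<close> is triangular with
  diagonal entries \<open>1\<close> and \<open>b j\<close>, and its inverse determines the rest. The
  inverse map has the same shape, with \<open>a' i = 1\<close> and \<open>b' i = 0\<close>, so
  \<open>2 n\<close> real numbers describe it.\<close>

lemma linear_change_inverse:
  assumes ij: "i \<noteq> j" and a: "a i = 1" "b i = 0" "b j \<noteq> 0"
  defines "a' \<equiv> \<lambda>v. if v = i then 1 else if v = j then - a j / b j else - a v + b v * a j / b j"
    and "b' \<equiv> \<lambda>v. if v = i then 0 else if v = j then 1 / b j else - b v / b j"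
  shows "mpoly_subst mconst (linear_change i j a' b') (linear_change i j a b v) = mvar v"
proof -
  note s = mpoly_subst_zero mpoly_subst_simps[OF semiring_hom_mconst]
  let ?L = "linear_change i j a' b'"
  have c: "mconst x + mconst y = (mconst (x + y) :: (nat, real) mpoly)"
    "mconst x * mconst y = (mconst (x * y) :: (nat, real) mpoly)" for x y
    by (simp_all only: semiring_hom_simps(3,4)[OF semiring_hom_mconst])
  have c01: "mconst 0 = (0 :: (nat, real) mpoly)" "mconst 1 = (1 :: (nat, real) mpoly)"
    using semiring_hom_simps(1,2)[OF semiring_hom_mconst] by auto
  have comb: "mconst x * p + mconst y * p = mconst (x + y) * p" for x y and p :: "(nat, real) mpoly"
    by (simp add: c(1)[symmetric] distrib_right)
  have Li: "?L i = mvar i" using ij by (simp add: linear_change_def a'_def b'_def c01)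
  have Lj: "?L j = mconst (- a j / b j) * mvar i + mconst (1 / b j) * mvar j"
    using ij by (simp add: linear_change_def a'_def b'_def)
  have main: "mconst (a v) * mvar i + mconst (b v) * ?L j =
      mconst (a v - b v * a j / b j) * mvar i + mconst (b v / b j) * mvar j"
    unfolding Lj by (simp add: distrib_left mult.assoc[symmetric] c comb add.assoc[symmetric])
  have "mpoly_subst mconst ?L (linear_change i j a b v) =
      (if v \<in> {i, j} then 0 else ?L v) + (mconst (a v) * mvar i + mconst (b v) * ?L j)"
    unfolding linear_change_def[of i j a b] by (simp add: s Li add.assoc)
  also have "\<dots> = mvar v"
  proof -
    consider "v = i" | "v = j" "v \<noteq> i" | "v \<notin> {i, j}" by blast
    then show ?thesis
    proof cases
      case 1 then show ?thesis unfolding main using a by (simp add: c01)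
    next
      case 2 then show ?thesis unfolding main using a by (simp add: c01)
    next
      case 3
      then have "?L v = mvar v + mconst (- a v + b v * a j / b j) * mvar i + mconst (- b v / b j) * mvar j"
        by (simp add: linear_change_def a'_def b'_def)
      moreover have "mvar v + mconst x * mvar i + mconst y * mvar j + (mconst (- x) * mvar i + mconst (- y) * mvar j) =
          (mvar v :: (nat, real) mpoly)" for x y
      proof -
        have "mvar v + mconst x * mvar i + mconst y * mvar j + (mconst (- x) * mvar i + mconst (- y) * mvar j) =
          mvar v + (mconst x * mvar i + mconst (- x) * mvar i) + (mconst y * mvar j + mconst (- y) * (mvar j :: (nat, real) mpoly))"
          by (simp only: add_ac)
        then show ?thesis unfolding comb by (simp add: c01)
      qed
      from this[of "- a v + b v * a j / b j" "- b v / b j"]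
      have "?L v + (mconst (a v - b v * a j / b j) * mvar i + mconst (b v / b j) * mvar j) = mvar v"
        unfolding \<open>?L v = _\<close> by simp
      with 3 show ?thesis unfolding main by simp
    qed
  qed
  finally show ?thesis .
qed

definition std_point :: "nat \<Rightarrow> nat \<Rightarrow> nat \<Rightarrow> complex" where
  "std_point i j v = (if v = i then 1 else if v = j then \<i> else 0)"

lemma singular_point_linear_change:
  assumes q: "q \<in> FR n d" "singular_point n q w" and ij: "i \<in> {1..n}" "j \<in> {1..n}" "i \<noteq> j"
  defines "r \<equiv> mpoly_subst mconst (linear_change i j (\<lambda>v. Re (w v)) (\<lambda>v. Im (w v))) q"
  shows "r \<in> FR n d" "singular_point n r (std_point i j)"
proof -
  let ?M = "linear_change i j (\<lambda>v. Re (w v)) (\<lambda>v. Im (w v))"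
  have qin: "q \<in> mpolys_in {0..n}" and h: "homogeneous d q" using q(1) by (auto simp: FR_iff)
  have rin: "r \<in> mpolys_in {0..n}" unfolding r_def
    using ij by (intro mpolys_in_subst[OF qin] linear_change_in) auto
  have rh: "homogeneous d r" unfolding r_def by (intro homogeneous_subst[OF h] homogeneous_linear_change)
  note s = mpoly_subst_zero mpoly_subst_simps[OF semiring_hom_id]
  \<comment> \<open>The point \<open>(1, 0, ..., 0)\<close> is fixed by the change, since
    \<open>i\<close> and \<open>j\<close> differ from \<open>0\<close>; so the normalisation of
    \<open>q\<close> passes to \<open>r\<close>.\<close>
  have "mpoly_subst (\<lambda>c. c) (\<lambda>i. if i = 0 then 1 else 0) r = mpoly_subst (\<lambda>c. c) (\<lambda>i. if i = 0 then 1 else (0::real)) q"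
    unfolding r_def mpoly_subst_mpoly_subst[OF semiring_hom_id]
    by (rule mpoly_subst_cong[OF qin]) (use ij in \<open>auto simp: linear_change_def s\<close>)
  then show rFR: "r \<in> FR n d" using q(1) rin rh by (simp add: FR_iff)
  have wv: "eval_complex (?M v) (std_point i j) = w v" for v
  proof -
    have "eval_complex (?M v) (std_point i j) = of_real (Re (w v)) + of_real (Im (w v)) * \<i>"
      using ij(3) by (simp add: linear_change_def eval_complex_simps std_point_def)
    then show ?thesis by (simp add: complex_eq_iff)
  qed
  show "singular_point n r (std_point i j)"
    unfolding singular_point_def
  proof (intro conjI ballI)
    show "\<exists>v\<in>{0..n}. std_point i j v \<noteq> 0" using ij by (intro bexI[of _ i]) (auto simp: std_point_def)
    have "eval_complex r (std_point i j) = eval_complex q (\<lambda>v. eval_complex (?M v) (std_point i j))"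
      unfolding r_def eval_complex_def by (rule mpoly_subst_mpoly_subst[OF semiring_hom_of_real])
    then show "eval_complex r (std_point i j) = 0" using q(2) by (simp add: wv singular_point_def)
    fix k assume k: "k \<in> {0..n}"
    \<comment> \<open>A line through the standard point in the direction \<open>k\<close>: the
      derivative of \<open>r\<close> along it is the partial derivative, and the change of
      coordinates takes it to a line through \<open>w\<close>.\<close>
    let ?a = "\<lambda>v. [:std_point i j v, if v = k then 1 else 0:]"
    have "pderiv (complex_subst ?a r) = (\<Sum>v\<in>{0..n}. pderiv (?a v) * complex_subst ?a (mpderiv v r))"
      by (rule pderiv_mpoly_subst[OF _ rin]) simp
    also have "\<dots> = (\<Sum>v\<in>{0..n}. if v = k then complex_subst ?a (mpderiv k r) else 0)"
      by (intro sum.cong) (auto simp: pderiv_pCons one_pCons[symmetric])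
    also have "\<dots> = complex_subst ?a (mpderiv k r)" using k by simp
    finally have "eval_complex (mpderiv k r) (std_point i j) = poly (pderiv (complex_subst ?a r)) 0"
      by (simp add: poly_complex_subst)
    also have "complex_subst ?a r = complex_subst (\<lambda>v. complex_subst ?a (?M v)) q"
      unfolding r_def by (rule mpoly_subst_mpoly_subst[OF semiring_hom_poly_const])
    also have "poly (pderiv \<dots>) 0 = 0"
      by (rule poly_pderiv_complex_subst_singular(2)[OF qin q(2)]) (simp add: poly_complex_subst wv)
    finally show "eval_complex (mpderiv k r) (std_point i j) = 0" .
  qed
qed

text \<open>All coordinates except \<open>i\<close> and \<open>j\<close> vanish, so only monomials
  in these two variables contribute.\<close>

lemma eval_complex_std_point:
  assumes ij: "i \<noteq> j" and h: "homogeneous D s"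
  shows "eval_complex s (std_point i j) = (\<Sum>a\<le>D. of_real (lookup s (single i (D - a) + single j a)) * \<i> ^ a)"
proof -
  let ?m = "\<lambda>a. single i (D - a) + single j a :: nat \<Rightarrow>\<^sub>0 nat"
  have inj: "inj_on ?m {..D}"
  proof (rule inj_onI)
    fix a b assume "?m a = ?m b"
    then have "lookup (?m a) j = lookup (?m b) j" by simp
    then show "a = b" using ij by (simp add: lookup_add lookup_single)
  qed
  have mv: "monom_val (std_point i j) (?m a) = \<i> ^ a" for a
    using ij by (simp add: monom_val_add monom_val_single std_point_def)
  have "eval_complex s (std_point i j) = (\<Sum>m\<in>keys s \<union> ?m ` {..D}. of_real (lookup s m) * monom_val (std_point i j) m)"
    unfolding eval_complex_def by (rule mpoly_subst_superset[OF semiring_hom_of_real]) auto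
  also have "\<dots> = (\<Sum>m\<in>?m ` {..D}. of_real (lookup s m) * monom_val (std_point i j) m)"
  proof (rule sum.mono_neutral_right)
    show "\<forall>m\<in>(keys s \<union> ?m ` {..D}) - ?m ` {..D}. of_real (lookup s m) * monom_val (std_point i j) m = 0"
    proof
      fix m assume m: "m \<in> (keys s \<union> ?m ` {..D}) - ?m ` {..D}"
      then have deg: "mdeg m = D" using h by (auto simp: homogeneous_def)
      have "\<not> keys m \<subseteq> {i, j}"
      proof
        assume k: "keys m \<subseteq> {i, j}"
        then have sum: "D = lookup m i + lookup m j" using ij deg mdeg_superset[of "{i, j}" m] by simp
        have "m = ?m (lookup m j)"
        proof (rule poly_mapping_eqI)
          fix v
          have "lookup m v = 0" if "v \<noteq> i" "v \<noteq> j"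
          proof -
            have "v \<notin> keys m" using k that by auto
            then show ?thesis by (simp add: in_keys_iff)
          qed
          then show "lookup m v = lookup (?m (lookup m j)) v"
            using ij sum by (auto simp: lookup_add lookup_single when_def)
        qed
        then have "m \<in> ?m ` {..D}" using sum by (intro image_eqI[of _ _ "lookup m j"]) auto
        with m show False by simp
      qed
      then obtain v where "v \<in> keys m" "v \<noteq> i" "v \<noteq> j" by auto
      then have "monom_val (std_point i j) m = 0"
        unfolding monom_val_def by (intro prod_zero) (auto intro!: bexI[of _ v] simp: std_point_def in_keys_iff)
      then show "of_real (lookup s m) * monom_val (std_point i j) m = 0" by simp
    qed
  qed auto
  also have "\<dots> = (\<Sum>a\<le>D. of_real (lookup s (?m a)) * monom_val (std_point i j) (?m a))"
    by (rule sum.reindex_cong[OF inj]) auto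
  finally show ?thesis by (simp only: mv)
qed

section \<open>Inverting the operators\<close>

text \<open>A Neumann series: \<open>T_op (mvar i) s\<close> is the identity minus the operator
  iterated here. That operator lowers the degree in \<open>t\<close>, so on forms of degree
  \<open>d\<close> its power \<open>d + 1\<close> vanishes, and the inverse is polynomial in
  \<open>s\<close>.\<close>

definition T_inv :: "nat \<Rightarrow> nat \<Rightarrow> real \<Rightarrow> (nat, real) mpoly \<Rightarrow> (nat, real) mpoly" where
  "T_inv d i s p = (\<Sum>k\<le>d. ((\<lambda>p. mconst (- s) * mvar i * mpderiv 0 p) ^^ k) p)"

lemma T_inv_T_op:
  assumes i: "i \<noteq> 0" and p: "\<And>m. m \<in> keys p \<Longrightarrow> lookup m 0 \<le> d"
  shows "T_inv d i s (T_op (mvar i) s p) = p"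
proof -
  define B where "B p = mconst (- s) * mvar i * mpderiv 0 p" for p :: "(nat, real) mpoly"
  have neg: "mconst (- s) = (- mconst s :: (nat, real) mpoly)" by (simp add: mconst_def single_uminus)
  have B_add: "B (p + q) = B p + B q" for p q by (simp add: B_def mpderiv_add distrib_left)
  have B_pow_add: "(B ^^ k) (p + q) = (B ^^ k) p + (B ^^ k) q" for k p q
    by (induction k) (auto simp: B_add)
  have B0: "B 0 = 0" by (simp add: B_def mpderiv_zero)
  have B_uminus: "B (- p) = - B p" for p
    using B_add[of "- p" p] by (simp add: B0 eq_neg_iff_add_eq_0)
  have B_pow_uminus: "(B ^^ k) (- p) = - (B ^^ k) p" for k p
    by (induction k) (auto simp: B_uminus)
  have T: "T_op (mvar i) s p = p + (- B p)" by (simp add: T_op_def B_def neg)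
  have tdeg: "lookup m 0 + k \<le> d" if "m \<in> keys ((B ^^ k) p)" for m k
    using that
  proof (induction k arbitrary: m)
    case 0 then show ?case using p by simp
  next
    case (Suc k)
    then have "m \<in> keys (mconst (- s) * mvar i * mpderiv 0 ((B ^^ k) p))" by (simp add: B_def[of "(B ^^ k) p"])
    then obtain u v where uv: "m = u + v" "u \<in> keys (mconst (- s) * mvar i :: (nat, real) mpoly)"
      "v \<in> keys (mpderiv 0 ((B ^^ k) p))"
      using keys_mult[of "mconst (- s) * mvar i" "mpderiv 0 ((B ^^ k) p)"] by auto
    have "u = single i 1" using uv(2) by (auto simp: mconst_def mvar_def mult_single split: if_splits)
    then have "lookup m 0 = lookup v 0" using uv(1) i by (simp add: lookup_add lookup_single)
    moreover have "v + single 0 1 \<in> keys ((B ^^ k) p)" using uv(3) by (auto simp: in_keys_iff lookup_mpderiv)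
    from Suc.IH[OF this] have "lookup v 0 + 1 + k \<le> d" by (simp add: lookup_add)
    ultimately show ?case by simp
  qed
  have "(B ^^ Suc d) p = 0"
  proof (rule ccontr)
    assume "(B ^^ Suc d) p \<noteq> 0"
    then obtain m where "m \<in> keys ((B ^^ Suc d) p)" using keys_eq_empty by blast
    from tdeg[OF this] show False by simp
  qed
  have "T_inv d i s (T_op (mvar i) s p) = (\<Sum>k\<le>d. (B ^^ k) p - (B ^^ Suc k) p)"
    unfolding T_inv_def B_def[symmetric] T B_pow_add B_pow_uminus
    by (intro sum.cong refl) (simp add: funpow_swap1)
  also have "\<dots> = (B ^^ 0) p - (B ^^ Suc d) p" by (rule sum_telescope)
  finally show ?thesis using \<open>(B ^^ Suc d) p = 0\<close> by simp
qed

text \<open>\<open>F_list\<close> applies the head of its list last, so the head is undone before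
  the tail.\<close>

primrec F_inv :: "nat \<Rightarrow> real \<Rightarrow> nat list \<Rightarrow> (nat, real) mpoly \<Rightarrow> (nat, real) mpoly" where
  "F_inv d s [] q = q"
| "F_inv d s (i # is) q = F_inv d s is ((T_inv d i s ^^ d) q)"

lemma F_inv_F_list:
  assumes "p \<in> FR n d" "d \<ge> 1" "set is \<subseteq> {1..n}"
  shows "F_list d s is p \<in> FR n d \<and> F_inv d s is (F_list d s is p) = p"
  using assms(3)
proof (induction "is")
  case Nil then show ?case using assms(1) by simp
next
  case (Cons i "is")
  then have IH: "F_list d s is p \<in> FR n d" "F_inv d s is (F_list d s is p) = p" and i: "i \<in> {1..n}" by auto
  have T: "(T_op (mvar i) s ^^ k) q \<in> FR n d \<and> (T_inv d i s ^^ k) ((T_op (mvar i) s ^^ k) q) = q"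
    if "q \<in> FR n d" for k q
  proof (induction k)
    case 0 then show ?case using that by simp
  next
    case (Suc k)
    let ?r = "(T_op (mvar i) s ^^ k) q"
    have r: "?r \<in> FR n d" using Suc by simp
    have "T_inv d i s (T_op (mvar i) s ?r) = ?r"
    proof (rule T_inv_T_op)
      show "lookup m 0 \<le> d" if "m \<in> keys ?r" for m
        using r that lookup_le_mdeg[of m 0] by (auto simp: FR_def)
    qed (use i in simp)
    then have "(T_inv d i s ^^ Suc k) ((T_op (mvar i) s ^^ Suc k) q) = q"
      using Suc by (simp add: funpow_swap1[of "T_inv d i s"]) 
    then show ?case using FR_T_op[OF r assms(2) i] by simp
  qed
  show ?case using T[OF IH(1), of d] IH(2) by simp
qed

lemma poly_family_F_inv:
  assumes "polyfun V f" "poly_family V P" shows "poly_family V (\<lambda>x. F_inv d (f x) is (P x))"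
proof -
  have B: "poly_family V (\<lambda>x. ((\<lambda>p. mconst (- f x) * mvar i * mpderiv 0 p) ^^ k) (P x))"
    if "poly_family V P" for i k P
    using that
  proof (induction k)
    case (Suc k)
    then show ?case unfolding funpow.simps comp_def
      by (intro poly_family_mult poly_family_mconst poly_family_mpderiv polyfun_uminus assms(1) poly_family_const[of V "mvar i"])
  qed simp
  have "poly_family V (\<lambda>x. T_inv d i (f x) (P x))" if "poly_family V P" for i P
    unfolding T_inv_def by (intro poly_family_sum B that)
  then have T: "poly_family V (\<lambda>x. (T_inv d i (f x) ^^ k) (P x))" if "poly_family V P" for i k P
    using that by (induction k) auto
  show ?thesis using assms(2) by (induction "is" arbitrary: P) (auto intro: T)
qed

section \<open>Polynomials with a nonreal singular point lie in a hypersurface\<close>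

text \<open>The two lowest coefficients enter with the factors \<open>1\<close> and
  \<open>\<i>\<close>, a real basis of the complex numbers.\<close>

lemma solve_simple_zero:
  fixes g :: "nat \<Rightarrow> real"
  assumes "D \<ge> 1" "(\<Sum>a\<le>D. of_real (g a) * \<i> ^ a) = 0"
  shows "g 0 = - Re (\<Sum>a\<in>{2..D}. of_real (g a) * \<i> ^ a)" "g 1 = - Im (\<Sum>a\<in>{2..D}. of_real (g a) * \<i> ^ a)"
proof -
  have "{..D} = {0, 1} \<union> {2..D}" using assms(1) by auto
  then have "(\<Sum>a\<le>D. of_real (g a) * \<i> ^ a) = of_real (g 0) + of_real (g 1) * \<i> + (\<Sum>a\<in>{2..D}. of_real (g a) * \<i> ^ a)"
    by (simp add: sum.union_disjoint)
  then have *: "of_real (g 0) + of_real (g 1) * \<i> + (\<Sum>a\<in>{2..D}. of_real (g a) * \<i> ^ a) = 0" using assms(2) by simp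
  from arg_cong[OF *, of Re] arg_cong[OF *, of Im]
  show "g 0 = - Re (\<Sum>a\<in>{2..D}. of_real (g a) * \<i> ^ a)" "g 1 = - Im (\<Sum>a\<in>{2..D}. of_real (g a) * \<i> ^ a)"
    by simp_all
qed

text \<open>A real polynomial with a double zero at \<open>\<i>\<close> is divisible by the square
  of \<open>x\<^sup>2 + 1\<close>, so its coefficients from index \<open>4\<close> on determine the
  four lowest. Concretely, the real and imaginary parts of the two equations form an invertible
  system for \<open>b 0\<close> to \<open>b 3\<close>.\<close>

lemma solve_double_zero:
  fixes b :: "nat \<Rightarrow> real"
  assumes "D \<ge> 3" "(\<Sum>a\<le>D. of_real (b a) * \<i> ^ a) = 0"
    "(\<Sum>a\<le>D - 1. of_real (real (Suc a) * b (Suc a)) * \<i> ^ a) = 0"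
  defines "S \<equiv> \<Sum>a\<in>{4..D}. of_real (b a) * \<i> ^ a"
    and "T \<equiv> \<Sum>a\<in>{3..D - 1}. of_real (real (Suc a) * b (Suc a)) * \<i> ^ a"
  shows "b 0 = - Im T / 2 - Re S" "b 1 = (Re T - Im S) / 2 - Im S" "b 2 = - Im T / 2" "b 3 = (Re T - Im S) / 2"
proof -
  have "{..D} = {0, 1, 2, 3} \<union> {4..D}" using assms(1) by auto
  then have "(\<Sum>a\<le>D. of_real (b a) * \<i> ^ a) =
      of_real (b 0) + of_real (b 1) * \<i> + of_real (b 2) * \<i> ^ 2 + of_real (b 3) * \<i> ^ 3 + S"
    unfolding S_def by (simp add: sum.union_disjoint)
  then have 1: "of_real (b 0) + of_real (b 1) * \<i> + of_real (b 2) * \<i> ^ 2 + of_real (b 3) * \<i> ^ 3 + S = 0"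
    using assms(2) by simp
  have "{..D - 1} = {0, 1, 2} \<union> {3..D - 1}" using assms(1) by auto
  then have "(\<Sum>a\<le>D - 1. of_real (real (Suc a) * b (Suc a)) * \<i> ^ a) =
      of_real (b 1) + of_real (2 * b 2) * \<i> + of_real (3 * b 3) * \<i> ^ 2 + T"
    unfolding T_def by (simp add: sum.union_disjoint numeral_2_eq_2 numeral_3_eq_3)
  then have 2: "of_real (b 1) + of_real (2 * b 2) * \<i> + of_real (3 * b 3) * \<i> ^ 2 + T = 0"
    using assms(3) by simp
  have i3: "\<i> ^ 3 = - \<i>" by (simp add: power3_eq_cube)
  have "b 0 - b 2 + Re S = 0" "b 1 - b 3 + Im S = 0"
    using arg_cong[OF 1, of Re] arg_cong[OF 1, of Im] by (simp_all add: i3)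
  moreover have "b 1 - 3 * b 3 + Re T = 0" "2 * b 2 + Im T = 0"
    using arg_cong[OF 2, of Re] arg_cong[OF 2, of Im] by simp_all
  ultimately show "b 0 = - Im T / 2 - Re S" "b 1 = (Re T - Im S) / 2 - Im S" "b 2 = - Im T / 2" "b 3 = (Re T - Im S) / 2"
    by (auto simp: field_simps)
qed

section \<open>Determined and free coefficients at the standard point\<close>

definition mono2 :: "nat \<Rightarrow> nat \<Rightarrow> nat \<Rightarrow> nat \<Rightarrow> nat \<Rightarrow>\<^sub>0 nat" where
  "mono2 i j d a = single i (d - a) + single j a"

text \<open>For \<open>k\<close> other than \<open>i\<close> and \<open>j\<close> these are the
  monomials of degree \<open>d\<close> whose derivative with respect to \<open>k\<close> does not
  vanish at \<open>std_point i j\<close>.\<close>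

definition mono3 :: "nat \<Rightarrow> nat \<Rightarrow> nat \<Rightarrow> nat \<Rightarrow> nat \<Rightarrow> nat \<Rightarrow>\<^sub>0 nat" where
  "mono3 i j d k a = mono2 i j (d - 1) a + single k 1"

text \<open>The coefficients that a singularity at \<open>std_point i j\<close> determines.\<close>

definition determined :: "nat \<Rightarrow> nat \<Rightarrow> nat \<Rightarrow> nat \<Rightarrow> (nat \<Rightarrow>\<^sub>0 nat) set" where
  "determined n d i j = mono2 i j d ` {..3} \<union> (\<lambda>(k, a). mono3 i j d k a) ` (({0..n} - {i, j}) \<times> {..1})"

lemma determinedE:
  assumes "m \<in> determined n d i j"
  obtains a where "a \<le> 3" "m = mono2 i j d a"
    | k a where "k \<in> {0..n} - {i, j}" "a \<le> 1" "m = mono3 i j d k a"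
proof -
  consider "m \<in> mono2 i j d ` {..3}" | "m \<in> (\<lambda>(k, a). mono3 i j d k a) ` (({0..n} - {i, j}) \<times> {..1})"
    using assms unfolding determined_def by blast
  then show ?thesis
  proof cases
    case 1
    then obtain a where "a \<in> {..3}" "m = mono2 i j d a" by (rule imageE) 
    then show ?thesis using that(1) by simp
  next
    case 2
    then obtain ka where ka: "ka \<in> ({0..n} - {i, j}) \<times> {..1}" "m = (\<lambda>(k, a). mono3 i j d k a) ka" by (rule imageE)
    then obtain k a where "ka = (k, a)" "k \<in> {0..n} - {i, j}" "a \<in> {..1}" by (elim SigmaE)
    then show ?thesis using that(2)[of k a] ka(2) by simp
  qed
qed

text \<open>The value and the derivatives in \<open>j\<close> and in the \<open>k\<close> make
  \<open>n + 1\<close> complex equations; by Euler's relation the derivative in \<open>i\<close>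
  follows from the value and the derivative in \<open>j\<close>. The first two equations share their
  unknowns, and otherwise different equations involve different coefficients.\<close>

lemma singular_std_point_equations:
  assumes r: "r \<in> FR n d" "singular_point n r (std_point i j)" and ij: "i \<in> {1..n}" "j \<in> {1..n}" "i \<noteq> j" and d: "d \<ge> 3"
  shows "(\<Sum>a\<le>d. of_real (lookup r (mono2 i j d a)) * \<i> ^ a) = 0"
    "(\<Sum>a\<le>d - 1. of_real (real (Suc a) * lookup r (mono2 i j d (Suc a))) * \<i> ^ a) = 0"
    "k \<in> {0..n} - {i, j} \<Longrightarrow> (\<Sum>a\<le>d - 1. of_real (lookup r (mono3 i j d k a)) * \<i> ^ a) = 0"
proof -
  have h: "homogeneous d r" using r(1) by (simp add: FR_iff)
  note E = eval_complex_std_point[OF ij(3)]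
  show "(\<Sum>a\<le>d. of_real (lookup r (mono2 i j d a)) * \<i> ^ a) = 0"
    using r(2) E[OF h] by (simp add: singular_point_def mono2_def)
  have "eval_complex (mpderiv j r) (std_point i j) = 0" using r(2) ij by (simp add: singular_point_def)
  moreover have "lookup (mpderiv j r) (single i (d - 1 - a) + single j a) = real (Suc a) * lookup r (mono2 i j d (Suc a))" for a
    using ij(3) by (simp add: lookup_mpderiv lookup_add lookup_single mono2_def add.assoc single_add[symmetric] del: of_nat_Suc)
  ultimately show "(\<Sum>a\<le>d - 1. of_real (real (Suc a) * lookup r (mono2 i j d (Suc a))) * \<i> ^ a) = 0"
    using E[OF homogeneous_mpderiv[OF h]] by simp
  assume k: "k \<in> {0..n} - {i, j}"
  then have "eval_complex (mpderiv k r) (std_point i j) = 0" using r(2) by (simp add: singular_point_def)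
  moreover have "lookup (mpderiv k r) (single i (d - 1 - a) + single j a) = lookup r (mono3 i j d k a)" for a
    using k by (simp add: lookup_mpderiv lookup_add lookup_single mono2_def mono3_def)
  ultimately show "(\<Sum>a\<le>d - 1. of_real (lookup r (mono3 i j d k a)) * \<i> ^ a) = 0"
    using E[OF homogeneous_mpderiv[OF h]] by simp
qed

lemma lookup_mono2: "i \<noteq> j \<Longrightarrow> lookup (mono2 i j d a) v = (if v = i then d - a else if v = j then a else 0)"
  by (auto simp: mono2_def lookup_add lookup_single when_def)

lemma lookup_mono3:
  "i \<noteq> j \<Longrightarrow> k \<noteq> i \<Longrightarrow> k \<noteq> j \<Longrightarrow>
    lookup (mono3 i j d k a) v = (if v = i then d - 1 - a else if v = j then a else if v = k then 1 else 0)"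
  by (auto simp: mono3_def lookup_add lookup_mono2 lookup_single when_def)

lemma keys_subset_iff: "keys m \<subseteq> V \<longleftrightarrow> (\<forall>v. v \<notin> V \<longrightarrow> lookup m v = 0)"
  by (auto simp: in_keys_iff)

lemma mono2_coord:
  assumes "i \<in> {1..n}" "j \<in> {1..n}" "i \<noteq> j" "a \<le> d" "d \<ge> 1"
  shows "mono2 i j d a \<in> coord_monomials n d"
proof -
  have "mdeg (mono2 i j d a) = d" using assms by (simp add: mono2_def mdeg_add)
  moreover have "mono2 i j d a \<noteq> single 0 d"
  proof
    assume "mono2 i j d a = single 0 d"
    then have "lookup (mono2 i j d a) 0 = d" by simp
    then show False using assms by (auto simp: lookup_mono2)
  qed
  ultimately show ?thesis using assms by (auto simp: coord_monomials_def keys_subset_iff lookup_mono2)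
qed

lemma mono3_coord:
  assumes "i \<in> {1..n}" "j \<in> {1..n}" "i \<noteq> j" "a \<le> d - 1" "d \<ge> 2" "k \<in> {0..n} - {i, j}"
  shows "mono3 i j d k a \<in> coord_monomials n d"
proof -
  have "mdeg (mono3 i j d k a) = d" using assms by (simp add: mono3_def mono2_def mdeg_add)
  moreover have "mono3 i j d k a \<noteq> single 0 d"
  proof
    assume "mono3 i j d k a = single 0 d"
    then have "lookup (mono3 i j d k a) 0 = d" by simp
    then show False using assms by (auto simp: lookup_mono3 split: if_splits)
  qed
  ultimately show ?thesis using assms by (auto simp: coord_monomials_def keys_subset_iff lookup_mono3)
qed

lemma determined_coord:
  assumes "i \<in> {1..n}" "j \<in> {1..n}" "i \<noteq> j" "d \<ge> 3"
  shows "determined n d i j \<subseteq> coord_monomials n d"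
  using assms unfolding determined_def by (auto intro!: mono2_coord mono3_coord)

text \<open>Together with its counterpart for \<open>mono3\<close> this ensures that the solved
  equations express the determined coefficients through the remaining ones only.\<close>

lemma mono2_not_determined:
  assumes "i \<noteq> j" "a \<ge> 4"
  shows "mono2 i j d a \<notin> determined n d i j"
proof
  assume "mono2 i j d a \<in> determined n d i j"
  then consider b where "b \<le> 3" "mono2 i j d a = mono2 i j d b"
    | k b where "k \<in> {0..n} - {i, j}" "mono2 i j d a = mono3 i j d k b"
    by (elim determinedE)
  then show False
  proof cases
    case 1
    from arg_cong[OF 1(2), of "\<lambda>m. lookup m j"] show ?thesis using 1(1) assms by (simp add: lookup_mono2)
  next
    case 2
    from arg_cong[OF 2(2), of "\<lambda>m. lookup m k"] show ?thesis
      using 2(1) assms by (auto simp: lookup_mono2 lookup_mono3)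
  qed
qed

lemma mono3_not_determined:
  assumes "i \<noteq> j" "a \<ge> 2" "k \<in> {0..n} - {i, j}"
  shows "mono3 i j d k a \<notin> determined n d i j"
proof
  assume "mono3 i j d k a \<in> determined n d i j"
  then consider b where "mono3 i j d k a = mono2 i j d b"
    | l b where "l \<in> {0..n} - {i, j}" "b \<le> 1" "mono3 i j d k a = mono3 i j d l b"
    by (elim determinedE)
  then show False
  proof cases
    case 1
    from arg_cong[OF 1, of "\<lambda>m. lookup m k"] show ?thesis using assms by (auto simp: lookup_mono2 lookup_mono3)
  next
    case 2
    from arg_cong[OF 2(3), of "\<lambda>m. lookup m j"] show ?thesis using 2(1,2) assms by (auto simp: lookup_mono3)
  qed
qed

text \<open>Four monomials in the variables \<open>i\<close> and \<open>j\<close>, and two for each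
  of the \<open>n - 1\<close> other variables, \<open>t\<close> included.\<close>

lemma card_determined:
  assumes "i \<in> {1..n}" "j \<in> {1..n}" "i \<noteq> j"
  shows "finite (determined n d i j)" "card (determined n d i j) = 2 * n + 2"
proof -
  let ?A = "mono2 i j d ` {..3}" and ?K = "({0..n} - {i, j}) \<times> {..1::nat}"
  let ?B = "(\<lambda>(k, a). mono3 i j d k a) ` ?K"
  show "finite (determined n d i j)" by (simp add: determined_def)
  have "inj_on (mono2 i j d) {..3}"
  proof (rule inj_onI)
    fix a b assume "mono2 i j d a = mono2 i j d b"
    then have "lookup (mono2 i j d a) j = lookup (mono2 i j d b) j" by simp
    then show "a = b" using assms(3) by (simp add: lookup_mono2)
  qed
  then have A: "card ?A = 4" by (simp add: card_image)
  have inj: "inj_on (\<lambda>(k, a). mono3 i j d k a) ?K"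
  proof (rule inj_onI)
    fix x y assume xy: "x \<in> ?K" "y \<in> ?K" "(\<lambda>(k, a). mono3 i j d k a) x = (\<lambda>(k, a). mono3 i j d k a) y"
    obtain k a l b where kl: "x = (k, a)" "y = (l, b)" by (cases x; cases y) blast
    have eq: "mono3 i j d k a = mono3 i j d l b" using xy(3) by (simp add: kl)
    have ne: "k \<noteq> i" "k \<noteq> j" "l \<noteq> i" "l \<noteq> j" using xy(1,2) by (auto simp: kl)
    from arg_cong[OF eq, of "\<lambda>m. lookup m k"] arg_cong[OF eq, of "\<lambda>m. lookup m j"] show "x = y"
      using ne assms(3) by (auto simp: lookup_mono3 kl split: if_splits)
  qed
  have B: "card ?B = 2 * (n - 1)"
  proof -
    have "card ?B = card ?K" using inj by (rule card_image)
    also have "\<dots> = card ({0..n} - {i, j}) * 2" by simp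
    also have "card ({0..n} - {i, j}) = n - 1" using assms by (subst card_Diff_subset) auto
    finally show ?thesis by simp
  qed
  have "?A \<inter> ?B = {}"
  proof -
    have "mono2 i j d a \<noteq> mono3 i j d k b" if "k \<noteq> i" "k \<noteq> j" for a k b
    proof
      assume eq: "mono2 i j d a = mono3 i j d k b"
      from arg_cong[OF eq, of "\<lambda>m. lookup m k"] show False
        using that assms(3) by (simp add: lookup_mono2 lookup_mono3)
    qed
    then show ?thesis by fastforce
  qed
  then have "card (?A \<union> ?B) = card ?A + card ?B" by (intro card_Un_disjoint finite_imageI) simp_all
  then have "card (determined n d i j) = 4 + 2 * (n - 1)" unfolding determined_def A B .
  moreover have "n \<ge> 1" using assms by simp
  ultimately show "card (determined n d i j) = 2 * n + 2" by simp
qed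

text \<open>The variable \<open>Inl m\<close> is the coefficient of \<open>m\<close>; \<open>Inr (2 v)\<close> and \<open>Inr (2 v + 1)\<close> are the two
  coefficients of \<open>linear_change\<close> at \<open>v\<close>, except that \<open>Inr (2 i)\<close>, whose coefficient is \<open>1\<close>, holds the
  parameter of \<open>F_op\<close>.\<close>

definition parameters :: "nat \<Rightarrow> nat \<Rightarrow> nat \<Rightarrow> nat \<Rightarrow> ((nat \<Rightarrow>\<^sub>0 nat) + nat) set" where
  "parameters n d i j = Inl ` (coord_monomials n d - determined n d i j) \<union> Inr ` ({..2 * n + 1} - {2 * i + 1})"

text \<open>The balance on which the codimension rests: \<open>2 n + 2\<close> coefficients are
  lost, while \<open>2 n\<close> entries of the linear change and one parameter of
  \<open>F_op\<close> are gained.\<close>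

lemma card_parameters:
  assumes "i \<in> {1..n}" "j \<in> {1..n}" "i \<noteq> j" "d \<ge> 3"
  shows "finite (parameters n d i j)" "card (parameters n d i j) < card (coord_monomials n d)"
proof -
  let ?I = "coord_monomials n d" and ?D = "determined n d i j"
  show "finite (parameters n d i j)" using finite_coord_monomials by (simp add: parameters_def)
  have le: "2 * n + 2 \<le> card ?I"
    using card_mono[OF finite_coord_monomials determined_coord[OF assms]] card_determined(2)[OF assms(1-3)] by simp
  have "card (parameters n d i j) = card (Inl ` (?I - ?D) :: ((nat \<Rightarrow>\<^sub>0 nat) + nat) set) +
      card (Inr ` ({..2 * n + 1} - {2 * i + 1}) :: ((nat \<Rightarrow>\<^sub>0 nat) + nat) set)"
    unfolding parameters_def using finite_coord_monomials by (intro card_Un_disjoint) auto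
  also have "card (Inl ` (?I - ?D) :: ((nat \<Rightarrow>\<^sub>0 nat) + nat) set) = card ?I - (2 * n + 2)"
    using card_determined[OF assms(1-3)] determined_coord[OF assms] by (simp add: card_image card_Diff_subset)
  also have "card (Inr ` ({..2 * n + 1} - {2 * i + 1}) :: ((nat \<Rightarrow>\<^sub>0 nat) + nat) set) = 2 * n + 1"
    using assms(1) by (simp add: card_image)
  finally show "card (parameters n d i j) < card ?I" using le by simp
qed

lemma polyfun_Re_Im_sum:
  assumes "\<And>a. a \<in> A \<Longrightarrow> polyfun V (\<lambda>y. f y a)"
  shows "polyfun V (\<lambda>y. Re (\<Sum>a\<in>A. of_real (f y a) * \<i> ^ a))" "polyfun V (\<lambda>y. Im (\<Sum>a\<in>A. of_real (f y a) * \<i> ^ a))"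
proof -
  have "complex_polyfun V (\<lambda>y. \<Sum>a\<in>A. of_real (f y a) * \<i> ^ a)"
    by (intro complex_polyfun_sum complex_polyfun_mult complex_polyfun_of_real complex_polyfun_const assms)
  then show "polyfun V (\<lambda>y. Re (\<Sum>a\<in>A. of_real (f y a) * \<i> ^ a))" "polyfun V (\<lambda>y. Im (\<Sum>a\<in>A. of_real (f y a) * \<i> ^ a))"
    by (simp_all add: complex_polyfun_def)
qed

text \<open>The function \<open>\<phi>\<close> depends on the monomial but not on \<open>r\<close>:
  one polynomial expression recovers the coefficient for all \<open>r\<close> that are singular at
  the standard point.\<close>

lemma coefficient_polyfun:
  assumes ij: "i \<in> {1..n}" "j \<in> {1..n}" "i \<noteq> j" and d: "d \<ge> 3" and m: "m \<in> coord_monomials n d"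
  shows "\<exists>\<phi>. polyfun (parameters n d i j) \<phi> \<and>
    (\<forall>r y. r \<in> FR n d \<longrightarrow> singular_point n r (std_point i j) \<longrightarrow>
      (\<forall>m\<in>coord_monomials n d - determined n d i j. y (Inl m) = lookup r m) \<longrightarrow> lookup r m = \<phi> y)"
proof (cases "m \<in> determined n d i j")
  case False
  then have "polyfun (parameters n d i j) (\<lambda>y. y (Inl m))"
    using m by (intro polyfun.var) (auto simp: parameters_def)
  then show ?thesis using False m by (intro exI[of _ "\<lambda>y. y (Inl m)"]) auto
next
  case True
  let ?V = "parameters n d i j"
  define b where "b y a = y (Inl (mono2 i j d a))" for y :: "(nat \<Rightarrow>\<^sub>0 nat) + nat \<Rightarrow> real" and a
  define g where "g y k a = y (Inl (mono3 i j d k a))" for y :: "(nat \<Rightarrow>\<^sub>0 nat) + nat \<Rightarrow> real" and k a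
  have b_free: "mono2 i j d a \<in> coord_monomials n d - determined n d i j" if "4 \<le> a" "a \<le> d" for a
    using that ij d mono2_not_determined[OF ij(3)] mono2_coord[OF ij] by auto
  have g_free: "mono3 i j d k a \<in> coord_monomials n d - determined n d i j"
    if "2 \<le> a" "a \<le> d - 1" "k \<in> {0..n} - {i, j}" for k a
    using that ij d mono3_not_determined[OF ij(3)] mono3_coord[OF ij] by auto
  have pb: "polyfun ?V (\<lambda>y. b y a)" if "4 \<le> a" "a \<le> d" for a
    unfolding b_def using b_free[OF that] by (intro polyfun.var) (auto simp: parameters_def)
  have pg: "polyfun ?V (\<lambda>y. g y k a)" if "2 \<le> a" "a \<le> d - 1" "k \<in> {0..n} - {i, j}" for k a
    unfolding g_def using g_free[OF that] by (intro polyfun.var) (auto simp: parameters_def)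
  consider a where "a \<le> 3" "m = mono2 i j d a"
    | k a where "k \<in> {0..n} - {i, j}" "a \<le> 1" "m = mono3 i j d k a"
    using True by (elim determinedE)
  then show ?thesis
  proof cases
    case 1
    define S where "S y = (\<Sum>a\<in>{4..d}. of_real (b y a) * \<i> ^ a)" for y
    define T where "T y = (\<Sum>a\<in>{3..d - 1}. of_real (real (Suc a) * b y (Suc a)) * \<i> ^ a)" for y
    have pS: "polyfun ?V (\<lambda>y. Re (S y))" "polyfun ?V (\<lambda>y. Im (S y))"
      unfolding S_def by (rule polyfun_Re_Im_sum; use pb in simp)+
    have pT: "polyfun ?V (\<lambda>y. Re (T y))" "polyfun ?V (\<lambda>y. Im (T y))"
      unfolding T_def using d by (intro polyfun_Re_Im_sum polyfun.mult polyfun.const pb; auto)+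
    define \<phi> where "\<phi> y = (if a = 0 then (-1 / 2) * Im (T y) - Re (S y)
      else if a = 1 then (1 / 2) * (Re (T y) - Im (S y)) - Im (S y)
      else if a = 2 then (-1 / 2) * Im (T y) else (1 / 2) * (Re (T y) - Im (S y)))" for y
    have "polyfun ?V \<phi>" unfolding \<phi>_def
      by (intro polyfun_if polyfun_diff polyfun.mult polyfun.const pS pT)
    moreover have "lookup r m = \<phi> y"
      if r: "r \<in> FR n d" "singular_point n r (std_point i j)"
        and y: "\<forall>m\<in>coord_monomials n d - determined n d i j. y (Inl m) = lookup r m" for r y
    proof -
      let ?b = "\<lambda>a. lookup r (mono2 i j d a)"
      have bb: "b y a = ?b a" if "4 \<le> a" "a \<le> d" for a
        unfolding b_def using y b_free[OF that] by blast
      have S: "S y = (\<Sum>a\<in>{4..d}. of_real (?b a) * \<i> ^ a)"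
        unfolding S_def by (intro sum.cong refl) (simp add: bb)
      have T: "T y = (\<Sum>a\<in>{3..d - 1}. of_real (real (Suc a) * ?b (Suc a)) * \<i> ^ a)"
        unfolding T_def using d by (intro sum.cong refl) (auto simp: bb)
      note s = solve_double_zero[OF d singular_std_point_equations(1,2)[OF r ij d], folded S T]
      have "a \<in> {0, 1, 2, 3}" using 1(1) by auto
      then show ?thesis using s unfolding 1(2) \<phi>_def by auto
    qed
    ultimately show ?thesis by blast
  next
    case 2
    define S where "S y = (\<Sum>a\<in>{2..d - 1}. of_real (g y k a) * \<i> ^ a)" for y
    have pS: "polyfun ?V (\<lambda>y. Re (S y))" "polyfun ?V (\<lambda>y. Im (S y))"
      unfolding S_def by (rule polyfun_Re_Im_sum; use pg 2(1) in simp)+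
    define \<phi> where "\<phi> y = (if a = 0 then - Re (S y) else - Im (S y))" for y
    have "polyfun ?V \<phi>" unfolding \<phi>_def by (intro polyfun_if polyfun_uminus pS)
    moreover have "lookup r m = \<phi> y"
      if r: "r \<in> FR n d" "singular_point n r (std_point i j)"
        and y: "\<forall>m\<in>coord_monomials n d - determined n d i j. y (Inl m) = lookup r m" for r y
    proof -
      have gy: "g y k a = lookup r (mono3 i j d k a)" if "2 \<le> a" "a \<le> d - 1" for a
        unfolding g_def using y g_free[OF that 2(1)] by blast
      have S: "S y = (\<Sum>a\<in>{2..d - 1}. of_real (lookup r (mono3 i j d k a)) * \<i> ^ a)"
        unfolding S_def by (intro sum.cong refl) (simp add: gy)
      have d1: "d - 1 \<ge> 1" using d by simp
      note s = solve_simple_zero[OF d1 singular_std_point_equations(3)[OF r ij d 2(1)], folded S]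
      have "a \<in> {0, 1}" using 2(2) by auto
      then show ?thesis using s unfolding 2(3) \<phi>_def by auto
    qed
    ultimately show ?thesis by blast
  qed
qed

text \<open>The passage from \<open>p\<close> to the standard position is traversed backwards:
  \<open>R\<close> restores the moved polynomial from its free coefficients, then the linear change
  is undone by \<open>L\<close> and the operator by \<open>F_inv\<close>. Every stage is polynomial
  in the parameters, so \<open>Q\<close> is a polynomial map that hits every such
  \<open>p\<close>.\<close>

lemma singular_pair_hypersurface:
  assumes ij: "i \<in> {1..n}" "j \<in> {1..n}" "i \<noteq> j" and d: "d \<ge> 3"
  obtains F where "F \<in> mpolys_in (coord_monomials n d)" "F \<noteq> 0"
    "\<And>p \<tau> w. p \<in> FR n d \<Longrightarrow> hyperbolic p \<Longrightarrow> singular_point n (F_op n d \<tau> p) w \<Longrightarrow> w i = 1 \<Longrightarrow> Im (w j) \<noteq> 0 \<Longrightarrow>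
      mpoly_subst (\<lambda>c. c) (coords n d p) F = 0"
proof -
  let ?I = "coord_monomials n d" and ?V = "parameters n d i j"
  have "\<forall>m\<in>?I. \<exists>\<phi>. polyfun ?V \<phi> \<and> (\<forall>r y. r \<in> FR n d \<longrightarrow> singular_point n r (std_point i j) \<longrightarrow>
      (\<forall>m\<in>?I - determined n d i j. y (Inl m) = lookup r m) \<longrightarrow> lookup r m = \<phi> y)"
    by (intro ballI coefficient_polyfun assms)
  then obtain \<phi> where \<phi>: "\<forall>m\<in>?I. polyfun ?V (\<phi> m) \<and> (\<forall>r y. r \<in> FR n d \<longrightarrow> singular_point n r (std_point i j) \<longrightarrow>
      (\<forall>m\<in>?I - determined n d i j. y (Inl m) = lookup r m) \<longrightarrow> lookup r m = \<phi> m y)"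
    unfolding bchoice_iff by blast
  define A where "A y v = (if v = i then 1 else y (Inr (2 * v)))" for y :: "(nat \<Rightarrow>\<^sub>0 nat) + nat \<Rightarrow> real" and v
  define B where "B y v = (if v = i then 0 else y (Inr (2 * v + 1)))" for y :: "(nat \<Rightarrow>\<^sub>0 nat) + nat \<Rightarrow> real" and v
  \<comment> \<open>Beyond \<open>n\<close> the substitution is the identity, because
    \<open>parameters\<close> has no entries for such indices while \<open>poly_family_subst\<close>
    asks for a family at every index.\<close>
  define L where "L y v = (if v \<le> n then linear_change i j (A y) (B y) v else mvar v)" for y v
  define R where "R y = poly_of n d (\<lambda>m. \<phi> m y)" for y
  define Q where "Q y = F_inv d (y (Inr (2 * i))) [1..<Suc n] (mpoly_subst mconst (L y) (R y))" for y
  have Inr: "polyfun ?V (\<lambda>y. y (Inr k))" if "k \<le> 2 * n + 1" "k \<noteq> 2 * i + 1" for k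
    using that by (intro polyfun.var) (auto simp: parameters_def)
  have fL: "poly_family ?V (\<lambda>y. L y v)" for v
  proof (cases "v \<le> n")
    case True
    have "polyfun ?V (\<lambda>y. A y v)" "polyfun ?V (\<lambda>y. B y v)"
      using True unfolding A_def B_def by (cases "v = i"; auto intro!: polyfun.const Inr)+
    then show ?thesis using True unfolding L_def linear_change_def if_P[OF True]
      by (intro poly_family_add poly_family_mult poly_family_mconst poly_family_const)
  qed (simp add: L_def poly_family_const)
  have fR: "poly_family ?V R" unfolding R_def using \<phi> by (intro poly_family_poly_of) blast
  have fQ: "poly_family ?V Q" unfolding Q_def
    by (intro poly_family_F_inv poly_family_subst fL fR Inr) (use ij in auto)
  obtain F where F: "F \<in> mpolys_in ?I" "F \<noteq> 0" "\<And>y. mpoly_subst (\<lambda>c. c) (\<lambda>m. lookup (Q y) m) F = 0"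
  proof (rule polynomial_image_in_hypersurface[OF finite_coord_monomials card_parameters[OF ij d], where \<phi> = "\<lambda>m y. lookup (Q y) m"])
    show "polyfun ?V (\<lambda>y. lookup (Q y) m)" for m using fQ by (simp add: poly_family_def)
  qed (use that in blast)
  have "mpoly_subst (\<lambda>c. c) (coords n d p) F = 0"
    if p: "p \<in> FR n d" "hyperbolic p" and w: "singular_point n (F_op n d \<tau> p) w" "w i = 1" "Im (w j) \<noteq> 0" for p \<tau> w
  proof -
    define q where "q = F_op n d \<tau> p"
    have d1: "d \<ge> 1" using d by simp
    have q: "q \<in> FR n d" unfolding q_def by (rule F_op_hyperbolic(1)[OF p(1) d1 p(2)])
    then have qin: "q \<in> mpolys_in {0..n}" by (simp add: FR_iff)
    let ?a = "\<lambda>v. Re (w v)" and ?b = "\<lambda>v. Im (w v)"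
    define a' where "a' v = (if v = i then 1 else if v = j then - ?a j / ?b j else - ?a v + ?b v * ?a j / ?b j)" for v
    define b' where "b' v = (if v = i then 0 else if v = j then 1 / ?b j else - ?b v / ?b j)" for v
    define r where "r = mpoly_subst mconst (linear_change i j ?a ?b) q"
    have r: "r \<in> FR n d" "singular_point n r (std_point i j)"
      unfolding r_def by (rule singular_point_linear_change[OF q w(1)[folded q_def] ij])+
    have inv: "mpoly_subst mconst (linear_change i j a' b') (linear_change i j ?a ?b v) = mvar v" for v
      unfolding a'_def b'_def using w by (intro linear_change_inverse[OF ij(3)]) auto
    have rq: "mpoly_subst mconst (linear_change i j a' b') r = q"
      unfolding r_def mpoly_subst_mpoly_subst[OF semiring_hom_mconst] inv by (rule mpoly_subst_mconst_mvar)
    \<comment> \<open>The parameter point that produces \<open>p\<close>: the coefficients of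
      \<open>r\<close>, the columns of the inverse change, and \<open>\<tau>\<close> in the slot
      that \<open>a' i = 1\<close> leaves free.\<close>
    define y where "y v = (case v of Inl m \<Rightarrow> lookup r m
      | Inr k \<Rightarrow> if k = 2 * i then \<tau> else if even k then a' (k div 2) else b' (k div 2))" for v
    have yA: "A y = a'" by (rule ext) (auto simp: A_def y_def a'_def)
    have yB: "B y = b'"
    proof
      fix v
      have "2 * v + 1 \<noteq> 2 * i" by presburger
      then show "B y v = b' v" by (auto simp: B_def y_def b'_def)
    qed
    have "lookup r m = \<phi> m y" if "m \<in> ?I" for m
    proof -
      have "\<forall>m\<in>?I - determined n d i j. y (Inl m) = lookup r m" by (simp add: y_def)
      then show ?thesis using \<phi> that r by blast
    qed
    then have "lookup (R y) m = lookup (poly_of n d (coords n d r)) m" for m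
      by (simp add: R_def lookup_poly_of coords_def)
    then have "R y = r" using poly_of_coords[OF r(1)] by (intro poly_mapping_eqI) simp
    then have "mpoly_subst mconst (L y) (R y) = mpoly_subst mconst (linear_change i j a' b') r"
      using r(1) by (simp, intro mpoly_subst_cong[of r "{0..n}"]) (auto simp: L_def yA yB FR_iff)
    then have "Q y = F_inv d \<tau> [1..<Suc n] q" by (simp add: Q_def rq y_def del: upt_Suc)
    also have "\<dots> = p"
    proof -
      have "set [1..<Suc n] \<subseteq> {1..n}" by auto
      from F_inv_F_list[OF p(1) d1 this] show ?thesis unfolding q_def F_op_F_list by blast
    qed
    finally have "Q y = p" .
    have "mpoly_subst (\<lambda>c. c) (coords n d p) F = mpoly_subst (\<lambda>c. c) (\<lambda>m. lookup (Q y) m) F"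
      by (rule mpoly_subst_cong[OF F(1)]) (simp add: coords_def \<open>Q y = p\<close>)
    then show ?thesis by (simp add: F(3))
  qed
  with F(1,2) that show ?thesis by blast
qed

lemma singular_hypersurface:
  assumes "d \<ge> 1"
  obtains F where "F \<in> mpolys_in (coord_monomials n d)" "F \<noteq> 0"
    "\<And>p \<tau> z. p \<in> FR n d \<Longrightarrow> strictly_hyperbolic n p \<Longrightarrow> singular_point n (F_op n d \<tau> p) z \<Longrightarrow>
      mpoly_subst (\<lambda>c. c) (coords n d p) F = 0"
proof -
  let ?I = "coord_monomials n d"
  \<comment> \<open>Finitely many pairs of positions cover all nonreal singular points, so a product
    over them suffices. For \<open>d < 3\<close> the product is empty and equal to \<open>1\<close>;
    then \<open>strictly_hyperbolic_singular_degree\<close> leaves nothing to cover.\<close>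
  define K where "K = {(i, j). i \<in> {1..n} \<and> j \<in> {1..n} \<and> i \<noteq> j \<and> d \<ge> 3}"
  have "finite K" by (rule finite_subset[of _ "{1..n} \<times> {1..n}"]) (auto simp: K_def)
  have "\<forall>ij\<in>K. \<exists>F. F \<in> mpolys_in ?I \<and> F \<noteq> 0 \<and>
    (\<forall>p \<tau> w. p \<in> FR n d \<longrightarrow> hyperbolic p \<longrightarrow> singular_point n (F_op n d \<tau> p) w \<longrightarrow> w (fst ij) = 1 \<longrightarrow>
      Im (w (snd ij)) \<noteq> 0 \<longrightarrow> mpoly_subst (\<lambda>c. c) (coords n d p) F = (0::real))"
  proof
    fix ij assume "ij \<in> K"
    then have ij: "fst ij \<in> {1..n}" "snd ij \<in> {1..n}" "fst ij \<noteq> snd ij" "d \<ge> 3" by (auto simp: K_def)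
    show "\<exists>F. F \<in> mpolys_in ?I \<and> F \<noteq> 0 \<and>
      (\<forall>p \<tau> w. p \<in> FR n d \<longrightarrow> hyperbolic p \<longrightarrow> singular_point n (F_op n d \<tau> p) w \<longrightarrow> w (fst ij) = 1 \<longrightarrow>
        Im (w (snd ij)) \<noteq> 0 \<longrightarrow> mpoly_subst (\<lambda>c. c) (coords n d p) F = (0::real))"
      by (rule singular_pair_hypersurface[OF ij]) blast
  qed
  then obtain F where F: "\<forall>ij\<in>K. F ij \<in> mpolys_in ?I \<and> F ij \<noteq> 0 \<and>
    (\<forall>p \<tau> w. p \<in> FR n d \<longrightarrow> hyperbolic p \<longrightarrow> singular_point n (F_op n d \<tau> p) w \<longrightarrow> w (fst ij) = 1 \<longrightarrow>
      Im (w (snd ij)) \<noteq> 0 \<longrightarrow> mpoly_subst (\<lambda>c. c) (coords n d p) (F ij) = (0::real))"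
    unfolding bchoice_iff by blast
  have "(\<Prod>ij\<in>K. F ij) \<in> mpolys_in ?I" using F by (intro mpolys_in_prod) blast
  moreover have "(\<Prod>ij\<in>K. F ij) \<noteq> 0" using F \<open>finite K\<close> by (subst prod_zero_iff) auto
  moreover have "mpoly_subst (\<lambda>c. c) (coords n d p) (\<Prod>ij\<in>K. F ij) = 0"
    if p: "p \<in> FR n d" "strictly_hyperbolic n p" and z: "singular_point n (F_op n d \<tau> p) z" for p \<tau> z
  proof -
    have hyp: "hyperbolic p" using p(2) by (simp add: strictly_hyperbolic_def)
    have q: "F_op n d \<tau> p \<in> FR n d" "strictly_hyperbolic n (F_op n d \<tau> p)"
      by (rule F_op_hyperbolic(1)[OF p(1) assms hyp], rule strictly_hyperbolic_F_op'[OF p(1) assms p(2)])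
    obtain w i j where w: "singular_point n (F_op n d \<tau> p) w" "i \<in> {1..n}" "j \<in> {1..n}" "w i = 1" "Im (w j) \<noteq> 0"
      using strictly_hyperbolic_singular_point[OF q z] .
    have "d \<ge> 3" by (rule strictly_hyperbolic_singular_degree[OF q w(1,2,4)])
    moreover have "i \<noteq> j" using w(4,5) by auto
    ultimately have K: "(i, j) \<in> K" using w by (simp add: K_def)
    then have "mpoly_subst (\<lambda>c. c) (coords n d p) (F (i, j)) = 0" using F p(1) hyp w by fastforce
    moreover have "mpoly_subst (\<lambda>c. c) (coords n d p) (\<Prod>ij\<in>K. F ij) =
        (\<Prod>ij\<in>K. mpoly_subst (\<lambda>c. c) (coords n d p) (F ij))"
      by (rule semiring_hom_prod[OF semiring_hom_mpoly_subst[OF semiring_hom_id]])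
    ultimately show ?thesis using K \<open>finite K\<close> by (auto intro: prod_zero)
  qed
  ultimately show ?thesis using that by blast
qed

section \<open>Density\<close>

lemma convergent_subsequences:
  fixes f :: "'s \<Rightarrow> nat \<Rightarrow> complex"
  assumes "finite S" "\<And>s. s \<in> S \<Longrightarrow> bounded (range (f s))"
  shows "\<exists>r l. strict_mono (r :: nat \<Rightarrow> nat) \<and> (\<forall>s\<in>S. (f s \<circ> r) \<longlonglongrightarrow> l s)"
  using assms
proof (induction S rule: finite_induct)
  case empty
  show ?case by (intro exI[of _ id]) (auto simp: strict_mono_def)
next
  case (insert s S)
  have "\<exists>r l. strict_mono (r :: nat \<Rightarrow> nat) \<and> (\<forall>t\<in>S. (f t \<circ> r) \<longlonglongrightarrow> l t)"
    by (rule insert.IH) (use insert.prems in blast)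
  then obtain r l where r: "strict_mono (r :: nat \<Rightarrow> nat)" "\<forall>t\<in>S. (f t \<circ> r) \<longlonglongrightarrow> l t"
    by (elim exE conjE)
  have "bounded (range (f s \<circ> r))"
    using insert.prems[of s] by (auto intro: bounded_subset)
  then obtain x r' where r': "strict_mono (r' :: nat \<Rightarrow> nat)" "((f s \<circ> r) \<circ> r') \<longlonglongrightarrow> x"
    using bounded_imp_convergent_subsequence by blast
  have "(f t \<circ> (r \<circ> r')) \<longlonglongrightarrow> (l(s := x)) t" if "t \<in> insert s S" for t
  proof (cases "t = s")
    case True then show ?thesis using r'(2) by (simp add: comp_assoc)
  next
    case False
    then have "t \<in> S" using that by simp
    then have "((f t \<circ> r) \<circ> r') \<longlonglongrightarrow> l t" using r(2) r'(1) LIMSEQ_subseq_LIMSEQ by blast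
    then show ?thesis using False by (simp add: comp_assoc)
  qed
  then show ?case using strict_mono_o[OF r(1) r'(1)] by blast
qed

text \<open>The divided difference of a polynomial at \<open>z\<close> and \<open>w\<close>; it vanishes at a nonreal root and its
  conjugate as well as at a double root, and is continuous.\<close>

definition divided_difference :: "(nat \<Rightarrow> complex) \<Rightarrow> nat \<Rightarrow> complex \<Rightarrow> complex \<Rightarrow> complex" where
  "divided_difference c d z w = (\<Sum>j\<le>d. c j * (\<Sum>i<j. w ^ (j - Suc i) * z ^ i))"

lemma divided_difference_mult:
  "(z - w) * divided_difference c d z w = (\<Sum>j\<le>d. c j * z ^ j) - (\<Sum>j\<le>d. c j * w ^ j)"
proof -
  have "(z - w) * (c j * (\<Sum>i<j. w ^ (j - Suc i) * z ^ i)) = c j * z ^ j - c j * w ^ j" for j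
  proof -
    have "z ^ j - w ^ j = (z - w) * (\<Sum>i<j. w ^ (j - Suc i) * z ^ i)" by (rule power_diff_sumr2)
    then show ?thesis by (simp only: right_diff_distrib[symmetric] mult_ac)
  qed
  then show ?thesis
    unfolding divided_difference_def sum_subtractf[symmetric]
    by (subst sum_distrib_left) simp
qed

lemma divided_difference_diagonal:
  "divided_difference c d z z = (\<Sum>j\<le>d. of_nat j * c j * z ^ (j - 1))"
  unfolding divided_difference_def
proof (intro sum.cong refl)
  fix j
  have "(\<Sum>i<j. z ^ (j - Suc i) * z ^ i) = (\<Sum>i<j. z ^ (j - 1))"
    by (intro sum.cong refl) (simp add: power_add[symmetric])
  then show "c j * (\<Sum>i<j. z ^ (j - Suc i) * z ^ i) = of_nat j * c j * z ^ (j - 1)" by simp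
qed

lemma poly_eq_sum_coeff: "degree p \<le> d \<Longrightarrow> poly p (z::complex) = (\<Sum>j\<le>d. coeff p j * z ^ j)"
proof -
  assume "degree p \<le> d"
  then have "(\<Sum>j\<le>degree p. coeff p j * z ^ j) = (\<Sum>j\<le>d. coeff p j * z ^ j)"
    by (intro sum.mono_neutral_left) (auto simp: not_le coeff_eq_0)
  then show ?thesis by (simp add: poly_altdef)
qed

lemma poly_pderiv_eq_divided_difference:
  assumes "degree p \<le> d"
  shows "poly (pderiv p) z = divided_difference (coeff p) d z z"
proof -
  have "p = (\<Sum>j\<le>d. monom (coeff p j) j)"
    using assms by (intro poly_eqI) (auto simp: coeff_sum coeff_eq_0)
  then have "pderiv p = pderiv (\<Sum>j\<le>d. monom (coeff p j) j)" by simp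
  also have "\<dots> = (\<Sum>j\<le>d. pderiv (monom (coeff p j) j))"
    using higher_pderiv_sum[of 1] by simp
  finally show ?thesis
    by (simp add: divided_difference_diagonal poly_sum pderiv_monom poly_monom)
qed

text \<open>Cauchy's bound: the leading term outweighs the others for larger \<open>z\<close>. It
  keeps the roots of a bounded family of monic polynomials in a compact set.\<close>

lemma monic_root_bound:
  fixes z :: complex
  assumes "c d = 1" "d \<ge> 1" "(\<Sum>j\<le>d. c j * z ^ j) = 0"
  shows "cmod z \<le> 1 + (\<Sum>j<d. cmod (c j))"
proof (cases "cmod z \<le> 1")
  case True
  have "0 \<le> (\<Sum>j<d. cmod (c j))" by (rule sum_nonneg) simp
  with True show ?thesis by linarith
next
  case False
  have "(\<Sum>j\<le>d. c j * z ^ j) = (\<Sum>j<d. c j * z ^ j) + z ^ d"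
    by (simp add: lessThan_Suc_atMost[symmetric] assms(1))
  then have "z ^ d = - (\<Sum>j<d. c j * z ^ j)" using assms(3) by (simp add: eq_neg_iff_add_eq_0 add.commute)
  then have "cmod z ^ d = cmod (\<Sum>j<d. c j * z ^ j)" by (metis norm_minus_cancel norm_power)
  also have "\<dots> \<le> (\<Sum>j<d. cmod (c j) * cmod z ^ (d - 1))"
  proof (rule sum_norm_le)
    fix j assume "j \<in> {..<d}"
    then have "cmod z ^ j \<le> cmod z ^ (d - 1)" using False by (intro power_increasing) auto
    then show "cmod (c j * z ^ j) \<le> cmod (c j) * cmod z ^ (d - 1)"
      by (simp add: norm_mult norm_power mult_left_mono)
  qed
  also have "\<dots> = (\<Sum>j<d. cmod (c j)) * cmod z ^ (d - 1)" by (simp add: sum_distrib_right)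
  finally have "cmod z * cmod z ^ (d - 1) \<le> (\<Sum>j<d. cmod (c j)) * cmod z ^ (d - 1)"
    using assms(2) by (simp add: power_eq_if)
  moreover have "cmod z ^ (d - 1) > 0" using False by (intro zero_less_power) linarith
  ultimately have "cmod z \<le> (\<Sum>j<d. cmod (c j))" by (rule mult_right_le_imp_le)
  then show ?thesis by linarith
qed

lemma coeff_fibre:
  assumes "p \<in> FR n d"
  shows "coeff (fibre p u) j = (\<Sum>m\<in>insert (single 0 d) (coord_monomials n d).
    if lookup m 0 = j then of_real (lookup p m) * (\<Prod>i\<in>{1..n}. of_real (u i) ^ lookup m i) else 0)"
proof -
  have "coeff (fibre p u) j = (\<Sum>m\<in>keys p.
      if lookup m 0 = j then of_real (lookup p m) * (\<Prod>i\<in>{1..n}. of_real (u i) ^ lookup m i) else 0)"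
    using assms unfolding FR_iff by (simp only: fibre_sum_monom[of p n u] coeff_sum coeff_monom)
  also have "\<dots> = (\<Sum>m\<in>insert (single 0 d) (coord_monomials n d).
      if lookup m 0 = j then of_real (lookup p m) * (\<Prod>i\<in>{1..n}. of_real (u i) ^ lookup m i) else 0)"
    using keys_FR[OF assms] finite_coord_monomials by (intro sum.mono_neutral_left) (auto simp: in_keys_iff)
  finally show ?thesis .
qed

lemma cnj_coeff_fibre: "p \<in> FR n d \<Longrightarrow> cnj (coeff (fibre p u) j) = coeff (fibre p u) j"
  by (simp add: coeff_fibre if_distrib cong: if_cong)

text \<open>Nonreal roots and double roots are both expressed by one closed condition, the vanishing
  of the divided difference at \<open>z\<close> and its conjugate. By homogeneity the direction can
  be scaled to maximum norm \<open>1\<close>; the two bounds on \<open>u\<close> confine it to a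
  compact set that avoids \<open>0\<close>.\<close>

lemma not_strictly_hyperbolic_witness:
  assumes p: "p \<in> FR n d" "d \<ge> 1" "\<not> strictly_hyperbolic n p"
  shows "\<exists>u z. (\<forall>i\<in>{1..n}. \<bar>u i\<bar> \<le> 1) \<and> (\<Sum>i\<in>{1..n}. \<bar>u i\<bar>) \<ge> 1 \<and>
    poly (fibre p u) z = 0 \<and> divided_difference (coeff (fibre p u)) d z (cnj z) = 0"
proof -
  have h: "homogeneous d p" and pin: "p \<in> mpolys_in {0..n}" using p(1) by (auto simp: FR_iff)
  obtain u z where uz: "\<exists>i\<in>{1..n}. u i \<noteq> 0" "eval_complex p (fibre_point u z) = 0"
    "Im z \<noteq> 0 \<or> eval_complex (mpderiv 0 p) (fibre_point u z) = 0"
  proof (cases "hyperbolic p")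
    case True
    then have "\<exists>u z. (\<exists>i\<in>{1..n}. u i \<noteq> 0) \<and> eval_complex p (fibre_point u z) = 0 \<and>
        eval_complex (mpderiv 0 p) (fibre_point u z) = 0"
      using strictly_hyperbolic_eval[OF p(1) True] p(3) by simp
    then show ?thesis using that by auto
  next
    case False
    then obtain u z where z: "poly (fibre p u) z = 0" "Im z \<noteq> 0"
      by (auto simp: hyperbolic_def complex_is_Real_iff)
    \<comment> \<open>In the zero direction the fibre is a power of \<open>t\<close>, whose only
      root is real.\<close>
    have "\<exists>i\<in>{1..n}. u i \<noteq> 0"
    proof (rule ccontr)
      assume "\<not> ?thesis"
      then have pt: "\<And>i. i \<le> n \<Longrightarrow> fibre_point u z i = z * (if i = 0 then 1 else 0)"
        by (auto simp: fibre_point_def)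
      have "eval_complex p (fibre_point u z) = eval_complex p (\<lambda>i. z * (if i = 0 then 1 else 0))"
        by (rule eval_complex_cong[OF pin pt])
      also have "\<dots> = z ^ d" unfolding eval_complex_scale[OF h] eval_complex_FR[OF p(1)] by simp
      finally have "z = 0" using z(1) by (simp add: poly_fibre)
      then show False using z(2) by simp
    qed
    then show ?thesis using that z by (auto simp: poly_fibre)
  qed
  define M where "M = Max ((\<lambda>i. \<bar>u i\<bar>) ` {1..n})"
  obtain i0 where i0: "i0 \<in> {1..n}" "u i0 \<noteq> 0" using uz(1) by blast
  have le: "\<bar>u i\<bar> \<le> M" if "i \<in> {1..n}" for i unfolding M_def using that by (intro Max_ge) auto
  have "M \<in> (\<lambda>i. \<bar>u i\<bar>) ` {1..n}" unfolding M_def using i0 by (intro Max_in) auto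
  then obtain i1 where i1: "i1 \<in> {1..n}" "M = \<bar>u i1\<bar>" by blast
  have M0: "M > 0" using le[OF i0(1)] i0(2) by linarith
  define v where "v i = u i / M" for i
  define y where "y = of_real (1 / M) * z"
  have pt: "fibre_point v y = (\<lambda>i. of_real (1 / M) * fibre_point u z i)"
    by (rule ext) (auto simp: fibre_point_def v_def y_def)
  have root: "poly (fibre p v) y = 0"
    unfolding poly_fibre pt eval_complex_scale[OF h] uz(2) by simp
  have "Im y \<noteq> 0 \<or> poly (pderiv (fibre p v)) y = 0"
  proof (cases "Im z = 0")
    case False
    then show ?thesis using M0 by (simp add: y_def)
  next
    case True
    then have "eval_complex (mpderiv 0 p) (fibre_point v y) = 0"
      using uz(3) unfolding pt eval_complex_scale[OF homogeneous_mpderiv[OF h]] by simp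
    then show ?thesis by (simp add: pderiv_fibre[OF pin] poly_fibre)
  qed
  then have "divided_difference (coeff (fibre p v)) d y (cnj y) = 0"
  proof (cases "Im y = 0")
    case True
    then have "cnj y = y" by (simp add: complex_eq_iff)
    with True \<open>Im y \<noteq> 0 \<or> poly (pderiv (fibre p v)) y = 0\<close> show ?thesis
      by (simp add: poly_pderiv_eq_divided_difference[OF fibre_FR(2)[OF p(1)]])
  next
    case False
    have f: "(\<Sum>j\<le>d. coeff (fibre p v) j * y ^ j) = 0"
      using root poly_eq_sum_coeff[OF fibre_FR(2)[OF p(1)]] by simp
    have "(\<Sum>j\<le>d. coeff (fibre p v) j * cnj y ^ j) = cnj (\<Sum>j\<le>d. coeff (fibre p v) j * y ^ j)"
      by (simp add: cnj_coeff_fibre[OF p(1)])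
    then have "(\<Sum>j\<le>d. coeff (fibre p v) j * cnj y ^ j) = 0" using f by simp
    then have "(y - cnj y) * divided_difference (coeff (fibre p v)) d y (cnj y) = 0"
      unfolding divided_difference_mult f by simp
    moreover have "y - cnj y \<noteq> 0" using False by (simp add: complex_eq_iff)
    ultimately show ?thesis by simp
  qed
  moreover have "\<bar>v i\<bar> \<le> 1" if "i \<in> {1..n}" for i using le[OF that] M0 by (simp add: v_def)
  moreover have "(\<Sum>i\<in>{1..n}. \<bar>v i\<bar>) \<ge> 1"
  proof -
    have "\<bar>v i1\<bar> = 1" using i1(2) M0 by (simp add: v_def)
    moreover have "\<bar>v i1\<bar> \<le> (\<Sum>i\<in>{1..n}. \<bar>v i\<bar>)" by (rule member_le_sum[OF i1(1)]) auto
    ultimately show ?thesis by simp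
  qed
  ultimately show ?thesis using root by blast
qed

text \<open>Compactness: otherwise witnesses for the \<open>q k\<close> have a convergent
  subsequence, whose limit is a witness for \<open>p\<close>. As \<open>p\<close> is hyperbolic, the
  limit root is real, so the divided difference there is the derivative and the root is double, in a
  nonzero direction.\<close>

lemma strictly_hyperbolic_limit:
  assumes p: "p \<in> FR n d" "d \<ge> 1" "strictly_hyperbolic n p" and q: "\<And>k. q k \<in> FR n d"
    and lim: "\<And>m. (\<lambda>k. lookup (q k) m) \<longlonglongrightarrow> lookup p m"
  shows "\<exists>k. strictly_hyperbolic n (q k)"
proof (rule ccontr)
  assume "\<not> ?thesis"
  then have "\<forall>k. \<exists>uz. (\<forall>i\<in>{1..n}. \<bar>fst uz i\<bar> \<le> 1) \<and> (\<Sum>i\<in>{1..n}. \<bar>fst uz i\<bar>) \<ge> 1 \<and>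
    poly (fibre (q k) (fst uz)) (snd uz) = 0 \<and>
    divided_difference (coeff (fibre (q k) (fst uz))) d (snd uz) (cnj (snd uz)) = 0"
    using not_strictly_hyperbolic_witness[OF q p(2)] by simp
  then obtain uz where uz: "\<forall>k. (\<forall>i\<in>{1..n}. \<bar>fst (uz k) i\<bar> \<le> 1) \<and> (\<Sum>i\<in>{1..n}. \<bar>fst (uz k) i\<bar>) \<ge> 1 \<and>
    poly (fibre (q k) (fst (uz k))) (snd (uz k)) = 0 \<and>
    divided_difference (coeff (fibre (q k) (fst (uz k)))) d (snd (uz k)) (cnj (snd (uz k))) = 0"
    unfolding choice_iff by blast
  define u where "u k = fst (uz k)" for k
  define z where "z k = snd (uz k)" for k
  have u1: "\<And>k i. i \<in> {1..n} \<Longrightarrow> \<bar>u k i\<bar> \<le> 1" and u2: "\<And>k. (\<Sum>i\<in>{1..n}. \<bar>u k i\<bar>) \<ge> 1"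
    and root: "\<And>k. poly (fibre (q k) (u k)) (z k) = 0"
    and dd: "\<And>k. divided_difference (coeff (fibre (q k) (u k))) d (z k) (cnj (z k)) = 0"
    using uz by (auto simp: u_def z_def)
  let ?M = "insert (single 0 d) (coord_monomials n d)"
  have finM: "finite ?M" using finite_coord_monomials by simp
  have "\<exists>C. \<forall>k. (\<Sum>m\<in>?M. \<bar>lookup (q k) m\<bar>) \<le> C"
  proof -
    have "(\<lambda>k. \<Sum>m\<in>?M. \<bar>lookup (q k) m\<bar>) \<longlonglongrightarrow> (\<Sum>m\<in>?M. \<bar>lookup p m\<bar>)"
      by (intro tendsto_sum tendsto_rabs lim)
    then have "Bseq (\<lambda>k. \<Sum>m\<in>?M. \<bar>lookup (q k) m\<bar>)" by (intro convergent_imp_Bseq convergentI)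
    then obtain C where "\<forall>k. norm (\<Sum>m\<in>?M. \<bar>lookup (q k) m\<bar>) \<le> C" by (auto simp: Bseq_def)
    then have "\<forall>k. (\<Sum>m\<in>?M. \<bar>lookup (q k) m\<bar>) \<le> C" by (auto intro: order_trans[OF abs_ge_self])
    then show ?thesis by blast
  qed
  then obtain C where C: "\<And>k. (\<Sum>m\<in>?M. \<bar>lookup (q k) m\<bar>) \<le> C" by blast
  have coeff_bound: "cmod (coeff (fibre (q k) (u k)) j) \<le> C" for k j
  proof -
    have "cmod (coeff (fibre (q k) (u k)) j) \<le> (\<Sum>m\<in>?M. \<bar>lookup (q k) m\<bar>)"
      unfolding coeff_fibre[OF q]
    proof (rule sum_norm_le)
      fix m
      have "cmod (\<Prod>i\<in>{1..n}. complex_of_real (u k i) ^ lookup m i) \<le> 1"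
        unfolding prod_norm[symmetric] norm_power using u1[of _ k] by (intro prod_le_1) (auto simp: power_le_one)
      then have "cmod (of_real (lookup (q k) m) * (\<Prod>i\<in>{1..n}. of_real (u k i) ^ lookup m i)) \<le> \<bar>lookup (q k) m\<bar>"
        by (simp add: norm_mult mult_left_le)
      then show "cmod (if lookup m 0 = j then of_real (lookup (q k) m) * (\<Prod>i\<in>{1..n}. of_real (u k i) ^ lookup m i) else 0)
          \<le> \<bar>lookup (q k) m\<bar>" by simp
    qed
    then show ?thesis using C[of k] by linarith
  qed
  have z_bound: "cmod (z k) \<le> 1 + real d * C" for k
  proof -
    have "cmod (z k) \<le> 1 + (\<Sum>j<d. cmod (coeff (fibre (q k) (u k)) j))"
      using root poly_eq_sum_coeff[OF fibre_FR(2)[OF q]] fibre_FR(1)[OF q]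
      by (intro monic_root_bound p(2)) auto
    also have "(\<Sum>j<d. cmod (coeff (fibre (q k) (u k)) j)) \<le> of_nat (card {..<d}) * C"
      by (rule sum_bounded_above) (rule coeff_bound)
    finally show ?thesis by simp
  qed
  \<comment> \<open>Root and direction are bundled into complex sequences, so that one common
    subsequence makes all of them converge.\<close>
  define f where "f s k = (if s = 0 then z k else of_real (u k s))" for s k
  have "\<exists>r l. strict_mono (r :: nat \<Rightarrow> nat) \<and> (\<forall>s\<in>{0..n}. (f s \<circ> r) \<longlonglongrightarrow> l s)"
  proof (rule convergent_subsequences)
    fix s assume s: "s \<in> {0..n}"
    show "bounded (range (f s))"
    proof (cases "s = 0")
      case True
      then show ?thesis unfolding bounded_iff using z_bound by (auto simp: f_def)
    next
      case False
      then show ?thesis unfolding bounded_iff using u1[of s] s by (intro exI[of _ 1]) (auto simp: f_def)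
    qed
  qed simp
  then obtain r l where r: "strict_mono (r :: nat \<Rightarrow> nat)" "\<forall>s\<in>{0..n}. (f s \<circ> r) \<longlonglongrightarrow> l s" by blast
  define v where "v i = Re (l i)" for i
  define y where "y = l 0"
  have zlim: "(\<lambda>k. z (r k)) \<longlonglongrightarrow> y"
    using bspec[OF r(2), of 0] by (simp add: f_def y_def comp_def)
  have ulim: "(\<lambda>k. u (r k) i) \<longlonglongrightarrow> v i" if "i \<in> {1..n}" for i
  proof -
    have "i \<in> {0..n}" "i \<noteq> 0" using that by auto
    then have "(\<lambda>k. complex_of_real (u (r k) i)) \<longlonglongrightarrow> l i"
      using bspec[OF r(2), of i] by (simp add: f_def comp_def)
    then have "(\<lambda>k. Re (complex_of_real (u (r k) i))) \<longlonglongrightarrow> Re (l i)" by (rule tendsto_Re)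
    then show ?thesis by (simp add: v_def)
  qed
  have qlim: "(\<lambda>k. lookup (q (r k)) m) \<longlonglongrightarrow> lookup p m" for m
    using LIMSEQ_subseq_LIMSEQ[OF lim r(1)] by (simp add: comp_def)
  have clim: "(\<lambda>k. coeff (fibre (q (r k)) (u (r k))) j) \<longlonglongrightarrow> coeff (fibre p v) j" for j
    unfolding coeff_fibre[OF q] coeff_fibre[OF p(1)]
  proof (intro tendsto_sum)
    fix m
    have "(\<lambda>k. of_real (lookup (q (r k)) m) * (\<Prod>i\<in>{1..n}. complex_of_real (u (r k) i) ^ lookup m i))
        \<longlonglongrightarrow> of_real (lookup p m) * (\<Prod>i\<in>{1..n}. complex_of_real (v i) ^ lookup m i)"
      by (intro tendsto_mult tendsto_of_real qlim tendsto_prod tendsto_power ulim)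
    then show "(\<lambda>k. if lookup m 0 = j then of_real (lookup (q (r k)) m) * (\<Prod>i\<in>{1..n}. complex_of_real (u (r k) i) ^ lookup m i) else 0)
        \<longlonglongrightarrow> (if lookup m 0 = j then of_real (lookup p m) * (\<Prod>i\<in>{1..n}. complex_of_real (v i) ^ lookup m i) else 0)"
      by (cases "lookup m 0 = j") simp_all
  qed
  have "(\<lambda>k. \<Sum>i\<in>{1..n}. \<bar>u (r k) i\<bar>) \<longlonglongrightarrow> (\<Sum>i\<in>{1..n}. \<bar>v i\<bar>)"
    by (intro tendsto_sum tendsto_rabs ulim)
  then have "(\<Sum>i\<in>{1..n}. \<bar>v i\<bar>) \<ge> 1" by (rule LIMSEQ_le_const) (use u2 in auto)
  then have vnz: "\<exists>i\<in>{1..n}. v i \<noteq> 0"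
    by (rule contrapos_pp) simp
  then obtain i where i: "i \<in> {1..n}" "v i \<noteq> 0" by blast
  have "(\<lambda>k. \<Sum>j\<le>d. coeff (fibre (q (r k)) (u (r k))) j * z (r k) ^ j) \<longlonglongrightarrow> (\<Sum>j\<le>d. coeff (fibre p v) j * y ^ j)"
    by (intro tendsto_sum tendsto_mult clim tendsto_power zlim)
  moreover have "(\<Sum>j\<le>d. coeff (fibre (q (r k)) (u (r k))) j * z (r k) ^ j) = 0" for k
    using root[of "r k"] poly_eq_sum_coeff[OF fibre_FR(2)[OF q]] by simp
  ultimately have "(\<Sum>j\<le>d. coeff (fibre p v) j * y ^ j) = 0" using LIMSEQ_unique[OF _ tendsto_const] by simp
  then have py: "poly (fibre p v) y = 0" using poly_eq_sum_coeff[OF fibre_FR(2)[OF p(1)]] by simp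
  then have "y \<in> \<real>" using p(3) by (auto simp: strictly_hyperbolic_def hyperbolic_def)
  then have cy: "cnj y = y" by (simp add: Reals_cnj_iff)
  have "(\<lambda>k. divided_difference (coeff (fibre (q (r k)) (u (r k)))) d (z (r k)) (cnj (z (r k))))
      \<longlonglongrightarrow> divided_difference (coeff (fibre p v)) d y (cnj y)"
    unfolding divided_difference_def
    by (intro tendsto_sum tendsto_mult clim tendsto_power zlim tendsto_cnj)
  then have "divided_difference (coeff (fibre p v)) d y (cnj y) = 0"
    unfolding dd using LIMSEQ_unique[OF _ tendsto_const] by metis
  then have "poly (pderiv (fibre p v)) y = 0"
    using cy by (simp add: poly_pderiv_eq_divided_difference[OF fibre_FR(2)[OF p(1)]])
  then have "eval_complex (mpderiv 0 p) (fibre_point v y) = 0"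
    using p(1) by (simp add: pderiv_fibre[of p n] FR_iff poly_fibre)
  then show False using strictly_hyperbolicD[OF p(1,3) i(1), of v, OF i(2)] py by (simp add: poly_fibre)
qed

text \<open>Reduces to sequences: were it false, a counterexample could be chosen below each
  \<open>1 / (k + 1)\<close>.\<close>

lemma eventually_strictly_hyperbolic:
  assumes p: "p \<in> FR n d" "d \<ge> 1" "strictly_hyperbolic n p" and q: "\<And>e. q e \<in> FR n d"
    and lim: "\<And>m. ((\<lambda>e. lookup (q e) m) \<longlongrightarrow> lookup p m) (at_right (0::real))"
  shows "eventually (\<lambda>e. strictly_hyperbolic n (q e)) (at_right 0)"
proof (rule ccontr)
  assume "\<not> ?thesis"
  then have no: "\<not> (\<exists>b>0. \<forall>y>0. y < b \<longrightarrow> strictly_hyperbolic n (q y))"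
    unfolding eventually_at_right_field by simp
  have "\<forall>k. \<exists>e. e > 0 \<and> e < inverse (real (Suc k)) \<and> \<not> strictly_hyperbolic n (q e)"
  proof
    fix k
    have "\<not> (\<forall>y>0. y < inverse (real (Suc k)) \<longrightarrow> strictly_hyperbolic n (q y))"
    proof
      assume "\<forall>y>0. y < inverse (real (Suc k)) \<longrightarrow> strictly_hyperbolic n (q y)"
      then have "\<exists>b>0. \<forall>y>0. y < b \<longrightarrow> strictly_hyperbolic n (q y)"
        by (intro exI[of _ "inverse (real (Suc k))"]) simp
      with no show False by simp
    qed
    then show "\<exists>e. e > 0 \<and> e < inverse (real (Suc k)) \<and> \<not> strictly_hyperbolic n (q e)" by simp
  qed
  then obtain e where e: "\<forall>k. e k > 0 \<and> e k < inverse (real (Suc k)) \<and> \<not> strictly_hyperbolic n (q (e k))"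
    unfolding choice_iff by blast
  have "e \<longlonglongrightarrow> 0"
  proof (rule tendsto_sandwich[OF _ _ tendsto_const LIMSEQ_inverse_real_of_nat])
    show "\<forall>\<^sub>F k in sequentially. 0 \<le> e k" by (rule always_eventually) (use e less_imp_le in blast)
    show "\<forall>\<^sub>F k in sequentially. e k \<le> inverse (real (Suc k))"
      by (rule always_eventually) (use e less_imp_le in blast)
  qed
  then have "filterlim e (at_right 0) sequentially"
    unfolding at_within_def by (intro filterlim_inf[THEN iffD2] conjI) (use e in \<open>auto simp: filterlim_principal\<close>)
  then have "(\<lambda>k. lookup (q (e k)) m) \<longlonglongrightarrow> lookup p m" for m
    by (rule filterlim_compose[OF lim])
  then have "\<exists>k. strictly_hyperbolic n (q (e k))" by (intro strictly_hyperbolic_limit[OF p] q)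
  with e show False by simp
qed

lemma F_op_0: "F_op n d 0 p = p"
proof -
  have "T_op l 0 p = p" for l p by (simp add: T_op_def mconst_def)
  then have "(T_op l 0 ^^ k) p = p" for l k p by (induction k) simp_all
  then have "F_list d 0 is p = p" for "is" by (induction "is") simp_all
  then show ?thesis unfolding F_op_F_list .
qed

lemma lookup_F_op_tendsto:
  "((\<lambda>e. lookup (F_op n d e p) m) \<longlongrightarrow> lookup p m) (at_right 0)"
proof -
  \<comment> \<open>The coefficients of \<open>F_op n d e p\<close> are polynomials in
    \<open>e\<close>; the parameter space here has a single variable, indexed by the unit
    element.\<close>
  have "poly_family {()} (\<lambda>x. F_op n d (x ()) p)"
    by (intro poly_family_F_op poly_family_const polyfun.var) simp
  then have "polyfun {()} (\<lambda>x. lookup (F_op n d (x ()) p) m)" by (simp add: poly_family_def)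
  then have "((\<lambda>e. lookup (F_op n d ((\<lambda>_. e) ()) p) m) \<longlongrightarrow> lookup (F_op n d ((\<lambda>_. 0) ()) p) m) (at_right (0::real))"
    by (rule polyfun_tendsto[where \<gamma> = "\<lambda>e _. e" and x = "\<lambda>_. 0"]) (rule tendsto_ident_at)
  then show ?thesis by (simp add: F_op_0)
qed

lemma bad_hypersurface:
  assumes "d \<ge> 1"
  obtains F where "F \<in> mpolys_in (coord_monomials n d)" "F \<noteq> 0"
    "\<And>p. p \<in> Hyp n d - good_set n d \<Longrightarrow> mpoly_subst (\<lambda>c. c) (coords n d p) F = 0"
proof -
  let ?I = "coord_monomials n d"
  let ?g = "\<lambda>c. hyperbolic (poly_of n d c) \<and> \<not> strictly_hyperbolic n (poly_of n d c)"
  have "sign_determined ?I ?g" by (rule sign_determined_Inl[OF sign_determined_not_strict])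
  then obtain F where F: "F \<in> mpolys_in ?I" "F \<noteq> 0"
    "\<And>\<gamma> x G. (\<And>v. v \<in> ?I \<Longrightarrow> ((\<lambda>e. \<gamma> e v) \<longlongrightarrow> x v) G) \<Longrightarrow> mpoly_subst (\<lambda>c. c) x F \<noteq> 0 \<Longrightarrow>
       eventually (\<lambda>e::real. ?g (\<gamma> e) = ?g x) G"
    using finite_coord_monomials by (rule sign_determined_generic) blast
  obtain H where H: "H \<in> mpolys_in ?I" "H \<noteq> 0"
    "\<And>p \<tau> z. p \<in> FR n d \<Longrightarrow> strictly_hyperbolic n p \<Longrightarrow> singular_point n (F_op n d \<tau> p) z \<Longrightarrow>
      mpoly_subst (\<lambda>c. c) (coords n d p) H = 0"
    using singular_hypersurface[OF assms] by blast
  have 1: "mpoly_subst (\<lambda>c. c) (coords n d p) F = 0"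
    if p: "p \<in> FR n d" "hyperbolic p" "\<not> strictly_hyperbolic n p" for p
  proof (rule ccontr)
    assume nz: "mpoly_subst (\<lambda>c. c) (coords n d p) F \<noteq> 0"
    have "((\<lambda>e. coords n d (F_op n d e p) m) \<longlongrightarrow> coords n d p m) (at_right 0)" if "m \<in> ?I" for m
      using that lookup_F_op_tendsto[of n d p m] by (simp add: coords_def)
    from F(3)[OF this nz]
    have "eventually (\<lambda>e. ?g (coords n d (F_op n d e p)) = ?g (coords n d p)) (at_right 0)" .
    then have "eventually (\<lambda>e::real. False) (at_right 0)"
      using eventually_at_right_less[of "0::real"]
    proof eventually_elim
      case (elim e)
      have q: "F_op n d e p \<in> FR n d" by (rule F_op_hyperbolic(1)[OF p(1) assms p(2)])
      have "strictly_hyperbolic n (F_op n d e p)"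
        using strictly_hyperbolic_F_op[OF p(1) assms p(2)] elim(2) by simp
      then show ?case using elim(1) p unfolding poly_of_coords[OF q] poly_of_coords[OF p(1)] by simp
    qed
    then show False by simp
  qed
  show thesis
  proof (rule that)
    show "F * H \<in> mpolys_in ?I" by (rule mpolys_in_mult[OF F(1) H(1)])
    show "F * H \<noteq> 0" using F(2) H(2) by simp
    fix p assume bad: "p \<in> Hyp n d - good_set n d"
    then have p: "p \<in> FR n d" "hyperbolic p" by (auto simp: Hyp_def)
    have "mpoly_subst (\<lambda>c. c) (coords n d p) F = 0 \<or> mpoly_subst (\<lambda>c. c) (coords n d p) H = 0"
    proof (cases "strictly_hyperbolic n p")
      case False
      then show ?thesis using 1[OF p] by simp
    next
      case True
      then obtain s where s: "s \<in> {0<..1}" "\<not> smooth_hypersurface n (N_op n d s p)"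
        using bad bad_iff[OF p(1) assms] by auto
      then obtain z where "singular_point n (N_op n d s p) z" by (auto simp: not_smooth_iff)
      then obtain z' where "singular_point n (F_op n d ((1 - s) / s) p) z'"
        using singular_point_N_op[of s n d p z] s(1) by auto
      then show ?thesis using H(3)[OF p(1) True] by simp
    qed
    then show "mpoly_subst (\<lambda>c. c) (coords n d p) (F * H) = 0"
      by (auto simp: mpoly_subst_simps[OF semiring_hom_id])
  qed
qed

section \<open>Approximation by good polynomials\<close>

lemma eventually_openin_FR:
  assumes U: "openin (FR_topology n d) U" "p \<in> U" and q: "eventually (\<lambda>e. q e \<in> FR n d) G"
    and lim: "\<And>m. m \<in> coord_monomials n d \<Longrightarrow> ((\<lambda>e. lookup (q e) m) \<longlongrightarrow> lookup p m) G"
  shows "eventually (\<lambda>e. q e \<in> U) G"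
proof -
  let ?I = "coord_monomials n d"
  obtain W where W: "openin (product_topology (\<lambda>_. euclideanreal) ?I) W" "U = coords n d -` W \<inter> FR n d"
    using U(1) by (auto simp: FR_topology_def openin_pullback_topology)
  have "coords n d p \<in> W" using U(2) W(2) by simp
  then obtain B where B: "\<forall>i\<in>?I. openin euclideanreal (B i)" "coords n d p \<in> Pi\<^sub>E ?I B" "Pi\<^sub>E ?I B \<subseteq> W"
    using W(1) unfolding openin_product_topology_alt by blast
  have "eventually (\<lambda>e. lookup (q e) m \<in> B m) G" if "m \<in> ?I" for m
  proof (rule topological_tendstoD[OF lim[OF that]])
    show "open (B m)" using B(1) that by simp
    show "lookup p m \<in> B m" using PiE_mem[OF B(2) that] that by (simp add: coords_def)
  qed
  then have "eventually (\<lambda>e. \<forall>m\<in>?I. lookup (q e) m \<in> B m) G"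
    by (intro eventually_ball_finite finite_coord_monomials) simp
  with q show ?thesis
  proof eventually_elim
    case (elim e)
    have "coords n d (q e) \<in> Pi\<^sub>E ?I B" using elim(2) by (auto simp: coords_def)
    then show ?case using B(3) elim(1) W(2) by auto
  qed
qed

text \<open>On the line \<open>F\<close> is a univariate polynomial in \<open>e\<close>; it is
  nonzero because of its value at \<open>e = 1\<close>, so its finitely many zeros stay away from
  small \<open>e > 0\<close>.\<close>

lemma eventually_mpoly_line_nonzero:
  fixes F :: "('v, real) mpoly"
  assumes "mpoly_subst (\<lambda>c. c) (\<lambda>v. x v + y v) F \<noteq> 0"
  shows "eventually (\<lambda>e. mpoly_subst (\<lambda>c. c) (\<lambda>v. x v + e * y v) F \<noteq> 0) (at_right (0::real))"
proof -
  let ?P = "mpoly_subst (\<lambda>c. [:c:]) (\<lambda>v. [:x v, y v:]) F"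
  have ev: "poly ?P e = mpoly_subst (\<lambda>c. c) (\<lambda>v. x v + e * y v) F" for e
    by (simp add: mpoly_subst_def poly_sum poly_prod)
  have "?P \<noteq> 0" using assms ev[of 1] by auto
  then have fin: "finite {e. poly ?P e = 0}" by (rule poly_roots_finite)
  have "eventually (\<lambda>e. e \<notin> {e. poly ?P e = 0}) (at 0)"
    using islimpt_finite[OF fin, of 0] by (simp add: islimpt_iff_eventually)
  then have "eventually (\<lambda>e. e \<notin> {e. poly ?P e = 0}) (at_right 0)"
    by (simp add: eventually_at_split)
  then show ?thesis by (simp add: ev)
qed

lemma strictly_hyperbolic_imp_Hyp: "p \<in> FR n d \<Longrightarrow> strictly_hyperbolic n p \<Longrightarrow> p \<in> Hyp n d"
  by (simp add: Hyp_def strictly_hyperbolic_def)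

lemma good_set_dense:
  assumes "d \<ge> 1"
  shows "Hyp n d \<subseteq> FR_topology n d closure_of good_set n d"
proof
  fix p assume "p \<in> Hyp n d"
  then have p: "p \<in> FR n d" "hyperbolic p" by (auto simp: Hyp_def)
  let ?I = "coord_monomials n d"
  show "p \<in> FR_topology n d closure_of good_set n d"
    unfolding in_closure_of
  proof (intro conjI allI impI)
    show "p \<in> topspace (FR_topology n d)"
      using p(1) coords_affine_space[of n d p] by (simp add: FR_topology_def topspace_pullback_topology)
    fix U assume U: "p \<in> U \<and> openin (FR_topology n d) U"
    have "eventually (\<lambda>e. F_op n d e p \<in> U) (at_right 0)"
      using U F_op_hyperbolic(1)[OF p(1) assms p(2)] lookup_F_op_tendsto
      by (intro eventually_openin_FR) auto
    then have "eventually (\<lambda>e. F_op n d e p \<in> U \<and> 0 < e) (at_right 0)"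
      using eventually_at_right_less[of "0::real"] by (rule eventually_conj)
    then obtain e where e: "F_op n d e p \<in> U" "0 < e"
      using eventually_happens'[of "at_right (0::real)"] by auto
    define q where "q = F_op n d e p"
    have q: "q \<in> FR n d" "strictly_hyperbolic n q" "q \<in> U"
      unfolding q_def using F_op_hyperbolic(1)[OF p(1) assms p(2)] strictly_hyperbolic_F_op[OF p(1) assms p(2)] e
      by auto
    obtain F where F: "F \<in> mpolys_in ?I" "F \<noteq> 0"
      "\<And>p. p \<in> Hyp n d - good_set n d \<Longrightarrow> mpoly_subst (\<lambda>c. c) (coords n d p) F = 0"
      using bad_hypersurface[OF assms] by blast
    obtain x where x: "mpoly_subst (\<lambda>c. c) x F \<noteq> 0"
      using mpoly_eq_0[OF finite_coord_monomials F(1)] F(2) by blast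
    \<comment> \<open>The line from \<open>q\<close> towards a point \<open>x\<close> off the
      hypersurface. For small \<open>e > 0\<close> it avoids the hypersurface, stays in
      \<open>U\<close> and remains strictly hyperbolic.\<close>
    define \<gamma> where "\<gamma> e m = coords n d q m + e * (x m - coords n d q m)" for e m
    let ?r = "\<lambda>e. poly_of n d (\<gamma> e)"
    have lim: "((\<lambda>e. lookup (?r e) m) \<longlongrightarrow> lookup q m) (at_right 0)" for m
    proof -
      have "((\<lambda>e. \<gamma> e m) \<longlongrightarrow> coords n d q m + 0 * (x m - coords n d q m)) (at_right 0)"
        unfolding \<gamma>_def by (intro tendsto_intros)
      moreover have "lookup q m = (if m = single 0 d then 1 else if m \<in> ?I then coords n d q m else 0)"
        using lookup_poly_of[of n d "coords n d q" m] unfolding poly_of_coords[OF q(1)] .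
      ultimately show ?thesis by (simp add: lookup_poly_of)
    qed
    have "eventually (\<lambda>e. mpoly_subst (\<lambda>c. c) (\<gamma> e) F \<noteq> 0) (at_right 0)"
      unfolding \<gamma>_def by (rule eventually_mpoly_line_nonzero) (use x in simp)
    moreover have "eventually (\<lambda>e. ?r e \<in> U) (at_right 0)"
      using U q(3) lim by (intro eventually_openin_FR[where p = q]) (auto simp: poly_of_FR)
    moreover have "eventually (\<lambda>e. strictly_hyperbolic n (?r e)) (at_right 0)"
      by (rule eventually_strictly_hyperbolic[OF q(1) assms q(2) poly_of_FR lim])
    ultimately have "eventually (\<lambda>e. mpoly_subst (\<lambda>c. c) (\<gamma> e) F \<noteq> 0 \<and> ?r e \<in> U \<and> strictly_hyperbolic n (?r e)) (at_right 0)"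
      by (intro eventually_conj)
    then obtain e where e: "mpoly_subst (\<lambda>c. c) (\<gamma> e) F \<noteq> 0" "?r e \<in> U" "strictly_hyperbolic n (?r e)"
      using eventually_happens'[of "at_right (0::real)"] by auto
    \<comment> \<open>As \<open>x\<close> need not be extensional, \<open>\<gamma> e\<close> is
      compared with genuine coordinates only on the variables of \<open>F\<close>.\<close>
    have eq: "mpoly_subst (\<lambda>c. c) (coords n d (?r e)) F = mpoly_subst (\<lambda>c. c) (\<gamma> e) F"
      by (rule mpoly_subst_cong[OF F(1)]) (auto simp: coords_def lookup_poly_of coord_monomials_def)
    have "?r e \<notin> Hyp n d - good_set n d" using F(3)[of "?r e"] e(1) unfolding eq by blast
    then have "?r e \<in> good_set n d" using strictly_hyperbolic_imp_Hyp[OF poly_of_FR e(3)] by blast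
    then show "\<exists>y. y \<in> good_set n d \<and> y \<in> U" using e(2) by blast
  qed
qed

lemma positive_codim_bad:
  assumes "d \<ge> 1"
  shows "positive_codim_in_FR n d (Hyp n d - good_set n d)"
proof -
  obtain F where F: "F \<in> mpolys_in (coord_monomials n d)" "F \<noteq> 0"
    "\<And>p. p \<in> Hyp n d - good_set n d \<Longrightarrow> mpoly_subst (\<lambda>c. c) (coords n d p) F = 0"
    using bad_hypersurface[OF assms] by blast
  have "coords n d ` FR n d = affine_space (coord_monomials n d)"
    using poly_of_FR by (simp add: coords_image)
  moreover have "semialg_dim (coord_monomials n d) (coords n d ` (Hyp n d - good_set n d))
      < semialg_dim (coord_monomials n d) (affine_space (coord_monomials n d))"
    by (rule semialg_dim_less[OF finite_coord_monomials F(1,2)]) (use F(3) in blast)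
  ultimately show ?thesis by (simp add: positive_codim_in_FR_def)
qed

theorem proposition2p7:
  fixes d n :: nat
  assumes "d \<ge> 1" and "n \<ge> 1"
  shows "good_set n d \<subseteq> Hyp n d \<and>
         Hyp n d \<subseteq> FR_topology n d closure_of good_set n d \<and>
         semialgebraic_in_FR n d (Hyp n d - good_set n d) \<and>
         positive_codim_in_FR n d (Hyp n d - good_set n d)"
proof (intro conjI)
  show "good_set n d \<subseteq> Hyp n d"
    using strictly_hyperbolic_imp_Hyp by (auto simp: good_set_def)
qed (intro good_set_dense semialgebraic_bad positive_codim_bad assms)+

end
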